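(* Consider the randomised algorithm AltsymTest described in the context, where $n$ denotes the degree of the input permutation group $G \le S_n$. 1. For all $\varepsilon > 0$ and $N > 0$ there exists $k = k(N,\varepsilon)$ such that if the input to AltsymTest is $(G,k)$, with $n \ge N$ and $A_n \le G$, then the probability that AltsymTest returns false is $< \varepsilon$. 2. For fixed $\varepsilon > 0$, we may take $k(N,\varepsilon)$ to be a non-increasing function of $N$, with limit $1$ as $N \to \infty$.
   Context: All logarithms are natural. $S_n$ and $A_n$ are the symmetric and alternating groups of degree $n$. The cycle type (cycle structure) of $x\in S_n$ is the multiset of lengths of all its cycles, including fixed points as cycles of length 1; the number of cycles counts fixed points. **JordanTest.** Input: the cycle type of a permutation $x \in S_n$. It returns true if some power $y$ of $x$ has one of the cycle types listed below, and false otherwise: - (J1) $y$ is an $\ell$-cycle (one cycle of length $\ell$ and $n-\ell$ fixed points) with $1 < \ell < n-2$. - (J2) $y$ has prime order $p$, with exactly $m$ $p$-cycles and $k$ fixed points (so $n = mp+k$), where $m<p$, and one of the following holds: $m=2$ and ($k>3$, or $p>3$ and $k>2$); $m=3$ and $k>3$; $m=4$ and ($k>5$, or $p>5$ and $k>4$); $m=5$ and $k>2$; $m=6$ and ($k>7$, or $p>7$ and $k>6$); $m=7$ and $k>8$. - (J3) $y$ has prime order $p$, with exactly $m$ $p$-cycles and $k$ fixed points, where $m>5$, $p>2m-2$ and $k>4m-4$. - (J4) $y$ has prime order $p$, with exactly $m$ $p$-cycles and $k$ fixed points, where $1<m<p$, $k>5m/2-2$, $n\neq 9$ and $n \ne \binom{c}{2}$,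 where $c = m+(p+1)/2$. (In (J2)–(J4), $k$ denotes a number of fixed points, unrelated to the input parameter $k$ of AltsymTest.) **Elimination of $r$.** Let $r$ be a divisor of $n$ with $1<r<n$, and put $s=n/r$. The cycle type of $x\in S_n$ eliminates $r$ if $x$ has a cycle, of length $\ell$ say, for which there is no integer $c\ge 1$ satisfying both: (i) $c$ divides $\ell$, $\ell \le cs$ and $c\le r$; and (ii) there is a (possibly empty) set of other cycles of $x$, all with lengths that are multiples of $c$, whose lengths add up to $cs-\ell$. **AltsymTest.** Input: generators for a group $G\le S_n$ and an integer $k\ge 0$. The algorithm runs as follows. 1. If $G$ is not transitive, return false. 2. Set jordan := false, and r_list := the list of all divisors $r$ of $n$ with $1<r<n$. 3. For $i = 1,\dots,k$ do: (a) if jordan is true and r_list is empty, return true; (b) choose a random element $x\in G$ (uniformly distributed on $G$, independently of all previous choices), and compute its cycle type; (c) if the number of cycles of $x$ is $< 2\log n$, then: if jordan is false, set jordan to the result of JordanTest on the cycle type of $x$; and remove from r_list every $r$ that is eliminated by the cycle type of $x$. 4. Return true if jordan is true and r_list is empty; otherwise return false. The probability is over the random choices of elements of $G$.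
   Formalization: The inputs with n ≤ 4, and with n = 5 or 6 and G = A_n, are excluded; on exactly these AltsymTest returns false with probability 1 for every k, so the claim as stated fails for them when N ≤ 6 and ε ≤ 1. *)

theory Defs
  imports
    "HOL-Probability.Probability"
    "HOL-Computational_Algebra.Primes"
    "HOL-Combinatorics.Orbits"
    "HOL-Algebra.Sym_Groups"
begin

(* Permutations of degree n act on {1..n}, as in sym_group and alt_group.
   Orbits are collected as a set of sets, so each cycle is counted once;
   fixed points contribute parts equal to 1. *)
definition cycle_type :: "nat \<Rightarrow> (nat \<Rightarrow> nat) \<Rightarrow> nat multiset" where
  "cycle_type n x = image_mset card (mset_set (orbit x ` {1..n}))"

definition jordan_type1 :: "nat \<Rightarrow> nat multiset \<Rightarrow> bool" where
  "jordan_type1 n T \<longleftrightarrow>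
     (\<exists>l. 1 < l \<and> l < n - 2 \<and> T = {#l#} + replicate_mset (n - l) 1)"

(* For m > 0, the type of an element of prime order p with m p-cycles and k fixed points. *)
definition prime_order_type :: "nat \<Rightarrow> nat \<Rightarrow> nat \<Rightarrow> nat \<Rightarrow> nat multiset \<Rightarrow> bool" where
  "prime_order_type n p m k T \<longleftrightarrow>
     prime p \<and> n = m * p + k \<and> T = replicate_mset m p + replicate_mset k 1"

definition jordan_type2 :: "nat \<Rightarrow> nat multiset \<Rightarrow> bool" where
  "jordan_type2 n T \<longleftrightarrow>
     (\<exists>p m k. prime_order_type n p m k T \<and> m < p \<and>
        (m = 2 \<and> (k > 3 \<or> p > 3 \<and> k > 2) \<or>
         m = 3 \<and> k > 3 \<or>
         m = 4 \<and> (k > 5 \<or> p > 5 \<and> k > 4) \<or>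
         m = 5 \<and> k > 2 \<or>
         m = 6 \<and> (k > 7 \<or> p > 7 \<and> k > 6) \<or>
         m = 7 \<and> k > 8))"

definition jordan_type3 :: "nat \<Rightarrow> nat multiset \<Rightarrow> bool" where
  "jordan_type3 n T \<longleftrightarrow>
     (\<exists>p m k. prime_order_type n p m k T \<and> m > 5 \<and> p > 2 * m - 2 \<and> k > 4 * m - 4)"

(* The division by 2 is exact: 1 < m < p forces the prime p to be odd. *)
definition jordan_type4 :: "nat \<Rightarrow> nat multiset \<Rightarrow> bool" where
  "jordan_type4 n T \<longleftrightarrow>
     (\<exists>p m k. prime_order_type n p m k T \<and> 1 < m \<and> m < p \<and>
        real k > 5 * real m / 2 - 2 \<and> n \<noteq> 9 \<and> n \<noteq> (m + (p + 1) div 2) choose 2)"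

(* The test receives only the cycle type T, represented here by some permutation x of type T.
   The choice of x does not matter, as permutations of equal cycle type are conjugate. *)
definition jordan_test :: "nat \<Rightarrow> nat multiset \<Rightarrow> bool" where
  "jordan_test n T \<longleftrightarrow>
     (\<exists>x i. x permutes {1..n} \<and> cycle_type n x = T \<and>
        (let Y = cycle_type n (x ^^ i) in
         jordan_type1 n Y \<or> jordan_type2 n Y \<or> jordan_type3 n Y \<or> jordan_type4 n Y))"

(* A set of cycles other than the chosen one of length l corresponds to a
   sub-multiset M of T - {#l#}. *)
definition eliminates :: "nat \<Rightarrow> nat multiset \<Rightarrow> nat \<Rightarrow> bool" where
  "eliminates n T r \<longleftrightarrow>
     (let s = n div r in
      \<exists>l \<in># T. \<not> (\<exists>c \<ge> 1. c dvd l \<and> l \<le> c * s \<and> c \<le> r \<and>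
        (\<exists>M. M \<subseteq># T - {#l#} \<and> (\<forall>j \<in># M. c dvd j) \<and> \<Sum>\<^sub># M = c * s - l)))"

definition transitive_perms :: "nat \<Rightarrow> (nat \<Rightarrow> nat) set \<Rightarrow> bool" where
  "transitive_perms n G \<longleftrightarrow> (\<forall>a \<in> {1..n}. \<forall>b \<in> {1..n}. \<exists>g \<in> G. g a = b)"

(* Arguments: degree, group, iterations left, jordan flag, r_list. *)
fun altsym_loop ::
  "nat \<Rightarrow> (nat \<Rightarrow> nat) set \<Rightarrow> nat \<Rightarrow> bool \<Rightarrow> nat list \<Rightarrow> bool pmf" where
  "altsym_loop n G 0 jordan rs = return_pmf (jordan \<and> rs = [])"
| "altsym_loop n G (Suc i) jordan rs =
     (if jordan \<and> rs = [] then return_pmf True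
      else bind_pmf (pmf_of_set G) (\<lambda>x.
        let T = cycle_type n x in
        if real (size T) < 2 * ln (real n)
        then altsym_loop n G i (if jordan then jordan else jordan_test n T)
               (filter (\<lambda>r. \<not> eliminates n T r) rs)
        else altsym_loop n G i jordan rs))"

definition altsym_test :: "nat \<Rightarrow> (nat \<Rightarrow> nat) set \<Rightarrow> nat \<Rightarrow> bool pmf" where
  "altsym_test n G k =
     (if \<not> transitive_perms n G then return_pmf False
      else altsym_loop n G k False (filter (\<lambda>r. r dvd n) [2..<n]))"

(* Among the groups A_n \<le> G \<le> S_n, these are exactly the ones for which the test returns
   False with probability 1 for every k: no element of G with fewer than 2 ln n cycles
   has a power of one of the four types above. *)
definition exceptional_input :: "nat \<Rightarrow> (nat \<Rightarrow> nat) set \<Rightarrow> bool" where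
  "exceptional_input n G \<longleftrightarrow> n \<le> 4 \<or> n \<le> 6 \<and> G = carrier (alt_group n)"

end

theory Submission
  imports Defs "HOL-Real_Asymp.Real_Asymp"
begin

text \<open>
  Averaging \<open>w (l\<^sub>1) \<dots> w (l\<^sub>k)\<close> over the cycle lengths of a random permutation of degree \<open>n\<close> gives the
  coefficient of \<open>x ^ n\<close> in \<open>exp (\<Sum>l. w l * x ^ l / l)\<close>, and suitable weights \<open>w\<close> bound the probability of
  every event below by a Markov inequality. Let \<open>q = n powr (1 / 96)\<close>. With probability tending to \<open>1\<close>:
  there are few cycles; no union of cycles has size \<open>c * n / r\<close> with \<open>1 \<le> c < r \<le> q\<^sup>2\<close>; no two cycle
  lengths share a divisor \<open>\<ge> q\<close>; no \<open>s\<close> with \<open>2 \<le> s \<le> q\<^sup>2\<close> divides all cycle lengths \<open>\<ge> q\<^sup>2\<close>; two cycles have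
  length \<open>\<ge> n / q\<close>; and some cycle length \<open>l \<ge> q\<^sup>2\<close> has a prime divisor \<open>p\<close> with \<open>p\<^sup>2 \<ge> 9 * l\<close>, since such \<open>l\<close>
  have positive logarithmic density by a Mertens-type estimate.

  If \<open>r\<close> is not eliminated, every cycle of length \<open>l\<close> permutes cyclically some \<open>c\<close> of \<open>r\<close> putative blocks of
  size \<open>s = n / r\<close>. For \<open>r \<le> q\<^sup>2\<close>, take a cycle with \<open>\<not> r dvd l\<close>: then \<open>c < r\<close>, and a union of cycles has size
  \<open>c * s\<close>. For \<open>r > q\<^sup>2\<close>, cycles with \<open>l \<ge> q * s\<close> have \<open>c \<ge> q\<close>, so they fill their blocks alone and \<open>s dvd l\<close>;
  this fails for one of the two long cycles if \<open>s \<ge> q\<close>, and for some cycle of length \<open>\<ge> q\<^sup>2\<close> if \<open>s < q\<close>. The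
  cycle with the large prime divisor \<open>p\<close> has a power consisting of \<open>m \<le> p / 9\<close> cycles of length \<open>p\<close>, which is
  of Jordan type. In the remaining finitely many degrees, explicit elements show that a failure in every
  round has probability decreasing geometrically in the number of rounds.
\<close>

section \<open>Cycle lengths of permutations\<close>

text \<open>The cycle type over an arbitrary finite carrier, because the recursions below remove one
  cycle and continue on its complement.\<close>

definition cycle_mset :: "'a set \<Rightarrow> ('a \<Rightarrow> 'a) \<Rightarrow> nat multiset" where
  "cycle_mset A x = image_mset card (mset_set (orbit x ` A))"

lemma cycle_type_eq: "cycle_type n x = cycle_mset {1..n} x"
  by (simp add: cycle_type_def cycle_mset_def)

lemma permutes_self_in_orbit:
  assumes "x permutes A" "finite A"
  shows "a \<in> orbit x a"
  by (rule permutation_self_in_orbit[OF permutes_imp_permutation[OF assms(2,1)]])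

lemma permutes_orbit_eq:
  assumes "x permutes A" "finite A" "b \<in> orbit x a"
  shows "orbit x b = orbit x a"
  using cyclic_on_orbit[OF assms(1,2), of a] assms(3) by (simp add: cyclic_on_alldef)

lemma Union_orbits:
  assumes "x permutes A" "finite A"
  shows "\<Union>(orbit x ` A) = A"
proof
  show "\<Union>(orbit x ` A) \<subseteq> A" using permutes_orbit_subset[OF assms(1)] by auto
  show "A \<subseteq> \<Union>(orbit x ` A)" using permutes_self_in_orbit[OF assms] by auto
qed

lemma disjoint_orbits:
  assumes "x permutes A" "finite A" "O1 \<in> orbit x ` A" "O2 \<in> orbit x ` A" "O1 \<noteq> O2"
  shows "O1 \<inter> O2 = {}"
proof -
  obtain a b where ab: "O1 = orbit x a" "O2 = orbit x b" using assms(3,4) by auto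
  show ?thesis
    using assms(5) permutes_orbit_eq[OF assms(1,2)] unfolding ab by (metis disjoint_iff)
qed

lemma orbits_facts:
  assumes "x permutes A" "finite A" "O1 \<in> orbit x ` A"
  shows "finite O1" "O1 \<subseteq> A" "O1 \<noteq> {}" "x ` O1 = O1"
proof -
  show "O1 \<subseteq> A" using assms(3) permutes_orbit_subset[OF assms(1)] by blast
  then show "finite O1" using assms(2) finite_subset by blast
  show "O1 \<noteq> {}" using assms(3) orbit_nonempty by (metis imageE)
  have "x ` O1 \<subseteq> O1" using assms(3) by (auto intro: orbit.intros)
  moreover have "inj_on x O1" using permutes_inj_on[OF assms(1)] .
  ultimately show "x ` O1 = O1" using \<open>finite O1\<close> by (simp add: endo_inj_surj)
qed

lemma sum_mset_cycle_mset:
  assumes "x permutes A" "finite A"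
  shows "\<Sum>\<^sub># (cycle_mset A x) = card A"
proof -
  have "\<Sum>\<^sub># (cycle_mset A x) = (\<Sum>O1\<in>orbit x ` A. card O1)"
    by (simp add: cycle_mset_def sum_unfold_sum_mset)
  also have "\<dots> = card (\<Union>(orbit x ` A))"
  proof (rule card_Union_disjoint[symmetric])
    show "pairwise disjnt (orbit x ` A)"
      using disjoint_orbits[OF assms] unfolding pairwise_def disjnt_def by metis
  qed (use orbits_facts[OF assms] in auto)
  finally show ?thesis using Union_orbits[OF assms] by simp
qed

lemma zero_notin_cycle_mset:
  assumes "x permutes A" "finite A"
  shows "0 \<notin># cycle_mset A x"
proof
  assume "0 \<in># cycle_mset A x"
  then obtain a where "a \<in> A" "card (orbit x a) = 0"
    using assms(2) by (auto simp: cycle_mset_def)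
  then show False using orbits_facts[OF assms, of "orbit x a"] by (simp add: card_eq_0_iff)
qed

lemma cycle_mset_single:
  assumes "orbit x a = A" "a \<in> A" "x permutes A" "finite A"
  shows "cycle_mset A x = {#card A#}"
proof -
  have "orbit x ` A = {A}" using permutes_orbit_eq[OF assms(3,4), of _ a] assms(1,2) by auto
  then show ?thesis by (simp add: cycle_mset_def)
qed

section \<open>Products of permutations of disjoint sets\<close>

context
  fixes C D :: "'a set" and s t :: "'a \<Rightarrow> 'a"
  assumes fin: "finite C" "finite D" and disj: "C \<inter> D = {}"
    and s: "s permutes C" and t: "t permutes D"
begin

lemma orbit_comp_left: "c \<in> C \<Longrightarrow> orbit (s \<circ> t) c = orbit s c"
proof (rule orbit_cong0[of _ C])
  have *: "(s \<circ> t) y = s y" if "y \<in> C" for y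
    using that disj permutes_not_in[OF t, of y] by (auto simp: disjoint_iff)
  then show "\<And>y. y \<in> C \<Longrightarrow> (s \<circ> t) y = s y" .
  show "s \<circ> t \<in> C \<rightarrow> C" using * permutes_in_image[OF s] by auto
qed

lemma orbit_comp_right: "d \<in> D \<Longrightarrow> orbit (s \<circ> t) d = orbit t d"
proof (rule orbit_cong0[of _ D])
  have *: "(s \<circ> t) y = t y" if "y \<in> D" for y
    using that disj permutes_in_image[OF t] permutes_not_in[OF s, of "t y"] by auto
  then show "\<And>y. y \<in> D \<Longrightarrow> (s \<circ> t) y = t y" .
  show "s \<circ> t \<in> D \<rightarrow> D" using * permutes_in_image[OF t] by auto
qed

lemma comp_permutes_Un: "s \<circ> t permutes C \<union> D"
  by (intro permutes_compose permutes_subset[OF s] permutes_subset[OF t]) auto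

lemma cycle_mset_comp: "cycle_mset (C \<union> D) (s \<circ> t) = cycle_mset C s + cycle_mset D t"
proof -
  have im: "orbit (s \<circ> t) ` (C \<union> D) = orbit s ` C \<union> orbit t ` D"
    using orbit_comp_left orbit_comp_right by (auto simp: image_Un)
  have "orbit s ` C \<inter> orbit t ` D = {}"
  proof (rule ccontr)
    assume "orbit s ` C \<inter> orbit t ` D \<noteq> {}"
    then obtain X where X: "X \<in> orbit s ` C" "X \<in> orbit t ` D" by auto
    show False
      using orbits_facts(2,3)[OF s fin(1) X(1)] orbits_facts(2)[OF t fin(2) X(2)] disj by auto
  qed
  then show ?thesis
    unfolding cycle_mset_def im by (subst mset_set_Union) (use fin in auto)
qed

end

lemma cycle_mset_comp_Diff:
  assumes "finite A" "C \<subseteq> A" "s permutes C" "t permutes A - C"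
  shows "cycle_mset A (s \<circ> t) = cycle_mset C s + cycle_mset (A - C) t"
proof -
  have "C \<union> (A - C) = A" using assms by auto
  then show ?thesis
    using cycle_mset_comp[of C "A - C" s t] assms finite_subset[OF assms(2,1)] by auto
qed

text \<open>A permutation that leaves \<open>C\<close> invariant is determined by its restrictions
  to \<open>C\<close> and to \<open>A - C\<close>, which can be chosen independently. Restriction by
  \<open>restrict_id\<close> is inverse to composition.\<close>

lemma sum_permutes_invariant:
  assumes fin: "finite A" and sub: "C \<subseteq> A"
  shows "(\<Sum>x | x permutes A \<and> x ` C = C. F x) =
         (\<Sum>s | s permutes C. \<Sum>t | t permutes A - C. F (s \<circ> t))"
proof -
  have finC: "finite C" using fin sub finite_subset by blast
  have "(\<Sum>x | x permutes A \<and> x ` C = C. F x) =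
      (\<Sum>(s, t)\<in>{s. s permutes C} \<times> {t. t permutes A - C}. F (s \<circ> t))"
  proof (rule sum.reindex_bij_witness[where i = "\<lambda>(s,t). s \<circ> t" and
        j = "\<lambda>x. (restrict_id x C, restrict_id x (A - C))"])
    fix x assume x: "x \<in> {x. x permutes A \<and> x ` C = C}"
    have 1: "bij_betw x C C"
      using x permutes_inj_on[of x A C] by (simp add: bij_betw_def)
    have "x ` (A - C) = x ` A - x ` C"
      using x permutes_inj[of x A] by (simp add: image_set_diff)
    then have "x ` (A - C) = A - C" using x permutes_image[of x A] by simp
    then have 2: "bij_betw x (A - C) (A - C)"
      using x permutes_inj_on[of x A "A - C"] by (simp add: bij_betw_def)
    show "(restrict_id x C, restrict_id x (A - C)) \<in> {s. s permutes C} \<times> {t. t permutes A - C}"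
      using permutes_restrict_id[OF 1] permutes_restrict_id[OF 2] by simp
    have "restrict_id x C (restrict_id x (A - C) a) = x a" for a
    proof (cases "a \<in> A - C")
      case True
      then have "x a \<in> A - C" using 2 by (auto simp: bij_betw_def)
      then show ?thesis using True by simp
    next
      case False
      then show ?thesis
        using sub x permutes_not_in[of x A a] by (cases "a \<in> C") (simp_all add: restrict_id_def)
    qed
    then have *: "restrict_id x C \<circ> restrict_id x (A - C) = x"
      by (simp add: fun_eq_iff)
    show "(case (restrict_id x C, restrict_id x (A - C)) of (s, t) \<Rightarrow> s \<circ> t) = x"
      using * by (simp only: prod.case)
    show "(case (restrict_id x C, restrict_id x (A - C)) of (s, t) \<Rightarrow> F (s \<circ> t)) = F x"
      using * by (simp only: prod.case)
  next
    fix p assume p: "p \<in> {s. s permutes C} \<times> {t. t permutes A - C}"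
    obtain s t where [simp]: "p = (s, t)" by force
    have s: "s permutes C" and t: "t permutes A - C" using p by auto
    have st1: "(s \<circ> t) a = s a" if "a \<in> C" for a
      using that permutes_not_in[OF t, of a] by simp
    have st2: "(s \<circ> t) a = t a" if "a \<in> A - C" for a
      using that permutes_not_in[OF s, of "t a"] permutes_in_image[OF t, of a] by simp
    have "restrict_id (s \<circ> t) C = s"
      using st1 permutes_not_in[OF s] by (auto simp: restrict_id_def fun_eq_iff)
    moreover have "restrict_id (s \<circ> t) (A - C) = t"
      using st2 permutes_not_in[OF t] by (auto simp: restrict_id_def fun_eq_iff)
    ultimately show "(restrict_id (case p of (s, t) \<Rightarrow> s \<circ> t) C,
         restrict_id (case p of (s, t) \<Rightarrow> s \<circ> t) (A - C)) = p" by simp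
    have "(s \<circ> t) ` C = s ` C" using st1 by (intro image_cong) auto
    then have "(s \<circ> t) ` C = C" using permutes_image[OF s] by simp
    moreover have "s \<circ> t permutes A"
      by (intro permutes_compose permutes_subset[OF s sub] permutes_subset[OF t]) auto
    ultimately show "(case p of (s, t) \<Rightarrow> s \<circ> t) \<in> {x. x permutes A \<and> x ` C = C}" by simp
  qed
  then show ?thesis by (simp add: sum.cartesian_product)
qed

section \<open>Splitting off the cycle through a given point\<close>

definition cyclic_perms :: "'a \<Rightarrow> 'a set \<Rightarrow> ('a \<Rightarrow> 'a) set" where
  "cyclic_perms a C = {s. s permutes C \<and> orbit s a = C}"

text \<open>Permutations are grouped by the orbit \<open>C\<close> of \<open>a\<close>. Given
  \<open>C\<close>, such a permutation is the product of a full cycle on \<open>C\<close> and an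
  arbitrary permutation of \<open>A - C\<close>.\<close>

lemma sum_permutes_cycle:
  fixes F :: "_ \<Rightarrow> 'b::comm_monoid_add"
  assumes fin: "finite A" and a: "a \<in> A"
  shows "(\<Sum>x | x permutes A. F x) =
         (\<Sum>C | C \<subseteq> A \<and> a \<in> C. \<Sum>s\<in>cyclic_perms a C. \<Sum>t | t permutes A - C. F (s \<circ> t))"
proof -
  have "(\<Sum>x | x permutes A. F x) =
     (\<Sum>C | C \<subseteq> A \<and> a \<in> C. \<Sum>x\<in>{x \<in> {x. x permutes A}. orbit x a = C}. F x)"
  proof (rule sum.group[symmetric, where g = "\<lambda>x. orbit x a"])
    show "(\<lambda>x. orbit x a) ` {x. x permutes A} \<subseteq> {C. C \<subseteq> A \<and> a \<in> C}"
      using permutes_orbit_subset[OF _ a] permutes_self_in_orbit[OF _ fin] by auto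
  qed (use fin in \<open>auto simp: finite_permutations\<close>)
  also have "\<dots> = (\<Sum>C | C \<subseteq> A \<and> a \<in> C. \<Sum>s\<in>cyclic_perms a C. \<Sum>t | t permutes A - C. F (s \<circ> t))"
  proof (rule sum.cong[OF refl])
    fix C assume C: "C \<in> {C. C \<subseteq> A \<and> a \<in> C}"
    then have finC: "finite C" using fin finite_subset by blast
    \<comment> \<open>The condition on the orbit moves into the summand, so that the range becomes
      all permutations leaving \<open>C\<close> invariant and \<open>sum_permutes_invariant\<close>
      applies.\<close>
    have "(\<Sum>x\<in>{x \<in> {x. x permutes A}. orbit x a = C}. F x) =
          (\<Sum>x | x permutes A \<and> x ` C = C. if orbit x a = C then F x else 0)"
      by (rule sum.mono_neutral_cong_left)
         (use fin a orbits_facts(4)[OF _ fin] finite_permutations[OF fin] in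
         \<open>auto intro: finite_subset[rotated]\<close>)
    also have "\<dots> = (\<Sum>s | s permutes C. \<Sum>t | t permutes A - C.
        if orbit (s \<circ> t) a = C then F (s \<circ> t) else 0)"
      by (rule sum_permutes_invariant) (use fin C in auto)
    also have "\<dots> = (\<Sum>s | s permutes C. if orbit s a = C then \<Sum>t | t permutes A - C. F (s \<circ> t) else 0)"
    proof (rule sum.cong[OF refl])
      fix s assume "s \<in> {s. s permutes C}"
      then have "orbit (s \<circ> t) a = orbit s a" if "t permutes A - C" for t
        using orbit_comp_left[of C "A - C" s t a] that C fin finC by auto
      then show "(\<Sum>t | t permutes A - C. if orbit (s \<circ> t) a = C then F (s \<circ> t) else 0) =
         (if orbit s a = C then \<Sum>t | t permutes A - C. F (s \<circ> t) else 0)"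
        by (auto intro!: sum.neutral)
    qed
    also have "\<dots> = (\<Sum>s\<in>cyclic_perms a C. \<Sum>t | t permutes A - C. F (s \<circ> t))"
      unfolding cyclic_perms_def
      by (rule sum.mono_neutral_cong_right) (use finC finite_permutations in auto)
    finally show "(\<Sum>x\<in>{x \<in> {x. x permutes A}. orbit x a = C}. F x) =
      (\<Sum>s\<in>cyclic_perms a C. \<Sum>t | t permutes A - C. F (s \<circ> t))" .
  qed
  finally show ?thesis .
qed

section \<open>Averages of weights that are multiplicative over cycles\<close>

definition cycle_prod :: "(nat \<Rightarrow> real) \<Rightarrow> nat multiset \<Rightarrow> real" where
  "cycle_prod w T = (\<Prod>l\<in>#T. w l)"

text \<open>For finite \<open>A\<close>, division by \<open>fact (card A)\<close> gives the
  expectation of \<open>cycle_prod w\<close> for a uniformly random permutation of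
  \<open>A\<close>.\<close>

definition cycle_weight :: "(nat \<Rightarrow> real) \<Rightarrow> 'a set \<Rightarrow> real" where
  "cycle_weight w A = (\<Sum>x | x permutes A. cycle_prod w (cycle_mset A x))"

lemma cycle_prod_union: "cycle_prod w (S + T) = cycle_prod w S * cycle_prod w T"
  by (simp add: cycle_prod_def)

text \<open>The cycle \<open>C\<close> through \<open>a\<close> contributes the factor
  \<open>w (card C)\<close>; what remains is an arbitrary permutation of
  \<open>A - C\<close>.\<close>

lemma cycle_weight_recursion:
  fixes w :: "nat \<Rightarrow> real"
  assumes fin: "finite A" and a: "a \<in> A"
  shows "cycle_weight w A =
    (\<Sum>C | C \<subseteq> A \<and> a \<in> C. card (cyclic_perms a C) * w (card C) * cycle_weight w (A - C))"
  unfolding cycle_weight_def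
proof (subst sum_permutes_cycle[OF fin a], intro sum.cong refl)
  fix C assume C: "C \<in> {C. C \<subseteq> A \<and> a \<in> C}"
  then have finC: "finite C" using fin finite_subset by blast
  have "(\<Sum>s\<in>cyclic_perms a C. \<Sum>t | t permutes A - C. cycle_prod w (cycle_mset A (s \<circ> t))) =
     (\<Sum>s\<in>cyclic_perms a C. \<Sum>t | t permutes A - C. w (card C) * cycle_prod w (cycle_mset (A - C) t))"
  proof (intro sum.cong refl)
    fix s t assume "s \<in> cyclic_perms a C" "t \<in> {t. t permutes A - C}"
    then have s: "s permutes C" "orbit s a = C" and t: "t permutes A - C"
      by (auto simp: cyclic_perms_def)
    have "cycle_mset A (s \<circ> t) = {#card C#} + cycle_mset (A - C) t"
      using cycle_mset_comp_Diff[OF fin _ s(1) t] cycle_mset_single[OF s(2) _ s(1)] C finC by simp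
    then show "cycle_prod w (cycle_mset A (s \<circ> t)) = w (card C) * cycle_prod w (cycle_mset (A - C) t)"
      by (simp add: cycle_prod_def)
  qed
  then show "(\<Sum>s\<in>cyclic_perms a C. \<Sum>t | t permutes A - C. cycle_prod w (cycle_mset A (s \<circ> t))) =
     real (card (cyclic_perms a C)) * w (card C) *
       (\<Sum>x | x permutes A - C. cycle_prod w (cycle_mset (A - C) x))"
    by (simp add: sum_distrib_left mult.assoc)
qed

lemma card_subsets_containing:
  assumes "finite A" "a \<in> A" "1 \<le> l" "l \<le> card A"
  shows "card {C. C \<subseteq> A \<and> a \<in> C \<and> card C = l} = (card A - 1) choose (l - 1)"
proof -
  have "bij_betw (insert a) {C. C \<subseteq> A - {a} \<and> card C = l - 1} {C. C \<subseteq> A \<and> a \<in> C \<and> card C = l}"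
  proof (rule bij_betwI[where g = "\<lambda>C. C - {a}"])
    show "insert a \<in> {C. C \<subseteq> A - {a} \<and> card C = l - 1} \<rightarrow> {C. C \<subseteq> A \<and> a \<in> C \<and> card C = l}"
    proof
      fix C assume C: "C \<in> {C. C \<subseteq> A - {a} \<and> card C = l - 1}"
      then have "finite C" using assms(1) finite_subset by blast
      then have "card (insert a C) = l" using C assms(3) by (subst card_insert_disjoint) auto
      then show "insert a C \<in> {C. C \<subseteq> A \<and> a \<in> C \<and> card C = l}" using C assms(2) by auto
    qed
    show "(\<lambda>C. C - {a}) \<in> {C. C \<subseteq> A \<and> a \<in> C \<and> card C = l} \<rightarrow> {C. C \<subseteq> A - {a} \<and> card C = l - 1}"
      by auto
  qed auto
  then have "card {C. C \<subseteq> A \<and> a \<in> C \<and> card C = l} = card {C. C \<subseteq> A - {a} \<and> card C = l - 1}"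
    by (simp add: bij_betw_same_card)
  also have "\<dots> = (card (A - {a})) choose (l - 1)"
    by (rule n_subsets) (use assms in auto)
  finally show ?thesis using assms by simp
qed

lemma sum_subsets_containing:
  fixes f :: "nat \<Rightarrow> real"
  assumes "finite A" "a \<in> A"
  shows "(\<Sum>C | C \<subseteq> A \<and> a \<in> C. f (card C)) =
    (\<Sum>l=1..card A. real ((card A - 1) choose (l - 1)) * f l)"
proof -
  have "(\<Sum>C | C \<subseteq> A \<and> a \<in> C. f (card C)) =
     (\<Sum>l=1..card A. \<Sum>C\<in>{C\<in>{C. C \<subseteq> A \<and> a \<in> C}. card C = l}. f (card C))"
  proof (rule sum.group[symmetric])
    show "card ` {C. C \<subseteq> A \<and> a \<in> C} \<subseteq> {1..card A}"
    proof
      fix l assume "l \<in> card ` {C. C \<subseteq> A \<and> a \<in> C}"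
      then obtain C where C: "C \<subseteq> A" "a \<in> C" "l = card C" by auto
      then have "finite C" "C \<noteq> {}" using assms finite_subset by blast+
      then show "l \<in> {1..card A}" using C card_mono[OF assms(1)] by (simp add: Suc_leI card_gt_0_iff)
    qed
  qed (use assms in auto)
  also have "\<dots> = (\<Sum>l=1..card A. real ((card A - 1) choose (l - 1)) * f l)"
  proof (intro sum.cong refl)
    fix l assume "l \<in> {1..card A}"
    then have "card {C\<in>{C. C \<subseteq> A \<and> a \<in> C}. card C = l} = (card A - 1) choose (l - 1)"
      using card_subsets_containing[OF assms] by (simp add: conj_assoc)
    then show "(\<Sum>C\<in>{C\<in>{C. C \<subseteq> A \<and> a \<in> C}. card C = l}. f (card C)) =
       real ((card A - 1) choose (l - 1)) * f l" by simp
  qed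
  finally show ?thesis .
qed

text \<open>The three factors choose the other points of the cycle through a given point, arrange
  that cycle and permute the rest. The product does not depend on \<open>l\<close>: the length of
  the cycle through a given point is uniform on \<open>{1..n}\<close>.\<close>

lemma choose_times_facts:
  assumes "1 \<le> l" "l \<le> n"
  shows "real ((n - 1) choose (l - 1)) * fact (l - 1) * fact (n - l) = fact (n - 1)"
proof -
  have "fact (l - 1) * fact (n - 1 - (l - 1)) * ((n - 1) choose (l - 1)) = (fact (n - 1) :: nat)"
    by (rule binomial_fact_lemma) (use assms in auto)
  moreover have "n - 1 - (l - 1) = n - l" using assms by auto
  ultimately have "fact (l - 1) * fact (n - l) * ((n - 1) choose (l - 1)) = (fact (n - 1) :: nat)"
    by simp
  then have "real (fact (l - 1) * fact (n - l) * ((n - 1) choose (l - 1))) = real (fact (n - 1))"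
    by simp
  then show ?thesis by (simp add: algebra_simps)
qed

lemma cycle_weight_one:
  assumes "finite A"
  shows "cycle_weight (\<lambda>_. 1) A = fact (card A)"
  by (simp add: cycle_weight_def cycle_prod_def card_permutations[OF refl assms])

text \<open>Double counting by strong induction. With unit weights,
  \<open>cycle_weight_recursion\<close> writes \<open>fact n\<close> as a sum over the cycles
  \<open>D\<close> through \<open>a\<close>. The claimed values, summed over all \<open>D\<close>,
  also give \<open>fact n\<close>, since each length contributes \<open>fact (n - 1)\<close>. By
  induction the terms for proper subsets agree, hence so does the one for
  \<open>D = C\<close>.\<close>

lemma card_cyclic_perms:
  assumes "finite C" "a \<in> C"
  shows "card (cyclic_perms a C) = fact (card C - 1)"
  using assms
proof (induction "card C" arbitrary: C rule: less_induct)
  case less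
  let ?n = "card C"
  let ?F = "\<lambda>D. real (card (cyclic_perms a D)) * fact (card (C - D))"
  have n: "?n \<ge> 1" using less.prems by (metis One_nat_def Suc_leI card_gt_0_iff empty_iff)
  have fin: "finite {D. D \<subseteq> C \<and> a \<in> D}" using less.prems by auto
  have "fact ?n = (\<Sum>D | D \<subseteq> C \<and> a \<in> D. ?F D)"
    using cycle_weight_recursion[OF less.prems, of "\<lambda>_. 1"] less.prems
    by (simp add: cycle_weight_one)
  also have "\<dots> = ?F C + (\<Sum>D\<in>{D. D \<subseteq> C \<and> a \<in> D} - {C}. ?F D)"
    by (rule sum.remove) (use less.prems in auto)
  also have "(\<Sum>D\<in>{D. D \<subseteq> C \<and> a \<in> D} - {C}. ?F D) =
     (\<Sum>D\<in>{D. D \<subseteq> C \<and> a \<in> D} - {C}. fact (card D - 1) * fact (?n - card D))"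
  proof (intro sum.cong refl)
    fix D assume D: "D \<in> {D. D \<subseteq> C \<and> a \<in> D} - {C}"
    then have "card D < ?n" "finite D"
      using less.prems by (auto intro!: psubset_card_mono intro: finite_subset)
    then show "?F D = fact (card D - 1) * fact (?n - card D)"
      using less.hyps[of D] D card_Diff_subset[of D C] by simp
  qed
  also have "\<dots> = (\<Sum>D | D \<subseteq> C \<and> a \<in> D. fact (card D - 1) * fact (?n - card D)) - fact (?n - 1)"
    by (subst sum_diff1) (use less.prems fin in auto)
  also have "(\<Sum>D | D \<subseteq> C \<and> a \<in> D. fact (card D - 1) * fact (?n - card D)) =
    (\<Sum>l=1..?n. real ((?n - 1) choose (l - 1)) * (fact (l - 1) * fact (?n - l)))"
    by (rule sum_subsets_containing[OF less.prems])
  also have "\<dots> = (\<Sum>l=1..?n. fact (?n - 1))"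
    using choose_times_facts[of _ ?n] by (intro sum.cong refl) (simp add: mult.assoc)
  also have "\<dots> = fact ?n"
    using n fact_reduce[of ?n, where 'a=real] by simp
  finally have "?F C = fact (?n - 1)" by simp
  then have "real (card (cyclic_perms a C)) = real (fact (?n - 1))" by simp
  then show ?case by (simp only: of_nat_eq_iff)
qed

text \<open>The coefficient of \<open>x ^ n\<close> in the exponential of the series with
  coefficients \<open>w l / l\<close>; the recursion is what the logarithmic derivative of that
  exponential yields.\<close>

function cycle_mean :: "(nat \<Rightarrow> real) \<Rightarrow> nat \<Rightarrow> real" where
  "cycle_mean w n = (if n = 0 then 1 else (\<Sum>i<n. w (n - i) * cycle_mean w i) / n)"
  by auto
termination by (relation "Wellfounded.measure snd") auto

declare cycle_mean.simps [simp del]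

lemma cycle_mean_0 [simp]: "cycle_mean w 0 = 1"
  by (subst cycle_mean.simps) simp

lemma cycle_mean_rec:
  assumes "n > 0"
  shows "real n * cycle_mean w n = (\<Sum>l=1..n. w l * cycle_mean w (n - l))"
proof -
  have "real n * cycle_mean w n = (\<Sum>i<n. w (n - i) * cycle_mean w i)"
    using assms by (subst cycle_mean.simps) simp
  also have "\<dots> = (\<Sum>l=1..n. w l * cycle_mean w (n - l))"
    by (rule sum.reindex_bij_witness[of _ "\<lambda>l. n - l" "\<lambda>i. n - i"]) auto
  finally show ?thesis .
qed

text \<open>Group \<open>cycle_weight_recursion\<close> by the length of the cycle through
  \<open>a\<close>. By \<open>choose_times_facts\<close> every length carries the same factor
  \<open>fact (n - 1)\<close>, which leaves the recursion of \<open>cycle_mean\<close>.\<close>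

lemma cycle_weight_eq:
  assumes "finite A"
  shows "cycle_weight w A = fact (card A) * cycle_mean w (card A)"
  using assms
proof (induction "card A" arbitrary: A rule: less_induct)
  case less
  let ?n = "card A"
  show ?case
  proof (cases "A = {}")
    case True
    then show ?thesis by (simp add: cycle_weight_def cycle_prod_def cycle_mset_def)
  next
    case False
    then obtain a where a: "a \<in> A" by auto
    have n: "?n > 0" using False less.prems by auto
    have "cycle_weight w A = (\<Sum>C | C \<subseteq> A \<and> a \<in> C.
       fact (card C - 1) * w (card C) * (fact (?n - card C) * cycle_mean w (?n - card C)))"
    proof (subst cycle_weight_recursion[OF less.prems a], intro sum.cong refl)
      fix C assume C: "C \<in> {C. C \<subseteq> A \<and> a \<in> C}"
      then have finC: "finite C" using less.prems finite_subset by blast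
      have "A - C \<subset> A" using C by auto
      then have "cycle_weight w (A - C) = fact (card (A - C)) * cycle_mean w (card (A - C))"
        by (intro less.hyps psubset_card_mono) (use less.prems in auto)
      then show "real (card (cyclic_perms a C)) * w (card C) * cycle_weight w (A - C) =
         fact (card C - 1) * w (card C) * (fact (?n - card C) * cycle_mean w (?n - card C))"
        using card_cyclic_perms[OF finC, of a] C card_Diff_subset[of C A] finC by simp
    qed
    also have "\<dots> = (\<Sum>l=1..?n. real ((?n - 1) choose (l - 1)) *
         (fact (l - 1) * w l * (fact (?n - l) * cycle_mean w (?n - l))))"
      by (rule sum_subsets_containing[OF less.prems a])
    also have "\<dots> = (\<Sum>l=1..?n. fact (?n - 1) * (w l * cycle_mean w (?n - l)))"
    proof (intro sum.cong refl)
      fix l assume "l \<in> {1..?n}"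
      then have "fact (?n - 1) = real ((?n - 1) choose (l - 1)) * fact (l - 1) * fact (?n - l)"
        using choose_times_facts[of l ?n] by simp
      then show "real ((?n - 1) choose (l - 1)) *
         (fact (l - 1) * w l * (fact (?n - l) * cycle_mean w (?n - l))) =
         fact (?n - 1) * (w l * cycle_mean w (?n - l))" by simp
    qed
    also have "\<dots> = fact (?n - 1) * (real ?n * cycle_mean w ?n)"
      using cycle_mean_rec[OF n] by (simp add: sum_distrib_left)
    also have "\<dots> = fact ?n * cycle_mean w ?n"
      using n fact_reduce[of ?n, where 'a=real] by simp
    finally show ?thesis .
  qed
qed

section \<open>Averages over the symmetric group\<close>

lemma cycle_mean_nonneg:
  assumes "\<And>l. w l \<ge> 0"
  shows "cycle_mean w n \<ge> 0"
proof (induction n rule: less_induct)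
  case (less n)
  then show ?case using assms
    by (subst cycle_mean.simps) (auto intro!: divide_nonneg_nonneg sum_nonneg)
qed

text \<open>The generating function of \<^term>\<open>cycle_mean v\<close> is \<open>exp (\<Sum>l. v l * x ^ l / l)\<close>, so its
  truncation \<open>P\<close> satisfies \<open>P' \<le> V' P\<close> on \<open>[0, 1]\<close>, where \<open>V\<close> is the truncated exponent.\<close>

lemma sum_cycle_mean_le:
  assumes v: "\<And>l. v l \<ge> 0"
  shows "(\<Sum>j\<le>n. cycle_mean v j) \<le> exp (\<Sum>l=1..n. v l / real l)"
proof -
  define P where "P = (\<lambda>x. \<Sum>j\<le>n. cycle_mean v j * x ^ j)"
  define P' where "P' = (\<lambda>x. \<Sum>j\<le>n. cycle_mean v j * (real j * x ^ (j - 1)))"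
  define V where "V = (\<lambda>x. \<Sum>l=1..n. v l / real l * x ^ l)"
  define V' where "V' = (\<lambda>x. \<Sum>l=1..n. v l * x ^ (l - 1))"
  have dP: "(P has_real_derivative P' x) (at x)" for x
    unfolding P_def P'_def by (auto intro!: derivative_eq_intros sum.cong)
  have dV: "(V has_real_derivative V' x) (at x)" for x
    unfolding V_def V'_def by (auto intro!: derivative_eq_intros sum.cong)
  have P'_le: "P' x \<le> V' x * P x" if x: "0 \<le> x" for x
  proof -
    have "P' x = (\<Sum>j=1..n. (real j * cycle_mean v j) * x ^ (j - 1))"
      unfolding P'_def by (rule sum.mono_neutral_cong_right) (auto simp: not_le)
    also have "\<dots> = (\<Sum>j=1..n. \<Sum>l=1..j. v l * cycle_mean v (j - l) * x ^ (j - 1))"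
      using cycle_mean_rec[of _ v] by (intro sum.cong refl) (simp add: sum_distrib_right)
    also have "\<dots> = (\<Sum>(j, l)\<in>(SIGMA j:{1..n}. {1..j}). v l * cycle_mean v (j - l) * x ^ (j - 1))"
      by (rule sum.Sigma) auto
    also have "\<dots> = (\<Sum>(l, i)\<in>{(l, i). 1 \<le> l \<and> l + i \<le> n}. (v l * x ^ (l - 1)) * (cycle_mean v i * x ^ i))"
      by (rule sum.reindex_bij_witness[where i = "\<lambda>(l, i). (l + i, l)" and j = "\<lambda>(j, l). (l, j - l)"])
         (auto simp flip: power_add)
    \<comment> \<open>Dropping the constraint \<open>l + i \<le> n\<close> adds only nonnegative
      terms and lets the double sum factor.\<close>
    also have "\<dots> \<le> (\<Sum>(l, i)\<in>{1..n} \<times> {..n}. (v l * x ^ (l - 1)) * (cycle_mean v i * x ^ i))"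
      by (rule sum_mono2) (use x v cycle_mean_nonneg[OF v] in \<open>auto intro!: mult_nonneg_nonneg\<close>)
    also have "\<dots> = V' x * P x"
      unfolding V'_def P_def by (simp add: sum_product sum.cartesian_product)
    finally show ?thesis .
  qed
  \<comment> \<open>The differential inequality makes \<open>P x * exp (- V x)\<close>
    non-increasing on the unit interval; comparing its ends bounds \<open>P 1\<close>, the sum of
    the coefficients.\<close>
  have "P 1 * exp (- V 1) \<le> P 0 * exp (- V 0)"
  proof (rule DERIV_nonpos_imp_nonincreasing[of 0 1 "\<lambda>x. P x * exp (- V x)"])
    fix x :: real assume x: "0 \<le> x" "x \<le> 1"
    have "((\<lambda>x. P x * exp (- V x)) has_real_derivative (P' x - V' x * P x) * exp (- V x)) (at x)"
      using dP dV by (auto intro!: derivative_eq_intros simp: algebra_simps)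
    moreover have "(P' x - V' x * P x) * exp (- V x) \<le> 0"
      using P'_le[OF x(1)] by (intro mult_nonpos_nonneg) auto
    ultimately show "\<exists>y. ((\<lambda>x. P x * exp (- V x)) has_real_derivative y) (at x) \<and> y \<le> 0" by blast
  qed simp
  moreover have "V 0 = 0" unfolding V_def by (auto intro!: sum.neutral)
  moreover have "P 0 = 1"
  proof -
    have "P 0 = (\<Sum>j\<le>n. if j = 0 then 1 else 0)" unfolding P_def by (intro sum.cong) auto
    then show ?thesis by simp
  qed
  ultimately have "P 1 \<le> exp (V 1)"
    by (simp add: exp_minus field_simps)
  then show ?thesis by (simp add: P_def V_def)
qed

text \<open>The recursion bounds \<open>n * cycle_mean w n\<close> by \<open>W\<close> times the sum
  of the earlier means, to which \<open>sum_cycle_mean_le\<close> applies. The gain is a factor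
  \<open>1 / n\<close>, which matters for weights below 1.\<close>

lemma cycle_mean_le:
  assumes w: "\<And>l. 0 \<le> w l" "\<And>l. w l \<le> W" and n: "n > 0"
  shows "cycle_mean w n \<le> W / n * exp (\<Sum>l=1..n. w l / real l)"
proof -
  have W: "W \<ge> 0" using w[of 0] by linarith
  have "real n * cycle_mean w n = (\<Sum>l=1..n. w l * cycle_mean w (n - l))"
    by (rule cycle_mean_rec[OF n])
  also have "\<dots> \<le> (\<Sum>l=1..n. W * cycle_mean w (n - l))"
    using w cycle_mean_nonneg[OF w(1)] by (intro sum_mono mult_right_mono) auto
  also have "\<dots> = (\<Sum>j<n. W * cycle_mean w j)"
    by (rule sum.reindex_bij_witness[of _ "\<lambda>l. n - l" "\<lambda>i. n - i"]) auto
  also have "\<dots> \<le> (\<Sum>j\<le>n. W * cycle_mean w j)"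
    using W cycle_mean_nonneg[OF w(1)] by (intro sum_mono2) auto
  also have "\<dots> = W * (\<Sum>j\<le>n. cycle_mean w j)" by (simp add: sum_distrib_left)
  also have "\<dots> \<le> W * exp (\<Sum>l=1..n. w l / real l)"
    using sum_cycle_mean_le[OF w(1)] W by (intro mult_left_mono) auto
  finally show ?thesis using n by (simp add: field_simps)
qed

text \<open>Adding 1 to every weight multiplies the generating function by
  \<open>1 / (1 - x)\<close>, so coefficients turn into partial sums. The proof verifies that the
  partial sums satisfy the recursion for the weight \<open>1 + v l\<close>.\<close>

lemma cycle_mean_one_plus: "cycle_mean (\<lambda>l. 1 + v l) n = (\<Sum>j\<le>n. cycle_mean v j)"
proof (induction n rule: less_induct)
  case (less n)
  let ?h = "\<lambda>n. \<Sum>j\<le>n. cycle_mean v j"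
  show ?case
  proof (cases "n = 0")
    case False
    then have n: "n > 0" by simp
    have 1: "(\<Sum>j=1..n. real j * cycle_mean v j) = (\<Sum>l=1..n. v l * ?h (n - l))"
    proof -
      have "(\<Sum>j=1..n. real j * cycle_mean v j) = (\<Sum>j=1..n. \<Sum>l=1..j. v l * cycle_mean v (j - l))"
        using cycle_mean_rec[of _ v] by (intro sum.cong refl) simp
      also have "\<dots> = (\<Sum>(j, l)\<in>(SIGMA j:{1..n}. {1..j}). v l * cycle_mean v (j - l))"
        by (rule sum.Sigma) auto
      also have "\<dots> = (\<Sum>(l, i)\<in>(SIGMA l:{1..n}. {..n - l}). v l * cycle_mean v i)"
        by (rule sum.reindex_bij_witness[where i = "\<lambda>(l, i). (l + i, l)" and j = "\<lambda>(j, l). (l, j - l)"])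
           auto
      also have "\<dots> = (\<Sum>l=1..n. \<Sum>i\<le>n - l. v l * cycle_mean v i)"
        by (rule sum.Sigma[symmetric]) auto
      finally show ?thesis by (simp add: sum_distrib_left)
    qed
    have 2: "(\<Sum>j\<le>n. real (n - j) * cycle_mean v j) = (\<Sum>l=1..n. ?h (n - l))"
    proof -
      have "(\<Sum>j\<le>n. real (n - j) * cycle_mean v j) = (\<Sum>j\<le>n. \<Sum>l\<in>{1..n - j}. cycle_mean v j)"
        by simp
      also have "\<dots> = (\<Sum>(j, l)\<in>(SIGMA j:{..n}. {1..n - j}). cycle_mean v j)"
        by (rule sum.Sigma) auto
      also have "\<dots> = (\<Sum>(l, j)\<in>(SIGMA l:{1..n}. {..n - l}). cycle_mean v j)"
        by (rule sum.reindex_bij_witness[where i = "\<lambda>(l, j). (j, l)" and j = "\<lambda>(j, l). (l, j)"]) auto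
      also have "\<dots> = (\<Sum>l=1..n. ?h (n - l))"
        by (rule sum.Sigma[symmetric]) auto
      finally show ?thesis .
    qed
    \<comment> \<open>Splitting \<open>n\<close> as \<open>j + (n - j)\<close> separates the
      contribution of \<open>v\<close> from that of the constant weight 1.\<close>
    have "real n * ?h n = (\<Sum>j\<le>n. real j * cycle_mean v j + real (n - j) * cycle_mean v j)"
      by (subst sum_distrib_left, intro sum.cong refl) (simp add: algebra_simps of_nat_diff)
    also have "\<dots> = (\<Sum>j\<le>n. real j * cycle_mean v j) + (\<Sum>j\<le>n. real (n - j) * cycle_mean v j)"
      by (rule sum.distrib)
    also have "(\<Sum>j\<le>n. real j * cycle_mean v j) = (\<Sum>j=1..n. real j * cycle_mean v j)"
      by (rule sum.mono_neutral_right) auto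
    also have "\<dots> + (\<Sum>j\<le>n. real (n - j) * cycle_mean v j) = (\<Sum>l=1..n. (1 + v l) * ?h (n - l))"
      unfolding 1 2 by (simp add: sum.distrib algebra_simps)
    also have "\<dots> = (\<Sum>l=1..n. (1 + v l) * cycle_mean (\<lambda>l. 1 + v l) (n - l))"
      using less.IH by (intro sum.cong refl) auto
    also have "\<dots> = real n * cycle_mean (\<lambda>l. 1 + v l) n"
      by (rule cycle_mean_rec[OF n, symmetric])
    finally show ?thesis using n by simp
  qed simp
qed

lemma cycle_mean_one_plus_le:
  assumes "\<And>l. v l \<ge> 0"
  shows "cycle_mean (\<lambda>l. 1 + v l) n \<le> exp (\<Sum>l=1..n. v l / real l)"
  unfolding cycle_mean_one_plus by (rule sum_cycle_mean_le[OF assms])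

section \<open>Probabilities of events that depend on the cycle type\<close>

definition perm_fraction :: "nat \<Rightarrow> (nat multiset \<Rightarrow> bool) \<Rightarrow> real" where
  "perm_fraction n P = real (card {x. x permutes {1..n} \<and> P (cycle_type n x)}) / fact n"

lemma perm_fraction_mono:
  assumes "\<And>x. x permutes {1..n} \<Longrightarrow> P (cycle_type n x) \<Longrightarrow> Q (cycle_type n x)"
  shows "perm_fraction n P \<le> perm_fraction n Q"
proof -
  have "finite {x. x permutes {1..n} \<and> Q (cycle_type n x)}"
    by (rule finite_subset[OF _ finite_permutations[of "{1..n}"]]) auto
  then have "card {x. x permutes {1..n} \<and> P (cycle_type n x)}
      \<le> card {x. x permutes {1..n} \<and> Q (cycle_type n x)}"
    by (rule card_mono) (use assms in auto)
  then show ?thesis unfolding perm_fraction_def by (simp add: divide_right_mono)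
qed

lemma perm_fraction_disj:
  "perm_fraction n (\<lambda>T. P T \<or> Q T) \<le> perm_fraction n P + perm_fraction n Q"
proof -
  let ?S = "\<lambda>P. {x. x permutes {1..n} \<and> P (cycle_type n x)}"
  have "?S (\<lambda>T. P T \<or> Q T) = ?S P \<union> ?S Q" by auto
  then have "card (?S (\<lambda>T. P T \<or> Q T)) \<le> card (?S P) + card (?S Q)"
    using card_Un_le[of "?S P" "?S Q"] by simp
  then have "real (card (?S (\<lambda>T. P T \<or> Q T))) \<le> real (card (?S P)) + real (card (?S Q))"
    by linarith
  then have "real (card (?S (\<lambda>T. P T \<or> Q T))) / fact n \<le> (real (card (?S P)) + real (card (?S Q))) / fact n"
    by (rule divide_right_mono) simp
  then show ?thesis unfolding perm_fraction_def by (simp add: add_divide_distrib)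
qed

lemma perm_fraction_bex:
  assumes "finite I"
  shows "perm_fraction n (\<lambda>T. \<exists>i\<in>I. P i T) \<le> (\<Sum>i\<in>I. perm_fraction n (P i))"
  using assms
proof (induction rule: finite_induct)
  case empty
  then show ?case by (simp add: perm_fraction_def)
next
  case (insert i I)
  have "perm_fraction n (\<lambda>T. \<exists>i\<in>insert i I. P i T) = perm_fraction n (\<lambda>T. P i T \<or> (\<exists>i\<in>I. P i T))"
    by simp
  also have "\<dots> \<le> perm_fraction n (P i) + perm_fraction n (\<lambda>T. \<exists>i\<in>I. P i T)"
    by (rule perm_fraction_disj)
  finally show ?case using insert by simp
qed

lemma cycle_prod_nonneg: "(\<And>l. w l \<ge> 0) \<Longrightarrow> cycle_prod w T \<ge> 0"
  unfolding cycle_prod_def by (induction T) auto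

text \<open>Markov's inequality for the random variable \<open>cycle_prod w\<close>, whose
  expectation is \<open>cycle_mean w n\<close> by \<open>cycle_weight_eq\<close>.\<close>

lemma perm_fraction_markov:
  assumes w: "\<And>l. w l \<ge> 0" and u: "u > 0"
    and P: "\<And>x. x permutes {1..n} \<Longrightarrow> P (cycle_type n x) \<Longrightarrow> u \<le> cycle_prod w (cycle_type n x)"
  shows "perm_fraction n P \<le> cycle_mean w n / u"
proof -
  let ?S = "{x. x permutes {1..n} \<and> P (cycle_type n x)}"
  have "u * real (card ?S) = (\<Sum>x\<in>?S. u)" by simp
  also have "\<dots> \<le> (\<Sum>x\<in>?S. cycle_prod w (cycle_type n x))"
    using P by (intro sum_mono) auto
  also have "\<dots> \<le> (\<Sum>x | x permutes {1..n}. cycle_prod w (cycle_type n x))"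
    using cycle_prod_nonneg[OF w] by (intro sum_mono2) (auto simp: finite_permutations)
  also have "\<dots> = fact n * cycle_mean w n"
    using cycle_weight_eq[of "{1..n}" w] by (simp add: cycle_weight_def cycle_type_eq)
  finally show ?thesis using u unfolding perm_fraction_def by (simp add: field_simps)
qed

lemma harm_le_ln: "n > 0 \<Longrightarrow> harm n \<le> 1 + ln (real n)"
  using euler_mascheroni_sequence_decreasing[of 1 n] by (simp add: harm_expand)

lemma sum_inverse_eq_harm: "(\<Sum>l=1..n. 1 / real l) = harm n"
  by (simp add: harm_def inverse_eq_divide)

lemma sum_inverse_less_le:
  assumes "b \<ge> 1"
  shows "(\<Sum>l | l \<in> {1..n} \<and> real l < b. 1 / real l) \<le> 1 + ln b"
proof -
  let ?m = "nat \<lfloor>b\<rfloor>"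
  have m: "?m > 0" "real ?m \<le> b" using assms by auto
  have "(\<Sum>l | l \<in> {1..n} \<and> real l < b. 1 / real l) \<le> (\<Sum>l\<in>{1..?m}. 1 / real l)"
    by (rule sum_mono2) (auto simp: le_nat_floor)
  also have "\<dots> \<le> 1 + ln (real ?m)" using harm_le_ln[OF m(1)] by (simp only: sum_inverse_eq_harm)
  also have "\<dots> \<le> 1 + ln b" using m by simp
  finally show ?thesis .
qed

lemma sum_inverse_multiples_le:
  assumes "c > 0"
  shows "(\<Sum>l | l \<in> {1..n} \<and> c dvd l. 1 / real l) \<le> harm n / real c"
proof -
  have "(\<Sum>l | l \<in> {1..n} \<and> c dvd l. 1 / real l) = (\<Sum>j | j \<in> {1..n} \<and> c * j \<le> n. 1 / real (c * j))"
    by (rule sum.reindex_bij_witness[where i = "\<lambda>j. c * j" and j = "\<lambda>l. l div c"])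
       (use assms in \<open>auto simp: Suc_le_eq div_le_dividend elim!: dvdE intro: order_trans[OF div_le_dividend]\<close>)
  also have "\<dots> \<le> (\<Sum>j\<in>{1..n}. 1 / real (c * j))"
    by (rule sum_mono2) auto
  also have "\<dots> = harm n / real c"
    by (simp add: sum_inverse_eq_harm[symmetric] sum_divide_distrib mult.commute)
  finally show ?thesis .
qed

lemma cycle_prod_if: "cycle_prod (\<lambda>l. if p l then z else 1) T = z ^ size (filter_mset p T)"
  unfolding cycle_prod_def by (induction T) auto

lemma cycle_prod_const: "cycle_prod (\<lambda>_. z) T = z ^ size T"
  unfolding cycle_prod_def by (induction T) auto

text \<open>Give weight \<open>1 / 2\<close> to the lengths satisfying \<open>p\<close>. At most one
  such cycle keeps the product at least \<open>1 / 2\<close>, while the mean is at most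
  \<open>exp (1 - \<mu> / 2)\<close>, where \<open>\<mu>\<close> is the sum of \<open>1 / l\<close>
  over these lengths.\<close>

lemma perm_fraction_at_most_one:
  assumes "n > 0"
  shows "perm_fraction n (\<lambda>T. size (filter_mset p T) \<le> 1)
    \<le> 2 * exp (1 - (\<Sum>l | l \<in> {1..n} \<and> p l. 1 / real l) / 2)"
proof -
  let ?w = "\<lambda>l. if p l then 1 / 2 else 1 :: real"
  let ?\<mu> = "\<Sum>l | l \<in> {1..n} \<and> p l. 1 / real l"
  have "perm_fraction n (\<lambda>T. size (filter_mset p T) \<le> 1) \<le> cycle_mean ?w n / (1 / 2)"
  proof (rule perm_fraction_markov)
    fix x assume "size (filter_mset p (cycle_type n x)) \<le> 1"
    then have "(1 / 2 :: real) ^ 1 \<le> (1 / 2) ^ size (filter_mset p (cycle_type n x))"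
      by (intro power_decreasing) auto
    then show "1 / 2 \<le> cycle_prod ?w (cycle_type n x)" by (simp add: cycle_prod_if)
  qed auto
  also have "(\<Sum>l=1..n. ?w l / real l) = harm n - ?\<mu> / 2"
  proof -
    have "?\<mu> = (\<Sum>l\<in>{1..n}. if p l then 1 / real l else 0)"
      by (subst sum.inter_filter[symmetric]) auto
    then have "harm n - ?\<mu> / 2 = (\<Sum>l=1..n. 1 / real l - (if p l then 1 / real l else 0) / 2)"
      by (simp only: sum_inverse_eq_harm[symmetric] sum_subtractf sum_divide_distrib)
    also have "\<dots> = (\<Sum>l=1..n. ?w l / real l)" by (intro sum.cong) (auto simp: field_simps)
    finally show ?thesis by simp
  qed
  then have "cycle_mean ?w n \<le> 1 / n * exp (harm n - ?\<mu> / 2)"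
    using cycle_mean_le[of ?w 1 n] assms by simp
  also have "\<dots> \<le> 1 / n * exp (1 + ln n - ?\<mu> / 2)"
    using harm_le_ln[OF assms] by (intro mult_left_mono) auto
  also have "\<dots> = exp (1 - ?\<mu> / 2)"
    using assms by (simp add: exp_add exp_diff)
  finally show ?thesis by simp
qed

text \<open>Give weight \<open>1 + 1 / \<mu>\<close> to the lengths satisfying \<open>p\<close>. Two
  such cycles make the product at least \<open>1 / \<mu>\<close> squared, and the excess
  \<open>1 / \<mu>\<close> is scaled so that the exponent in \<open>cycle_mean_one_plus_le\<close>
  is at most 1.\<close>

lemma perm_fraction_at_least_two:
  assumes "(\<Sum>l | l \<in> {1..n} \<and> p l. 1 / real l) \<le> \<mu>" "\<mu> > 0"
  shows "perm_fraction n (\<lambda>T. 2 \<le> size (filter_mset p T)) \<le> exp 1 * \<mu>\<^sup>2"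
proof -
  let ?v = "\<lambda>l. if p l then 1 / \<mu> else 0"
  have "perm_fraction n (\<lambda>T. 2 \<le> size (filter_mset p T)) \<le> cycle_mean (\<lambda>l. 1 + ?v l) n / (1 / \<mu>)\<^sup>2"
  proof (rule perm_fraction_markov)
    fix x assume *: "2 \<le> size (filter_mset p (cycle_type n x))"
    have "(1 / \<mu>)\<^sup>2 \<le> (1 + 1 / \<mu>)\<^sup>2" using assms by (intro power_mono) auto
    also have "\<dots> \<le> (1 + 1 / \<mu>) ^ size (filter_mset p (cycle_type n x))"
      using * assms by (intro power_increasing) auto
    also have "\<dots> = cycle_prod (\<lambda>l. if p l then 1 + 1 / \<mu> else 1) (cycle_type n x)"
      by (simp add: cycle_prod_if)
    also have "(\<lambda>l. if p l then 1 + 1 / \<mu> else 1) = (\<lambda>l. 1 + ?v l)" by auto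
    finally show "(1 / \<mu>)\<^sup>2 \<le> cycle_prod (\<lambda>l. 1 + ?v l) (cycle_type n x)" .
  qed (use assms in auto)
  also have "cycle_mean (\<lambda>l. 1 + ?v l) n \<le> exp (\<Sum>l=1..n. ?v l / real l)"
    by (rule cycle_mean_one_plus_le) (use assms in auto)
  also have "(\<Sum>l=1..n. ?v l / real l) = (\<Sum>l | l \<in> {1..n} \<and> p l. 1 / real l) / \<mu>"
    by (subst sum.inter_filter) (auto simp: sum_divide_distrib intro!: sum.cong)
  also have "\<dots> \<le> 1" using assms by simp
  finally show ?thesis using assms by (simp add: field_simps)
qed

text \<open>The constant weight \<open>3 / 2\<close> has product \<open>(3 / 2) ^ size T\<close>,
  and its excess \<open>1 / 2\<close> over 1 gives the mean bound
  \<open>exp (harm n / 2)\<close>.\<close>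

lemma perm_fraction_many_cycles:
  assumes "n > 0" "u > 0"
  shows "perm_fraction n (\<lambda>T. u \<le> (3 / 2) ^ size T) \<le> exp ((1 + ln n) / 2) / u"
proof -
  have "perm_fraction n (\<lambda>T. u \<le> (3 / 2) ^ size T) \<le> cycle_mean (\<lambda>l. 1 + 1 / 2) n / u"
    by (rule perm_fraction_markov) (use assms in \<open>auto simp: cycle_prod_const\<close>)
  also have "cycle_mean (\<lambda>l. 1 + 1 / 2) n \<le> exp (\<Sum>l=1..n. (1 / 2) / real l)"
    by (rule cycle_mean_one_plus_le) auto
  also have "(\<Sum>l=1..n. (1 / 2) / real l) = harm n / 2"
    by (simp only: sum_inverse_eq_harm[symmetric] sum_divide_distrib)
       (simp add: mult.commute)
  also have "exp (harm n / 2 :: real) \<le> exp ((1 + ln n) / 2)"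
    using harm_le_ln[OF assms(1)] by simp
  finally show ?thesis using assms by (simp add: divide_right_mono)
qed

section \<open>Unions of cycles of prescribed size\<close>

lemma subset_image_msetE:
  assumes "M \<subseteq># image_mset f N"
  obtains N' where "N' \<subseteq># N" "M = image_mset f N'"
proof -
  obtain K where K: "image_mset f N = M + K" using assms by (auto simp: subset_mset.le_iff_add)
  then obtain N1 N2 where "N = N1 + N2" "M = image_mset f N1" by (metis image_mset_eq_plusD)
  then show ?thesis using that[of N1] by simp
qed

text \<open>Lift the sub-multiset of lengths to a collection of orbits and take their union;
  distinct orbits are disjoint, so the cardinalities add up.\<close>

lemma invariant_set_of_subset_mset:
  assumes x: "x permutes A" "finite A" and M: "M \<subseteq># cycle_mset A x"
  obtains C where "C \<subseteq> A" "x ` C = C" "card C = \<Sum>\<^sub># M"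
proof -
  let ?O = "orbit x ` A"
  obtain N where N: "N \<subseteq># mset_set ?O" "M = image_mset card N"
    using M unfolding cycle_mset_def by (rule subset_image_msetE)
  have sub: "set_mset N \<subseteq> ?O" using N(1) x(2) set_mset_mono by fastforce
  \<comment> \<open>Each orbit occurs once in \<open>mset_set ?O\<close>, although lengths may
    repeat, so the lifted multiset is a set.\<close>
  have N_eq: "N = mset_set (set_mset N)"
  proof (rule multiset_eqI)
    fix S
    have "count N S \<le> count (mset_set ?O) S" using N(1) by (simp add: subseteq_mset_def)
    also have "\<dots> \<le> 1" using x(2) by (simp add: count_mset_set')
    finally show "count N S = count (mset_set (set_mset N)) S"
      by (cases "S \<in># N") (auto simp: count_mset_set' not_in_iff le_Suc_eq simp flip: count_greater_zero_iff)
  qed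
  let ?C = "\<Union>(set_mset N)"
  have "card ?C = (\<Sum>S\<in>set_mset N. card S)"
  proof (rule card_Union_disjoint)
    show "pairwise disjnt (set_mset N)"
      using disjoint_orbits[OF x] sub unfolding pairwise_def disjnt_def by (metis subsetD)
    show "\<And>S. S \<in> set_mset N \<Longrightarrow> finite S" using orbits_facts(1)[OF x] sub by auto
  qed
  also have "\<dots> = \<Sum>\<^sub># M" using N(2) N_eq by (metis sum_unfold_sum_mset)
  finally have "card ?C = \<Sum>\<^sub># M" .
  moreover have "?C \<subseteq> A" using orbits_facts(2)[OF x] sub by blast
  moreover have "x ` ?C = ?C"
  proof -
    have "x ` ?C = (\<Union>S\<in>set_mset N. x ` S)" by auto
    also have "\<dots> = (\<Union>S\<in>set_mset N. S)" using orbits_facts(4)[OF x] sub by (intro SUP_cong refl) blast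
    finally show ?thesis by simp
  qed
  ultimately show ?thesis using that by blast
qed

lemma sum_Union_le:
  fixes f :: "'a \<Rightarrow> real"
  assumes "finite I" "\<And>i. finite (S i)" "\<And>x. f x \<ge> 0"
  shows "sum f (\<Union>i\<in>I. S i) \<le> (\<Sum>i\<in>I. sum f (S i))"
  using assms(1)
proof (induction rule: finite_induct)
  case (insert i I)
  have "sum f (S i \<union> (\<Union>i\<in>I. S i)) + sum f (S i \<inter> (\<Union>i\<in>I. S i)) =
      sum f (S i) + sum f (\<Union>i\<in>I. S i)"
    by (rule sum.union_inter) (use insert assms in auto)
  moreover have "sum f (S i \<inter> (\<Union>i\<in>I. S i)) \<ge> 0" by (intro sum_nonneg assms)
  ultimately show ?case using insert by simp
qed simp

text \<open>An invariant \<open>t\<close>-set splits the permutation into two independent random ones, which together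
  have about \<open>ln t + ln (n - t)\<close> cycles, nearly twice as many as a typical permutation.\<close>

lemma perm_fraction_invariant_set:
  assumes t: "t \<le> n" and u: "u > 0"
  shows "perm_fraction n (\<lambda>T. (3 / 2) ^ size T < u \<and> (\<exists>M. M \<subseteq># T \<and> \<Sum>\<^sub># M = t))
    \<le> u * cycle_mean (\<lambda>_. 2 / 3) t * cycle_mean (\<lambda>_. 2 / 3) (n - t)"
proof -
  let ?A = "{1..n}"
  \<comment> \<open>This weight is the reciprocal of the base \<open>3 / 2\<close>: for a
    permutation with few cycles the product times \<open>u\<close> exceeds 1, so it dominates the
    indicator of the event.\<close>
  let ?w = "\<lambda>_::nat. 2 / 3 :: real"
  let ?S = "{x. x permutes ?A \<and> ((3 / 2) ^ size (cycle_type n x) < u \<and>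
     (\<exists>M. M \<subseteq># cycle_type n x \<and> \<Sum>\<^sub># M = t))}"
  let ?I = "{C. C \<subseteq> ?A \<and> card C = t}"
  let ?F = "\<lambda>x. u * cycle_prod ?w (cycle_mset ?A x)"
  have finI: "finite ?I" by (rule finite_subset[of _ "Pow ?A"]) auto
  have fin: "finite {x. x permutes ?A \<and> x ` C = C}" for C
    by (rule finite_subset[OF _ finite_permutations[of ?A]]) auto
  have nn: "?F x \<ge> 0" for x using u cycle_prod_nonneg[of ?w] by (intro mult_nonneg_nonneg) auto
  have "real (card ?S) = (\<Sum>x\<in>?S. 1)" by simp
  also have "\<dots> \<le> (\<Sum>x\<in>?S. ?F x)"
  proof (intro sum_mono)
    fix x assume "x \<in> ?S"
    then have "(3 / 2) ^ size (cycle_type n x) < u" by blast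
    then have "1 < u / (3 / 2) ^ size (cycle_type n x)" by (simp add: field_simps)
    then show "1 \<le> ?F x" by (simp add: cycle_prod_const cycle_type_eq power_divide field_simps)
  qed
  \<comment> \<open>Union bound over the candidates \<open>C\<close> for the invariant
    \<open>t\<close>-set; for each \<open>C\<close> the weighted sum factors into the two
    parts.\<close>
  also have "\<dots> \<le> (\<Sum>x\<in>(\<Union>C\<in>?I. {x. x permutes ?A \<and> x ` C = C}). ?F x)"
  proof (rule sum_mono2)
    show "?S \<subseteq> (\<Union>C\<in>?I. {x. x permutes ?A \<and> x ` C = C})"
    proof
      fix x assume "x \<in> ?S"
      then obtain M where x: "x permutes ?A" and M: "M \<subseteq># cycle_mset ?A x" "\<Sum>\<^sub># M = t"
        by (auto simp: cycle_type_eq)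
      obtain C where "C \<subseteq> ?A" "x ` C = C" "card C = \<Sum>\<^sub># M"
        by (rule invariant_set_of_subset_mset[OF x _ M(1)]) auto
      then show "x \<in> (\<Union>C\<in>?I. {x. x permutes ?A \<and> x ` C = C})" using x M by blast
    qed
  qed (use finI fin nn in auto)
  also have "\<dots> \<le> (\<Sum>C\<in>?I. \<Sum>x | x permutes ?A \<and> x ` C = C. ?F x)"
    using finI fin nn by (intro sum_Union_le) auto
  also have "\<dots> = (\<Sum>C\<in>?I. u * (cycle_weight ?w C * cycle_weight ?w (?A - C)))"
  proof (rule sum.cong[OF refl])
    fix C assume C: "C \<in> ?I"
    then have "(\<Sum>x | x permutes ?A \<and> x ` C = C. ?F x) =
       (\<Sum>s | s permutes C. \<Sum>t | t permutes ?A - C. ?F (s \<circ> t))"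
      by (intro sum_permutes_invariant) auto
    also have "\<dots> = (\<Sum>s | s permutes C. \<Sum>t | t permutes ?A - C.
        u * (cycle_prod ?w (cycle_mset C s) * cycle_prod ?w (cycle_mset (?A - C) t)))"
    proof (intro sum.cong refl)
      fix s t assume "s \<in> {s. s permutes C}" "t \<in> {t. t permutes ?A - C}"
      then show "?F (s \<circ> t) = u * (cycle_prod ?w (cycle_mset C s) * cycle_prod ?w (cycle_mset (?A - C) t))"
        using C cycle_mset_comp_Diff[of ?A C s t] by (simp add: cycle_prod_union)
    qed
    also have "\<dots> = u * (cycle_weight ?w C * cycle_weight ?w (?A - C))"
      unfolding cycle_weight_def sum_product by (simp add: sum_distrib_left)
    finally show "(\<Sum>x | x permutes ?A \<and> x ` C = C. ?F x) =
      u * (cycle_weight ?w C * cycle_weight ?w (?A - C))" .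
  qed
  also have "\<dots> = (\<Sum>C\<in>?I. u * (fact t * cycle_mean ?w t * (fact (n - t) * cycle_mean ?w (n - t))))"
  proof (rule sum.cong[OF refl])
    fix C assume C: "C \<in> ?I"
    then have "finite C" "card (?A - C) = n - t" by (auto simp: card_Diff_subset finite_subset)
    then show "u * (cycle_weight ?w C * cycle_weight ?w (?A - C)) =
      u * (fact t * cycle_mean ?w t * (fact (n - t) * cycle_mean ?w (n - t)))"
      using C by (simp add: cycle_weight_eq)
  qed
  \<comment> \<open>The number of sets \<open>C\<close> cancels the two factorials against
    \<open>fact n\<close>.\<close>
  also have "\<dots> = real (n choose t) * (u * (fact t * cycle_mean ?w t * (fact (n - t) * cycle_mean ?w (n - t))))"
    by (simp add: n_subsets)
  also have "\<dots> = fact n * (u * cycle_mean ?w t * cycle_mean ?w (n - t))"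
    using t by (simp add: binomial_fact)
  finally show ?thesis unfolding perm_fraction_def by (simp add: field_simps)
qed

text \<open>The exponent is \<open>2 / 3 - 1\<close>: the harmonic sum contributes
  \<open>n powr (2 / 3)\<close>, and \<open>cycle_mean_le\<close> contributes
  \<open>1 / n\<close>.\<close>

lemma cycle_mean_two_thirds_le:
  assumes "n > 0"
  shows "cycle_mean (\<lambda>_. 2 / 3) n \<le> exp (2 / 3) * real n powr (-1/3)"
proof -
  have "cycle_mean (\<lambda>_. 2 / 3) n \<le> 1 / n * exp (\<Sum>l=1..n. (2 / 3) / real l)"
    by (rule cycle_mean_le) (use assms in auto)
  also have "(\<Sum>l=1..n. (2 / 3) / real l) = 2 / 3 * harm n"
    by (simp only: sum_inverse_eq_harm[symmetric] sum_distrib_left) simp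
  also have "1 / n * exp (2 / 3 * harm n) \<le> 1 / n * exp (2 / 3 * (1 + ln n))"
    using harm_le_ln[OF assms] by (intro mult_left_mono) auto
  also have "\<dots> = exp (2 / 3) * real n powr (-1/3)"
  proof -
    have "1 / real n = exp (- ln n)" using assms by (simp add: exp_minus field_simps)
    then have "1 / real n * exp (2 / 3 * (1 + ln n)) = exp (2 / 3 + (-1/3) * ln n)"
      by (simp add: exp_add[symmetric] algebra_simps)
    then show ?thesis using assms by (simp add: powr_def exp_add[symmetric])
  qed
  finally show ?thesis .
qed

section \<open>Numbers with a large prime divisor\<close>

lemma multiplicity_eq_sum:
  fixes p m :: nat
  assumes p: "prime p" and m: "m > 0" "m < p ^ K"
  shows "multiplicity p m = (\<Sum>k=1..K. if p ^ k dvd m then 1 else 0)"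
proof -
  have "m \<noteq> 0" "\<not> is_unit p" using p m by auto
  have le: "multiplicity p m \<le> K"
  proof (rule ccontr)
    assume "\<not> ?thesis"
    then have "p ^ K dvd m" by (intro multiplicity_dvd') auto
    then show False using m by (simp add: dvd_imp_le leD)
  qed
  have "(\<Sum>k=1..K. if p ^ k dvd m then 1 else 0) = card {k\<in>{1..K}. p ^ k dvd m}"
    by (subst sum.inter_filter[symmetric]) auto
  also have "{k\<in>{1..K}. p ^ k dvd m} = {1..multiplicity p m}"
    using le \<open>m \<noteq> 0\<close> \<open>\<not> is_unit p\<close> by (auto simp: power_dvd_iff_le_multiplicity)
  finally show ?thesis by simp
qed

text \<open>Legendre's formula, with the number of multiples of \<open>p ^ k\<close> up to
  \<open>N\<close> bounded by \<open>N / p ^ k\<close> and the geometric series summed.\<close>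

lemma multiplicity_fact_le:
  fixes p :: nat
  assumes p: "prime p"
  shows "real (multiplicity p (fact N)) \<le> real N / (real p - 1)"
proof -
  have p2: "p \<ge> 2" using p prime_ge_2_nat by blast
  \<comment> \<open>Exponents up to \<open>N\<close> therefore account for the full multiplicity of
    every \<open>m \<le> N\<close>.\<close>
  have lt: "m < p ^ N" if "m \<in> {1..N}" for m
  proof -
    have "m < 2 ^ m" by simp
    also have "\<dots> \<le> (2::nat) ^ N" using that by (intro power_increasing) auto
    also have "\<dots> \<le> p ^ N" using p2 by (intro power_mono) auto
    finally show ?thesis .
  qed
  have "multiplicity p (fact N) = (\<Sum>m=1..N. multiplicity p m)"
    using p by (simp add: fact_prod prime_elem_multiplicity_prod_distrib)
  also have "\<dots> = (\<Sum>m=1..N. \<Sum>k=1..N. if p ^ k dvd m then 1 else 0)"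
    using lt p by (intro sum.cong refl multiplicity_eq_sum) auto
  also have "\<dots> = (\<Sum>k=1..N. \<Sum>m=1..N. if p ^ k dvd m then 1 else 0)"
    by (rule sum.swap)
  also have "\<dots> = (\<Sum>k=1..N. card {m\<in>{1..N}. p ^ k dvd m})"
    by (intro sum.cong refl, subst sum.inter_filter[symmetric]) auto
  finally have "real (multiplicity p (fact N)) = (\<Sum>k=1..N. real (card {m\<in>{1..N}. p ^ k dvd m}))"
    by simp
  also have "\<dots> \<le> (\<Sum>k=1..N. real N * (1 / real p) ^ k)"
  proof (intro sum_mono)
    fix k
    have pk: "p ^ k > 0" using p2 by simp
    have "{m\<in>{1..N}. p ^ k dvd m} \<subseteq> (\<lambda>j. p ^ k * j) ` {1..N div p ^ k}"
      using pk by (auto elim!: dvdE simp: less_eq_div_iff_mult_less_eq mult.commute Suc_le_eq)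
    then have "card {m\<in>{1..N}. p ^ k dvd m} \<le> card {1..N div p ^ k}"
      by (intro surj_card_le) auto
    then have "real (card {m\<in>{1..N}. p ^ k dvd m}) \<le> real (N div p ^ k)" by simp
    also have "\<dots> \<le> real N / real (p ^ k)" by (rule of_nat_div_le_of_nat)
    finally show "real (card {m\<in>{1..N}. p ^ k dvd m}) \<le> real N * (1 / real p) ^ k"
      by (simp add: power_divide)
  qed
  also have "\<dots> = real N * (\<Sum>k=1..N. (1 / real p) ^ k)" by (simp add: sum_distrib_left)
  also have "(\<Sum>k=1..N. (1 / real p) ^ k) = (1 / p - (1 / p) ^ Suc N) / (1 - 1 / p)"
    using p2 by (subst sum_gp) auto
  also have "\<dots> \<le> (1 / p) / (1 - 1 / p)"
    using p2 by (intro divide_right_mono) auto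
  also have "\<dots> = 1 / (real p - 1)" using p2 by (simp add: field_simps)
  finally show ?thesis by (simp add: mult_left_mono)
qed

text \<open>A crude Stirling bound; the induction step rests on
  \<open>N * ln (1 + 1 / N) \<le> 1\<close>.\<close>

lemma ln_fact_ge:
  assumes "N > 0"
  shows "real N * (ln N - 1) \<le> ln (fact N)"
  using assms
proof (induction N rule: nat_induct_non_zero)
  case (Suc N)
  have "ln (1 + 1 / real N) \<le> 1 / real N" using Suc.hyps by (intro ln_add_one_self_le_self) auto
  moreover have "1 + 1 / real N = real (Suc N) / real N" using Suc.hyps by (simp add: field_simps)
  ultimately have "ln (real (Suc N)) - ln (real N) \<le> 1 / real N"
    using Suc.hyps by (simp add: ln_div)
  then have "real N * (ln (real (Suc N)) - ln (real N)) \<le> real N * (1 / real N)"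
    by (intro mult_left_mono) auto
  then have "real N * ln (real (Suc N)) - real N * ln (real N) \<le> 1"
    using Suc.hyps by (simp add: right_diff_distrib)
  moreover have "ln (fact (Suc N) :: real) = ln (real (Suc N)) + ln (fact N)"
    by (simp add: ln_mult)
  ultimately show ?case using Suc.IH by (simp add: algebra_simps)
qed simp

text \<open>The lower half of Mertens' first theorem: expand \<open>ln (fact N)\<close> over the
  prime factorisation, bound the multiplicities from above by \<open>multiplicity_fact_le\<close>
  and the logarithm from below by \<open>ln_fact_ge\<close>, and divide by \<open>N\<close>.\<close>

lemma sum_ln_prime_ge:
  assumes "N > 0"
  shows "ln (real N) - 1 \<le> (\<Sum>p | prime p \<and> p \<le> N. ln (real p) / (real p - 1))"
proof -
  have fin: "finite {p. prime p \<and> p \<le> N}" by (rule finite_subset[of _ "{..N}"]) auto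
  have "ln (fact N :: real) = ln (real (fact N))" by simp
  also have "(fact N :: nat) = (\<Prod>p\<in>prime_factors (fact N). p ^ multiplicity p (fact N))"
    by (subst prime_factorization_nat) auto
  also have "ln (real \<dots>) = (\<Sum>p\<in>prime_factors (fact N). multiplicity p (fact N) * ln (real p))"
  proof -
    have "real p > 0" if "p \<in> prime_factors (fact N :: nat)" for p
      using that prime_gt_0_nat by (auto simp: in_prime_factors_iff)
    then show ?thesis by (simp add: ln_prod ln_realpow)
  qed
  also have "\<dots> \<le> (\<Sum>p | prime p \<and> p \<le> N. multiplicity p (fact N) * ln (real p))"
    by (rule sum_mono2[OF fin])
       (auto simp: in_prime_factors_iff prime_dvd_fact_iff dest: prime_gt_0_nat)
  also have "\<dots> \<le> (\<Sum>p | prime p \<and> p \<le> N. real N / (real p - 1) * ln (real p))"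
  proof (intro sum_mono mult_right_mono)
    fix p assume "p \<in> {p. prime p \<and> p \<le> N}"
    then have "prime p" "p > 0" using prime_gt_0_nat by auto
    then show "real (multiplicity p (fact N)) \<le> real N / (real p - 1)" "0 \<le> ln (real p)"
      using multiplicity_fact_le by auto
  qed
  also have "\<dots> = real N * (\<Sum>p | prime p \<and> p \<le> N. ln (real p) / (real p - 1))"
    by (simp add: sum_distrib_left)
  finally have "real N * (ln (real N) - 1) \<le>
      real N * (\<Sum>p | prime p \<and> p \<le> N. ln (real p) / (real p - 1))"
    using ln_fact_ge[OF assms] by linarith
  then show ?thesis using assms by (subst (asm) mult_le_cancel_left_pos) auto
qed

text \<open>Equivalently \<open>l = t * p\<close> with \<open>9 * t \<le> p\<close>. A cycle of such
  a positive length has a power consisting of only \<open>t\<close> cycles of length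
  \<open>p\<close>.\<close>

definition big_prime_divisor :: "nat \<Rightarrow> bool" where
  "big_prime_divisor l \<longleftrightarrow> (\<exists>p. prime p \<and> p dvd l \<and> 9 * l \<le> p * p)"

lemma ln_div_le_harm: 
  assumes "p > 0"
  shows "ln (real p / 9) \<le> (\<Sum>t=1..p div 9. 1 / real t)"
proof -
  have "real p / 9 \<le> real (p div 9) + 1"
  proof -
    have "p \<le> 9 * (p div 9) + 9" by presburger
    then have "real p \<le> real (9 * (p div 9) + 9)" by (simp only: of_nat_le_iff)
    then show ?thesis by simp
  qed
  then have "ln (real p / 9) \<le> ln (real (p div 9) + 1)" using assms by (subst ln_le_cancel_iff) auto
  also have "\<dots> \<le> harm (p div 9)" by (rule ln_le_harm)
  finally show ?thesis by (simp only: sum_inverse_eq_harm)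
qed

text \<open>Sum over the products \<open>t * p\<close> with \<open>p\<close> a prime up to
  \<open>N\<close>, the integer part of \<open>sqrt n\<close>, and \<open>t \<le> p div 9\<close>.
  For fixed \<open>p > 81\<close> the inner sum is at least \<open>ln p / (2 * p)\<close>, which
  exceeds a quarter of the Mertens term. The total is about \<open>ln N / 4\<close>, that is
  \<open>ln n / 8\<close>.\<close>

lemma sum_big_prime_divisor_ge:
  "\<exists>C. \<forall>n>0. ln (real n) / 8 - C \<le> (\<Sum>l | l \<in> {1..n} \<and> big_prime_divisor l. 1 / real l)"
proof -
  define f where "f = (\<lambda>p::nat. ln (real p) / (real p - 1))"
  \<comment> \<open>The primes up to 81 are discarded at the cost of a constant, because
    \<open>ln (p / 9) \<ge> ln p / 2\<close> requires \<open>p \<ge> 81\<close>.\<close>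
  define C0 where "C0 = (\<Sum>p | prime p \<and> p \<le> (81::nat). f p)"
  have f0: "f p \<ge> 0" if "prime p" for p
    using prime_gt_1_nat[OF that] by (auto simp: f_def)
  have main: "(ln (real N) - 1 - C0) / 4 \<le> (\<Sum>l | l \<in> {1..n} \<and> big_prime_divisor l. 1 / real l)"
    if N: "N > 0" "N * N \<le> n" for N n
  proof -
    have finP: "finite {p. prime p \<and> 81 < p \<and> p \<le> N}" by (rule finite_subset[of _ "{..N}"]) auto
    have fin: "finite {p. prime p \<and> p \<le> N}" by (rule finite_subset[of _ "{..N}"]) auto
    have "ln (real N) - 1 \<le> (\<Sum>p | prime p \<and> p \<le> N. f p)"
      using sum_ln_prime_ge[OF N(1)] by (simp add: f_def)
    \<comment> \<open>An inequality rather than an equality, since for small \<open>N\<close> the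
      full constant \<open>C0\<close> is still used.\<close>
    also have "\<dots> \<le> (\<Sum>p\<in>{p. prime p \<and> p \<le> 81} \<union> {p. prime p \<and> 81 < p \<and> p \<le> N}. f p)"
      using f0 by (intro sum_mono2) auto
    also have "\<dots> = C0 + (\<Sum>p | prime p \<and> 81 < p \<and> p \<le> N. f p)"
      unfolding C0_def using finP by (intro sum.union_disjoint) auto
    finally have "(ln (real N) - 1 - C0) / 4 \<le> (\<Sum>p | prime p \<and> 81 < p \<and> p \<le> N. f p / 4)"
      by (simp add: sum_divide_distrib[symmetric])
    also have "\<dots> \<le> (\<Sum>p | prime p \<and> 81 < p \<and> p \<le> N. \<Sum>t=1..p div 9. 1 / real (t * p))"
    proof (rule sum_mono)
      fix p assume "p \<in> {p. prime p \<and> 81 < p \<and> p \<le> N}"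
      then have p: "p > 81" by simp
      have "ln (81::real) \<le> ln (real p)" using p by simp
      moreover have "ln (81::real) = 2 * ln 9" using ln_realpow[of "9::real" 2] by simp
      ultimately have "ln (real p) / 2 \<le> ln (real p / 9)" using p by (simp add: ln_div)
      also have "\<dots> \<le> (\<Sum>t=1..p div 9. 1 / real t)" by (rule ln_div_le_harm) (use p in auto)
      finally have *: "ln (real p) / 2 \<le> (\<Sum>t=1..p div 9. 1 / real t)" .
      have "f p / 4 = (ln (real p) / 2) * (1 / (2 * (real p - 1)))" by (simp add: f_def)
      also have "\<dots> \<le> (ln (real p) / 2) * (1 / real p)"
        using p by (intro mult_left_mono divide_left_mono) auto
      also have "\<dots> \<le> (\<Sum>t=1..p div 9. 1 / real t) * (1 / real p)"
        using * by (intro mult_right_mono) auto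
      also have "\<dots> = (\<Sum>t=1..p div 9. 1 / real (t * p))"
        unfolding sum_distrib_right by (intro sum.cong refl) simp
      finally show "f p / 4 \<le> (\<Sum>t=1..p div 9. 1 / real (t * p))" .
    qed
    also have "\<dots> = (\<Sum>(p, t)\<in>(SIGMA p:{p. prime p \<and> 81 < p \<and> p \<le> N}. {1..p div 9}). 1 / real (t * p))"
      using finP by (intro sum.Sigma) auto
    also have "\<dots> = (\<Sum>l\<in>(\<lambda>(p, t). t * p) ` (SIGMA p:{p. prime p \<and> 81 < p \<and> p \<le> N}. {1..p div 9}). 1 / real l)"
    proof (subst sum.reindex)
      show "inj_on (\<lambda>(p, t). t * p) (SIGMA p:{p. prime p \<and> 81 < p \<and> p \<le> N}. {1..p div 9})"
      proof (rule inj_onI)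
        fix u v
        assume uv: "u \<in> (SIGMA p:{p. prime p \<and> 81 < p \<and> p \<le> N}. {1..p div 9})"
          "v \<in> (SIGMA p:{p. prime p \<and> 81 < p \<and> p \<le> N}. {1..p div 9})"
          "(case u of (p, t) \<Rightarrow> t * p) = (case v of (p, t) \<Rightarrow> t * p)"
        obtain p t p' t' where u: "u = (p, t)" and v: "v = (p', t')" by fastforce
        have A: "prime p" "prime p'" "1 \<le> t" "t \<le> p div 9" "1 \<le> t'" "t' \<le> p' div 9"
          and eq: "t * p = t' * p'" using uv u v by auto
        \<comment> \<open>The factorisation \<open>t * p\<close> is unique: distinct primes would
          give \<open>p \<le> t' \<le> p' div 9\<close> and
          \<open>p' \<le> t \<le> p div 9\<close>.\<close>
        have "p = p'"
        proof (rule ccontr)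
          assume "p \<noteq> p'"
          then have "coprime p p'" using A primes_coprime by blast
          have "p dvd t' * p'" "p' dvd t * p" using eq by (metis dvd_triv_right)+
          then have "p dvd t'" "p' dvd t"
            using \<open>coprime p p'\<close> by (simp_all add: coprime_dvd_mult_left_iff coprime_commute)
          then have "p \<le> t'" "p' \<le> t" using A by (auto intro!: dvd_imp_le)
          then show False using A by linarith
        qed
        moreover have "p > 0" using A prime_gt_0_nat by blast
        ultimately show "u = v" using eq u v by auto
      qed
    qed (simp add: case_prod_unfold)
    also have "\<dots> \<le> (\<Sum>l | l \<in> {1..n} \<and> big_prime_divisor l. 1 / real l)"
    proof (rule sum_mono2)
      show "(\<lambda>(p, t). t * p) ` (SIGMA p:{p. prime p \<and> 81 < p \<and> p \<le> N}. {1..p div 9}) \<subseteq>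
         {l. l \<in> {1..n} \<and> big_prime_divisor l}"
      proof
        fix l assume "l \<in> (\<lambda>(p, t). t * p) ` (SIGMA p:{p. prime p \<and> 81 < p \<and> p \<le> N}. {1..p div 9})"
        then obtain p t where A: "prime p" "81 < p" "p \<le> N" "1 \<le> t" "t \<le> p div 9" and l: "l = t * p"
          by auto
        have "t * 9 \<le> p" using A by linarith
        then have 9: "9 * (t * p) \<le> p * p" using mult_le_mono1[of "t * 9" p p] by (simp add: mult_ac)
        have "p * p \<le> N * N" using A by (intro mult_le_mono) auto
        then have "t * p \<le> n" using 9 N by linarith
        moreover have "big_prime_divisor (t * p)"
          unfolding big_prime_divisor_def using A(1) 9 by (intro exI[of _ p]) simp
        ultimately show "l \<in> {l. l \<in> {1..n} \<and> big_prime_divisor l}"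
          using A l by (simp add: Suc_le_eq)
      qed
    qed auto
    finally show ?thesis .
  qed
  have "ln (real n) / 8 - (ln 2 + 1 + C0) / 4 \<le> (\<Sum>l | l \<in> {1..n} \<and> big_prime_divisor l. 1 / real l)"
    if n: "n > 0" for n
  proof -
    have s1: "sqrt (real n) \<ge> 1" using n by simp
    then have "nat \<lfloor>sqrt (real n)\<rfloor> > 0" "real (nat \<lfloor>sqrt (real n)\<rfloor>) \<le> sqrt (real n)"
      "sqrt (real n) \<le> real (nat \<lfloor>sqrt (real n)\<rfloor>) + 1" by linarith+
    then obtain N where N: "N > 0" "real N \<le> sqrt (real n)" "sqrt (real n) \<le> real N + 1" by blast
    have "real (N * N) \<le> sqrt (real n) * sqrt (real n)"
      unfolding of_nat_mult using N by (intro mult_mono) auto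
    also have "\<dots> = real n" by simp
    finally have "N * N \<le> n" by (simp only: of_nat_le_iff)
    \<comment> \<open>Rounding the square root down costs at most a factor 2, hence the
      \<open>ln 2\<close> in the constant.\<close>
    have "sqrt (real n) \<le> 2 * real N" using N by linarith
    then have "ln (sqrt (real n)) \<le> ln (2 * real N)" using s1 N(1) by (subst ln_le_cancel_iff) auto
    then have "ln (real n) / 2 \<le> ln 2 + ln (real N)"
      using n N by (simp add: ln_sqrt ln_mult)
    then show ?thesis using main[OF N(1) \<open>N * N \<le> n\<close>] by (simp add: field_simps)
  qed
  then show ?thesis by blast
qed

section \<open>Typical cycle types\<close>

lemma permutes_funpow:
  assumes "x permutes A"
  shows "(x ^^ i) permutes A"
proof (induction i)
  case 0
  then show ?case by (simp add: id_def[symmetric])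
next
  case (Suc i)
  then show ?case using permutes_compose[OF Suc assms] by (simp add: o_def)
qed

lemma funpow_fixes_iff:
  assumes "x permutes A" "finite A"
  shows "(x ^^ k) a = a \<longleftrightarrow> card (orbit x a) dvd k"
proof -
  have self: "a \<in> orbit x a" by (rule permutes_self_in_orbit[OF assms])
  define D where "D = funpow_dist1 x a a"
  have D: "orbit x a = (\<lambda>n. (x ^^ n) a) ` {0..<D}"
    unfolding D_def by (rule orbit_conv_funpow_dist1[OF self])
  have inj: "inj_on (\<lambda>n. (x ^^ n) a) {0..<D}"
    unfolding D_def by (rule inj_on_funpow_dist1[OF self])
  have card: "card (orbit x a) = D" unfolding D using card_image[OF inj] by simp
  have "D > 0" by (simp add: D_def)
  have "(x ^^ D) a = a" unfolding D_def by (rule funpow_dist1_prop[OF self])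
  then have "(x ^^ k) a = (x ^^ (k mod D)) a" by (simp add: funpow_mod_eq)
  moreover have "(x ^^ (k mod D)) a = (x ^^ 0) a \<longleftrightarrow> k mod D = 0"
    using inj \<open>D > 0\<close> by (intro inj_on_eq_iff[OF inj]) auto
  ultimately show ?thesis by (simp add: card dvd_eq_mod_eq_0)
qed

text \<open>Both sides have the same multiples: either divides \<open>k\<close> exactly when
  \<open>x ^^ (i * k)\<close> fixes \<open>a\<close>.\<close>

lemma card_orbit_funpow:
  assumes "x permutes A" "finite A"
  shows "card (orbit (x ^^ i) a) = card (orbit x a) div gcd (card (orbit x a)) i"
proof -
  let ?L = "card (orbit x a)"
  have "?L > 0"
    using permutes_self_in_orbit[OF assms] by (auto simp: card_gt_0_iff intro!: finite_orbit)
  have "card (orbit (x ^^ i) a) dvd k \<longleftrightarrow> ?L div gcd ?L i dvd k" for k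
  proof -
    have "card (orbit (x ^^ i) a) dvd k \<longleftrightarrow> ((x ^^ i) ^^ k) a = a"
      using funpow_fixes_iff[OF permutes_funpow[OF assms(1)] assms(2)] by blast
    also have "\<dots> \<longleftrightarrow> ?L dvd i * k"
      using funpow_fixes_iff[OF assms] by (simp add: funpow_mult)
    also have "\<dots> \<longleftrightarrow> ?L div gcd ?L i dvd k"
    proof -
      define g where "g = gcd ?L i"
      have "g > 0" using \<open>?L > 0\<close> by (simp add: g_def)
      then obtain L' i' where L': "?L = L' * g" "i = i' * g" "coprime L' i'"
        using gcd_coprime_exists[of ?L i] unfolding g_def by auto
      have "?L dvd i * k \<longleftrightarrow> L' * g dvd (i' * k) * g" unfolding L' by (simp add: mult_ac)
      also have "\<dots> \<longleftrightarrow> L' dvd i' * k" using \<open>g > 0\<close> by simp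
      also have "\<dots> \<longleftrightarrow> L' dvd k" using L'(3) by (simp add: coprime_dvd_mult_right_iff)
      also have "L' = ?L div g" using L'(1) \<open>g > 0\<close> by simp
      finally show ?thesis unfolding g_def .
    qed
    finally show ?thesis .
  qed
  then show ?thesis by (metis dvd_antisym dvd_refl)
qed

lemma replicate_msetI: "\<forall>l\<in>#T. l = d \<Longrightarrow> T = replicate_mset (size T) d"
  by (induction T) auto

lemma cycle_mset_const:
  assumes "x permutes A" "finite A" "\<And>a. a \<in> A \<Longrightarrow> card (orbit x a) = d" "m * d = card A" "d > 0"
  shows "cycle_mset A x = replicate_mset m d"
proof -
  have "\<forall>l\<in>#cycle_mset A x. l = d" using assms(2,3) by (auto simp: cycle_mset_def)
  then have *: "cycle_mset A x = replicate_mset (size (cycle_mset A x)) d"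
    by (rule replicate_msetI)
  have "\<Sum>\<^sub># (replicate_mset (size (cycle_mset A x)) d) = card A"
    using sum_mset_cycle_mset[OF assms(1,2)] *[symmetric] by simp
  then have "size (cycle_mset A x) * d = m * d" using assms(4) by simp
  then have "size (cycle_mset A x) = m" using assms(5) by simp
  then show ?thesis using *[symmetric] by simp
qed

lemma cycle_mset_id:
  assumes "finite A"
  shows "cycle_mset A id = replicate_mset (card A) 1"
proof (rule cycle_mset_const)
  fix a show "card (orbit id a) = 1"
    using orbit_eq_singleton_iff[of id a] by simp
qed (use assms in auto)

text \<open>A common multiple of the other lengths as exponent turns all other cycles into fixed
  points and isolates one cycle, which breaks into \<open>gcd L i\<close> cycles of equal
  length.\<close>

lemma cycle_mset_funpow:
  assumes x: "x permutes A" "finite A" and T: "cycle_mset A x = add_mset L T"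
    and i: "\<And>j. j \<in># T \<Longrightarrow> j dvd i"
  shows "cycle_mset A (x ^^ i) =
    replicate_mset (gcd L i) (L div gcd L i) + replicate_mset (card A - L) 1"
proof -
  have "L \<in># cycle_mset A x" using T by simp
  then obtain a where a: "a \<in> A" "card (orbit x a) = L"
    using x(2) by (auto simp: cycle_mset_def)
  let ?O = "orbit x a"
  have O: "finite ?O" "?O \<subseteq> A" using orbits_facts[OF x, of ?O] a by auto
  have "L > 0" using a O(1) orbit_nonempty[of x a] by (metis card_gt_0_iff)
  have "mset_set (orbit x ` A) = add_mset ?O (mset_set (orbit x ` A - {?O}))"
    using a x(2) by (intro mset_set.remove) auto
  then have T_eq: "T = image_mset card (mset_set (orbit x ` A - {?O}))"
    using T a by (simp add: cycle_mset_def)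
  have fixed: "(x ^^ i) b = b" if b: "b \<in> A - ?O" for b
  proof -
    have "orbit x b \<noteq> ?O" using permutes_self_in_orbit[OF x, of b] b by auto
    then have "card (orbit x b) \<in># T" unfolding T_eq using b x(2) by auto
    then show ?thesis using i funpow_fixes_iff[OF x] by blast
  qed
  have y: "(x ^^ i) permutes ?O"
    by (rule permutes_superset[OF permutes_funpow[OF x(1)]]) (use fixed in auto)
  have "cycle_mset A (x ^^ i) = cycle_mset ?O (x ^^ i) + cycle_mset (A - ?O) id"
    using cycle_mset_comp_Diff[OF x(2) O(2) y, of id] by simp
  also have "cycle_mset (A - ?O) id = replicate_mset (card A - L) 1"
    using x(2) O a by (simp add: cycle_mset_id card_Diff_subset)
  also have "cycle_mset ?O (x ^^ i) = replicate_mset (gcd L i) (L div gcd L i)"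
  proof (rule cycle_mset_const[OF y O(1)])
    fix b assume "b \<in> ?O"
    then have "orbit x b = ?O" by (rule permutes_orbit_eq[OF x])
    then show "card (orbit (x ^^ i) b) = L div gcd L i" using card_orbit_funpow[OF x] a by metis
  next
    have "L div gcd L i * gcd L i = L" by simp
    then show "L div gcd L i > 0" using \<open>L > 0\<close> by (cases "L div gcd L i") auto
  qed (use a in simp)
  finally show ?thesis .
qed

lemma size_filter_mset_le_1D:
  assumes "size (filter_mset P T) \<le> 1" "l \<in># T" "P l" "j \<in># T - {#l#}"
  shows "\<not> P j"
proof
  assume "P j"
  obtain T' where T: "T = add_mset l T'" using assms(2) by (metis insert_DiffM)
  then have "filter_mset P T' \<noteq> {#}" using assms(4) \<open>P j\<close> by auto
  moreover have "size (filter_mset P T') = 0" using assms(1,3) T by simp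
  ultimately show False by (simp only: size_eq_0_iff_empty)
qed

lemma size_filter_mset_ge_2E:
  assumes "2 \<le> size (filter_mset P T)"
  obtains a b where "a \<in># T" "b \<in># T - {#a#}" "P a" "P b"
proof -
  have "filter_mset P T \<noteq> {#}" 
  proof
    assume "filter_mset P T = {#}"
    then have "size (filter_mset P T) = 0" by simp
    then show False using assms by linarith
  qed
  then obtain a where "a \<in># filter_mset P T" by (meson multiset_nonemptyE)
  then have a: "a \<in># T" "P a" by auto
  then obtain T' where T: "T = add_mset a T'" "P a" by (metis insert_DiffM)
  then have "1 \<le> size (filter_mset P T')" using assms by simp
  then have "filter_mset P T' \<noteq> {#}" by force
  then obtain b where "b \<in># filter_mset P T'" by (meson multiset_nonemptyE)
  then show ?thesis using that[of a b] T by simp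
qed

text \<open>In the application \<open>q ^ 96 = n\<close>. The exponent 56 exceeds 48, which makes
  the first clause likely, and stays below \<open>2 * 94 / 3 - 4\<close>, which makes it unlikely
  that the second clause fails while the first holds.\<close>

definition typical :: "nat \<Rightarrow> real \<Rightarrow> nat multiset \<Rightarrow> bool" where
  "typical n q T \<longleftrightarrow>
     (3 / 2) ^ size T < q ^ 56 \<and>
     (\<forall>r c. r dvd n \<and> real r \<le> q\<^sup>2 \<and> 1 \<le> c \<and> c < r \<longrightarrow>
        \<not> (\<exists>M. M \<subseteq># T \<and> \<Sum>\<^sub># M = c * (n div r))) \<and>
     (\<forall>c. q \<le> real c \<longrightarrow> size (filter_mset (\<lambda>l. c dvd l) T) \<le> 1) \<and>
     (\<forall>s. 2 \<le> s \<and> real s \<le> q\<^sup>2 \<longrightarrow> (\<exists>l\<in>#T. q\<^sup>2 \<le> real l \<and> \<not> s dvd l)) \<and>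
     2 \<le> size (filter_mset (\<lambda>l. real n / q \<le> real l) T) \<and>
     (\<exists>l\<in>#T. q\<^sup>2 \<le> real l \<and> big_prime_divisor l)"

context
  fixes n :: nat and q :: real and x :: "nat \<Rightarrow> nat" and T :: "nat multiset"
  assumes x: "x permutes {1..n}" and T: "cycle_type n x = T" and q: "q \<ge> 2" "q ^ 96 = real n"
    and typical: "typical n q T"
begin

lemma typical_sum:
  assumes "r dvd n" "real r \<le> q\<^sup>2" "1 \<le> c" "c < r" "M \<subseteq># T"
  shows "\<Sum>\<^sub># M \<noteq> c * (n div r)"
  using typical assms unfolding typical_def by blast

lemma typical_not_dvd:
  assumes "2 \<le> s" "real s \<le> q\<^sup>2"
  obtains l where "l \<in># T" "q\<^sup>2 \<le> real l" "\<not> s dvd l"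
  using typical assms unfolding typical_def by blast

lemma typical_long:
  obtains a b where "a \<in># T" "b \<in># T - {#a#}" "real n / q \<le> real a" "real n / q \<le> real b"
proof (rule size_filter_mset_ge_2E)
  show "2 \<le> size (filter_mset (\<lambda>l. real n / q \<le> real l) T)"
    using typical unfolding typical_def by blast
qed (use that in blast)

lemma cycle_type_sum: "\<Sum>\<^sub># T = n"
  using sum_mset_cycle_mset[OF x] T by (simp add: cycle_type_eq)

lemma cycle_type_pos: "l \<in># T \<Longrightarrow> l > 0"
  using zero_notin_cycle_mset[OF x] T by (cases l) (auto simp: cycle_type_eq)

text \<open>Since \<open>ln (3 / 2) \<ge> 1 / 3\<close>, the first clause gives fewer than
  \<open>168 * ln q\<close> cycles, whereas \<open>2 * ln n = 192 * ln q\<close>.\<close>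

lemma typical_few_cycles: "real (size T) < 2 * ln (real n)"
proof -
  have "(3 / 2 :: real) ^ size T < q ^ 56" using typical by (simp add: typical_def)
  then have "ln ((3 / 2 :: real) ^ size T) < ln (q ^ 56)" using q by (subst ln_less_cancel_iff) auto
  then have 1: "real (size T) * ln (3 / 2) < 56 * ln q" using q by (simp add: ln_realpow)
  have "1 / 3 \<le> ln (3 / 2 :: real)" using ln_one_minus_pos_upper_bound[of "1/3"] ln_div[of 1 "3/2"]
    by (simp add: ln_div)
  then have "real (size T) * (1 / 3) \<le> real (size T) * ln (3 / 2)" by (intro mult_left_mono) auto
  moreover have "ln (real n) = 96 * ln q" using q by (simp add: q(2)[symmetric] ln_realpow)
  moreover have "ln q > 0" using q by simp
  ultimately show ?thesis using 1 by linarith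
qed

lemma typical_unique:
  assumes "q \<le> real c" "l \<in># T" "c dvd l" "j \<in># T - {#l#}"
  shows "\<not> c dvd j"
proof (rule size_filter_mset_le_1D[of "\<lambda>l. c dvd l" T l j])
  show "size (filter_mset (\<lambda>l. c dvd l) T) \<le> 1"
    using typical assms(1) unfolding typical_def by blast
qed (use assms in auto)

text \<open>Consequently a cycle that permutes \<open>c \<ge> q\<close> blocks fills these blocks
  without the help of other cycles.\<close>

lemma typical_unique':
  assumes "q \<le> real c" "l \<in># T" "c dvd l" "M \<subseteq># T - {#l#}" "\<forall>j\<in>#M. c dvd j"
  shows "M = {#}"
proof (rule ccontr)
  assume "M \<noteq> {#}"
  then obtain j where "j \<in># M" by (meson multiset_nonemptyE)
  then show False using typical_unique[OF assms(1-3), of j] assms(4,5) by (meson mset_subset_eqD)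
qed

lemma typical_eliminates:
  assumes r: "r dvd n" "1 < r" "r < n"
  shows "eliminates n T r"
proof (rule ccontr)
  assume "\<not> eliminates n T r"
  define s where "s = n div r"
  have n: "n = r * s" using r by (simp add: s_def)
  have s: "s \<ge> 2" using r n by (cases "s = 0 \<or> s = 1") auto
  have rs: "real r * real s = q ^ 96" using n q(2) by (metis of_nat_mult)
  have blocks: "\<exists>c M. 1 \<le> c \<and> c dvd l \<and> l \<le> c * s \<and> c \<le> r \<and> M \<subseteq># T - {#l#} \<and>
      (\<forall>j\<in>#M. c dvd j) \<and> \<Sum>\<^sub># M = c * s - l" if "l \<in># T" for l
    using \<open>\<not> eliminates n T r\<close> that unfolding eliminates_def Let_def s_def[symmetric] by blast
  have q0: "q > 0" using q by linarith
  \<comment> \<open>From \<open>q * s \<le> l \<le> c * s\<close> follows \<open>c \<ge> q\<close>;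
    the cycle is then alone in its \<open>c\<close> blocks, so \<open>l = c * s\<close>.\<close>
  have exact: "s dvd l" if l: "l \<in># T" "q * real s \<le> real l" for l
  proof -
    obtain c M where cM: "1 \<le> c" "c dvd l" "l \<le> c * s" "M \<subseteq># T - {#l#}"
      "\<forall>j\<in>#M. c dvd j" "\<Sum>\<^sub># M = c * s - l" using blocks[OF l(1)] by blast
    have "real l \<le> real (c * s)" using cM(3) by (simp only: of_nat_le_iff)
    then have "q * real s \<le> real c * real s" using l(2) by simp
    then have "q \<le> real c" using s by simp
    then have "M = {#}" using typical_unique'[OF _ l(1) cM(2,4,5)] by blast
    then have "c * s = l" using cM by simp
    then show ?thesis by auto
  qed
  show False
  proof (cases "real r \<le> q\<^sup>2")
    case True
    \<comment> \<open>For this cycle \<open>c = r\<close> is impossible because \<open>c\<close>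
      divides \<open>l\<close>. So \<open>l\<close> and the companions in \<open>M\<close> form a
      union of cycles of the forbidden size \<open>c * s\<close> with \<open>c < r\<close>.\<close>
    then obtain l where l: "l \<in># T" "\<not> r dvd l" using typical_not_dvd[of r] r by (metis Suc_1 Suc_leI)
    obtain c M where cM: "1 \<le> c" "c dvd l" "l \<le> c * s" "c \<le> r" "M \<subseteq># T - {#l#}"
      "\<Sum>\<^sub># M = c * s - l" using blocks[OF l(1)] by blast
    have "c < r" using cM l by (metis le_neq_implies_less)
    moreover have "add_mset l M \<subseteq># T" using cM(5) l(1) by (simp add: insert_subset_eq_iff)
    moreover have "\<Sum>\<^sub># (add_mset l M) = c * (n div r)" using cM by (simp add: s_def)
    ultimately show False using typical_sum[OF r(1) True cM(1)] by blast
  next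
    case False
    show False
    proof (cases "q \<le> real s")
      case True
      obtain a b where ab: "a \<in># T" "b \<in># T - {#a#}" "real n / q \<le> real a" "real n / q \<le> real b"
        by (rule typical_long)
      have "b \<in># T" using ab(2) by (rule in_diffD)
      \<comment> \<open>Here \<open>r > q\<^sup>2\<close> enters: both long cycles satisfy
        \<open>exact\<close>, so \<open>s \<ge> q\<close> would divide two lengths.\<close>
      have large: "q * real s \<le> real n / q"
      proof -
        have "q\<^sup>2 * real s \<le> real r * real s" using False s by (intro mult_right_mono) auto
        then show ?thesis using q0 n by (simp add: field_simps power2_eq_square)
      qed
      have "s dvd a" "s dvd b"
        using exact[OF ab(1)] exact[OF \<open>b \<in># T\<close>] ab(3,4) large by (meson order_trans)+
      then show False using typical_unique[OF True ab(1) _ ab(2)] by blast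
    next
      case False
      \<comment> \<open>Now \<open>s\<close> is so small that every cycle of length at least
        \<open>q\<^sup>2\<close> satisfies \<open>exact\<close>, while one of them is not divisible
        by \<open>s\<close>.\<close>
      have "q * real s \<le> q\<^sup>2" using False q0 by (simp add: power2_eq_square)
      moreover have "real s \<le> q\<^sup>2"
        using False q by (smt (verit) power2_eq_square mult_le_cancel_left1)
      then obtain l where l: "l \<in># T" "q\<^sup>2 \<le> real l" "\<not> s dvd l"
        using typical_not_dvd s by blast
      have "q * real s \<le> real l" using l(2) \<open>q * real s \<le> q\<^sup>2\<close> by linarith
      then show False using exact[OF l(1)] l(3) by blast
    qed
  qed
qed

text \<open>Write the length of the cycle with a large prime divisor as \<open>t * p\<close>. A
  suitable power has exactly \<open>t\<close> cycles of length \<open>p\<close>; here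
  \<open>9 * t \<le> p\<close>, and a second long cycle becomes fixed pointwise, which leaves ample
  fixed points.\<close>

lemma typical_jordan_test: "jordan_test n T"
proof -
  have q0: "q > 0" using q by linarith
  obtain l p where l: "l \<in># T" "q\<^sup>2 \<le> real l" and p: "prime p" "p dvd l" "9 * l \<le> p * p"
    using typical unfolding typical_def big_prime_divisor_def by blast
  define t where "t = l div p"
  have lt: "l = t * p" using p by (simp add: t_def)
  have p0: "p > 0" using p prime_gt_0_nat by blast
  have t0: "t > 0" using cycle_type_pos[OF l(1)] lt by (cases t) auto
  have t9: "9 * t \<le> p" using p(3) p0 unfolding lt by (metis mult.assoc mult_le_cancel2)
  \<comment> \<open>This makes \<open>l\<close> the only cycle length divisible by
    \<open>p\<close>.\<close>
  have qp: "q \<le> real p"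
  proof (rule power2_le_imp_le)
    have "real (9 * l) \<le> real (p * p)" using p(3) by (simp only: of_nat_le_iff)
    then have "real l \<le> (real p)\<^sup>2" by (simp add: power2_eq_square)
    then show "q\<^sup>2 \<le> (real p)\<^sup>2" using l(2) by linarith
  qed simp
  define k where "k = n - l"
  obtain a b where ab: "a \<in># T" "b \<in># T - {#a#}" "real n / q \<le> real a" "real n / q \<le> real b"
    by (rule typical_long)
  \<comment> \<open>Of two long cycles, at least one differs from the chosen cycle of length
    \<open>l\<close>.\<close>
  obtain j where j: "j \<in># T - {#l#}" "real n / q \<le> real j"
  proof (cases "a = l")
    case True
    then show ?thesis using that[of b] ab by simp
  next
    case False
    then show ?thesis using that[of a] ab by (simp add: in_diff_count)
  qed
  have "\<Sum>\<^sub># T = l + \<Sum>\<^sub># (T - {#l#})" using l(1) by (metis sum_mset.remove)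
  also have "\<Sum>\<^sub># (T - {#l#}) = j + \<Sum>\<^sub># (T - {#l#} - {#j#})" using j(1) by (metis sum_mset.remove)
  finally have "l + j \<le> n" using cycle_type_sum by simp
  have k4: "k > 4 * t + 9"
  proof -
    have "9 * (t * t) \<le> p * t" using t9 by (metis mult.assoc mult_le_mono1)
    also have "\<dots> \<le> n" using \<open>l + j \<le> n\<close> lt by (simp add: mult.commute)
    finally have "9 * (t * t) \<le> n" .
    then have 9: "real (9 * (t * t)) \<le> real n" by (simp only: of_nat_le_iff)
    \<comment> \<open>This is the square root of \<open>n\<close>. Then \<open>3 * t \<le> Q\<close>
      because \<open>9 * t * t \<le> p * t \<le> n\<close>, while the other long cycle has length at
      least \<open>n / q \<ge> 100 * Q\<close>.\<close>
    define Q where "Q = q ^ 48"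
    have "Q * Q = q ^ (48 + 48)" unfolding Q_def by (rule power_add[symmetric])
    then have QQ: "Q * Q = real n" using q(2) by (simp only: numeral_plus_numeral add_num_simps)
    have "(2::real) ^ 47 \<le> q ^ 47" by (rule power_mono) (use q in auto)
    then have "q * 100 \<le> q * q ^ 47" using q0 by (intro mult_left_mono) auto
    also have "\<dots> = Q" unfolding Q_def using power_add[of q 1 47] by simp
    finally have Q: "q * 100 \<le> Q" .
    have "(3 * real t)\<^sup>2 = real (9 * (t * t))" by (simp add: power2_eq_square)
    also have "\<dots> \<le> Q\<^sup>2" using 9 by (simp only: power2_eq_square QQ)
    finally have 3: "3 * real t \<le> Q" by (rule power2_le_imp_le) (use Q q0 in linarith)
    have "100 * Q \<le> real n / q"
    proof -
      have "q * 100 * Q \<le> Q * Q" using Q q0 by (intro mult_right_mono) auto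
      then show ?thesis using q0 by (simp add: QQ field_simps)
    qed
    then have "real j > 4 * real t + 9" using j(2) 3 Q q(1) by linarith
    then show ?thesis using \<open>l + j \<le> n\<close> unfolding k_def by linarith
  qed
  \<comment> \<open>This exponent is a multiple of \<open>t\<close> and of all other cycle lengths
    but is prime to \<open>p\<close>, so its gcd with \<open>l\<close> is \<open>t\<close>.\<close>
  define i where "i = (\<Prod>j | j \<in> {1..n} \<and> \<not> p dvd j. j)"
  have dvd_i: "j dvd i" if "j \<in> {1..n}" "\<not> p dvd j" for j
    unfolding i_def by (rule dvd_prodI) (use that in auto)
  have "\<not> p dvd i" unfolding i_def using p(1) by (simp add: prime_dvd_prod_iff)
  then have "coprime p i" using p(1) by (simp add: prime_imp_coprime)
  have le_n: "j \<le> n" if "j \<in># T" for j using sum_mset.remove[OF that] cycle_type_sum by simp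
  have "\<not> p dvd t" using t9 t0 by (auto dest!: dvd_imp_le)
  moreover have "t \<le> n" using lt le_n[OF l(1)] p0 by (metis le_trans mult_le_mono2 nat_mult_1_right Suc_leI One_nat_def)
  ultimately have "t dvd i" using dvd_i t0 by simp
  have "gcd l i = t"
    using \<open>coprime p i\<close> \<open>t dvd i\<close> unfolding lt
    by (metis coprime_commute gcd.commute gcd_mult_left_right_cancel gcd_nat.absorb1 mult.commute)
  moreover have "l div t = p" using lt t0 by simp
  moreover have "cycle_mset {1..n} x = add_mset l (T - {#l#})" using T l(1) by (simp add: cycle_type_eq)
  moreover have "j dvd i" if "j \<in># T - {#l#}" for j
  proof (rule dvd_i)
    have "j \<in># T" using that by (rule in_diffD)
    then show "j \<in> {1..n}" using cycle_type_pos le_n by (simp add: Suc_le_eq)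
    show "\<not> p dvd j" using typical_unique[OF qp l(1) p(2) that] .
  qed
  ultimately have Y: "cycle_type n (x ^^ i) = replicate_mset t p + replicate_mset k 1"
    using cycle_mset_funpow[OF x, of l "T - {#l#}" i] by (simp add: cycle_type_eq k_def)
  have nk: "n = t * p + k" using \<open>l + j \<le> n\<close> lt by (simp add: k_def)
  have pot: "prime_order_type n p t k (cycle_type n (x ^^ i))"
    unfolding prime_order_type_def using p(1) nk Y by blast
  have "jordan_type1 n (cycle_type n (x ^^ i)) \<or> jordan_type2 n (cycle_type n (x ^^ i)) \<or>
     jordan_type3 n (cycle_type n (x ^^ i))"
  proof -
    \<comment> \<open>One cycle falls under (J1), two to five under (J2), more under (J3);
      \<open>9 * t \<le> p\<close> and \<open>k > 4 * t + 9\<close> cover all numerical side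
      conditions.\<close>
    consider "t = 1" | "t \<in> {2,3,4,5}" | "t > 5" using t0 by (auto, linarith)
    then show ?thesis
    proof cases
      case 1
      have "jordan_type1 n (cycle_type n (x ^^ i))"
        unfolding jordan_type1_def using Y nk 1 p(1) k4
        by (intro exI[of _ p]) (auto dest: prime_gt_1_nat)
      then show ?thesis by blast
    next
      case 2
      then have "t = 2 \<or> t = 3 \<or> t = 4 \<or> t = 5" by simp
      moreover have "k > 3" "k > 5" "k > 2" "t < p" using k4 t9 t0 by linarith+
      ultimately have "jordan_type2 n (cycle_type n (x ^^ i))"
        unfolding jordan_type2_def using pot by blast
      then show ?thesis by blast
    next
      case 3
      then have "jordan_type3 n (cycle_type n (x ^^ i))"
      proof -
        have "p > 2 * t - 2" "k > 4 * t - 4" using t9 t0 k4 by linarith+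
        then show ?thesis unfolding jordan_type3_def using pot 3 by blast
      qed
      then show ?thesis by blast
    qed
  qed
  then show ?thesis unfolding jordan_test_def Let_def using x T by blast
qed

end

section \<open>Most cycle types are typical\<close>

text \<open>The expected number of cycles whose length satisfies \<open>P\<close> in a random
  permutation of degree \<open>n\<close>: cycles of length \<open>l\<close> occur
  \<open>1 / l\<close> times on average.\<close>

definition inverse_length_sum :: "nat \<Rightarrow> (nat \<Rightarrow> bool) \<Rightarrow> real" where
  "inverse_length_sum n P = (\<Sum>l | l \<in> {1..n} \<and> P l. 1 / real l)"

lemma inverse_length_sum_disj:
  assumes "\<And>l. l \<in> {1..n} \<Longrightarrow> P l \<Longrightarrow> Q l \<or> R l"
  shows "inverse_length_sum n P \<le> inverse_length_sum n Q + inverse_length_sum n R"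
proof -
  let ?S = "\<lambda>P. {l. l \<in> {1..n} \<and> P l}"
  have "inverse_length_sum n P \<le> (\<Sum>l\<in>?S Q \<union> ?S R. 1 / real l)"
    unfolding inverse_length_sum_def by (rule sum_mono2) (use assms in auto)
  also have "\<dots> \<le> (\<Sum>l\<in>?S Q. 1 / real l) + (\<Sum>l\<in>?S R. 1 / real l)"
    using sum.union_inter[of "?S Q" "?S R" "\<lambda>l. 1 / real l"] sum_nonneg[of "?S Q \<inter> ?S R" "\<lambda>l. 1 / real l"]
    by simp
  finally show ?thesis unfolding inverse_length_sum_def .
qed

text \<open>Telescoping with \<open>1 / c\<^sup>2 \<le> 1 / (c - 1) - 1 / c\<close>; the induction
  keeps the final term \<open>- 1 / n\<close>.\<close>

lemma sum_inverse_squares_le: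
  assumes "a \<ge> 2"
  shows "(\<Sum>c\<in>{a..n}. 1 / (real c)\<^sup>2) \<le> 1 / (real a - 1)"
proof -
  have "(\<Sum>c\<in>{a..n}. 1 / (real c)\<^sup>2) \<le> 1 / (real a - 1) - 1 / real n" if "a \<le> n"
    using that
  proof (induction n rule: dec_induct)
    case base
    then show ?case using assms by (simp add: field_simps power2_eq_square)
  next
    case (step n)
    have "1 / (real (Suc n))\<^sup>2 \<le> 1 / real n - 1 / real (Suc n)"
    proof -
      have n: "real n > 0" using step.hyps assms by simp
      have "1 / (real (Suc n))\<^sup>2 \<le> 1 / (real n * real (Suc n))"
        unfolding power2_eq_square using n by (intro divide_left_mono mult_right_mono) auto
      also have "\<dots> = 1 / real n - 1 / real (Suc n)" using n by (simp add: field_simps)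
      finally show ?thesis .
    qed
    then show ?case using step by (simp add: sum.nat_ivl_Suc')
  qed
  moreover have "1 / (real a - 1) \<ge> 0" "1 / real n \<ge> 0" using assms by auto
  ultimately show ?thesis by (cases "a \<le> n") (auto intro: order_trans)
qed

lemma size_filter_mset_le_1I:
  assumes "\<And>l. l \<in># T \<Longrightarrow> \<not> P l"
  shows "size (filter_mset P T) \<le> 1"
proof -
  have "filter_mset P T = {#}" using assms by simp
  show ?thesis by (subst \<open>filter_mset P T = {#}\<close>) simp
qed

lemma perm_fraction_false: "perm_fraction n (\<lambda>_. False) = 0"
  by (simp add: perm_fraction_def)

lemma exp_power: "exp (y::real) ^ k = exp (real k * y)"
  by (rule exp_of_nat_mult[symmetric])

section \<open>Probabilities of the six failures, as exponentials in \<open>y = ln q\<close>\<close>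

context
  fixes n :: nat and y q :: real
  assumes y: "y \<ge> 1" and q_def: "q = exp y" and n_eq: "real n = exp (96 * y)"
begin

lemma n_pos: "n > 0"
  using n_eq exp_gt_zero[of "96 * y"] by (cases n) auto

lemma ln_n: "ln (real n) = 96 * y"
  by (simp add: n_eq)

lemma q_ge_2: "q \<ge> 2"
  using exp_ge_add_one_self[of y] y unfolding q_def by linarith

lemma q_pos: "q > 0"
  by (simp add: q_def)

lemma q_power: "q ^ k = exp (real k * y)"
  by (simp add: q_def exp_power)

lemma harm_ge: "96 * y \<le> harm n"
proof -
  have "ln (real n) \<le> ln (real n + 1)" using n_pos by simp
  then show ?thesis using ln_le_harm[of n] by (simp add: ln_n)
qed

lemma fraction_many_cycles:
  "perm_fraction n (\<lambda>T. q ^ 56 \<le> (3 / 2) ^ size T) \<le> exp (1 / 2 - 8 * y)"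
proof -
  have "perm_fraction n (\<lambda>T. q ^ 56 \<le> (3 / 2) ^ size T) \<le> exp ((1 + ln n) / 2) / q ^ 56"
    by (rule perm_fraction_many_cycles) (use n_pos q_pos in auto)
  also have "\<dots> = exp (1 / 2 - 8 * y)" by (simp add: ln_n q_power exp_diff[symmetric] field_simps)
  finally show ?thesis .
qed

text \<open>Each of the two parts has at least \<open>q ^ 94\<close> points and contributes a factor
  of order \<open>exp (- 94 / 3 * y)\<close>; against \<open>q ^ 56\<close> this leaves the exponent
  \<open>56 - 188 / 3 = - 20 / 3\<close>.\<close>

lemma fraction_invariant_set:
  assumes "exp (94 * y) \<le> real t" "t \<le> n" "exp (94 * y) \<le> real (n - t)"
  shows "perm_fraction n (\<lambda>T. (3 / 2) ^ size T < q ^ 56 \<and> (\<exists>M. M \<subseteq># T \<and> \<Sum>\<^sub># M = t))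
    \<le> exp (4 / 3 - 20 / 3 * y)"
proof -
  have bound: "cycle_mean (\<lambda>_. 2 / 3) t \<le> exp (2 / 3 - 94 / 3 * y)" if "exp (94 * y) \<le> real t" for t
  proof -
    have "t > 0" using that exp_gt_zero[of "94 * y"] by (cases t) auto
    then have "cycle_mean (\<lambda>_. 2 / 3) t \<le> exp (2 / 3) * real t powr (-1/3)"
      by (rule cycle_mean_two_thirds_le)
    also have "real t powr (-1/3) \<le> exp (94 * y) powr (-1/3)"
      by (rule powr_mono2') (use that in auto)
    also have "exp (94 * y) powr (-1/3) = exp (- 94 / 3 * y)" by (simp add: powr_def)
    finally show ?thesis by (simp add: exp_add[symmetric])
  qed
  have "perm_fraction n (\<lambda>T. (3 / 2) ^ size T < q ^ 56 \<and> (\<exists>M. M \<subseteq># T \<and> \<Sum>\<^sub># M = t))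
    \<le> q ^ 56 * cycle_mean (\<lambda>_. 2 / 3) t * cycle_mean (\<lambda>_. 2 / 3) (n - t)"
    by (rule perm_fraction_invariant_set) (use assms q_pos in auto)
  also have "\<dots> \<le> q ^ 56 * exp (2 / 3 - 94 / 3 * y) * exp (2 / 3 - 94 / 3 * y)"
    using bound assms q_pos
    by (intro mult_mono mult_nonneg_nonneg cycle_mean_nonneg) auto
  also have "\<dots> = exp (4 / 3 - 20 / 3 * y)"
    by (simp add: q_power exp_add[symmetric])
  finally show ?thesis .
qed

text \<open>For \<open>r \<le> q\<^sup>2\<close> the block size is at least \<open>q ^ 94\<close>,
  hence so are a union of \<open>c\<close> blocks and its complement of \<open>r - c\<close> blocks.
  The union bound over at most \<open>q ^ 4\<close> pairs raises the exponent from
  \<open>- 20 / 3\<close> to \<open>- 8 / 3\<close>.\<close>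

lemma fraction_block_sums:
  "perm_fraction n (\<lambda>T. (3 / 2) ^ size T < q ^ 56 \<and>
     (\<exists>r c. r dvd n \<and> real r \<le> q\<^sup>2 \<and> 1 \<le> c \<and> c < r \<and> (\<exists>M. M \<subseteq># T \<and> \<Sum>\<^sub># M = c * (n div r))))
    \<le> exp (4 / 3 - 8 / 3 * y)"
proof -
  define m where "m = nat \<lfloor>q\<^sup>2\<rfloor>"
  have m: "real m \<le> exp (2 * y)" using q_power[of 2] by (simp add: m_def)
  \<comment> \<open>The arithmetic conditions are part of the event, so inadmissible pairs in the
    square of indices contribute 0.\<close>
  define P where "P = (\<lambda>(r, c) T. (r dvd n \<and> 1 \<le> c \<and> c < r) \<and> ((3 / 2) ^ size T < q ^ 56 \<and>
     (\<exists>M. M \<subseteq># T \<and> \<Sum>\<^sub># M = c * (n div r))))"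
  have "perm_fraction n (\<lambda>T. (3 / 2) ^ size T < q ^ 56 \<and>
     (\<exists>r c. r dvd n \<and> real r \<le> q\<^sup>2 \<and> 1 \<le> c \<and> c < r \<and> (\<exists>M. M \<subseteq># T \<and> \<Sum>\<^sub># M = c * (n div r))))
    \<le> perm_fraction n (\<lambda>T. \<exists>rc\<in>{1..m} \<times> {1..m}. P rc T)"
  proof (rule perm_fraction_mono)
    fix x
    assume "(3 / 2) ^ size (cycle_type n x) < q ^ 56 \<and> (\<exists>r c. r dvd n \<and> real r \<le> q\<^sup>2 \<and> 1 \<le> c \<and> c < r \<and>
      (\<exists>M. M \<subseteq># cycle_type n x \<and> \<Sum>\<^sub># M = c * (n div r)))"
    then obtain r c where rc: "(3 / 2) ^ size (cycle_type n x) < q ^ 56" "r dvd n" "real r \<le> q\<^sup>2"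
      "1 \<le> c" "c < r" "\<exists>M. M \<subseteq># cycle_type n x \<and> \<Sum>\<^sub># M = c * (n div r)" by blast
    have "r \<le> m" unfolding m_def using rc(3) by (rule le_nat_floor)
    then have "(r, c) \<in> {1..m} \<times> {1..m}" using rc by auto
    moreover have "P (r, c) (cycle_type n x)" unfolding P_def using rc by simp
    ultimately show "\<exists>rc\<in>{1..m} \<times> {1..m}. P rc (cycle_type n x)" by blast
  qed
  also have "\<dots> \<le> (\<Sum>rc\<in>{1..m} \<times> {1..m}. perm_fraction n (P rc))"
    by (rule perm_fraction_bex) auto
  also have "\<dots> \<le> (\<Sum>rc\<in>{1..m} \<times> {1..m}. exp (4 / 3 - 20 / 3 * y))"
  proof (rule sum_mono, clarify)
    fix r c assume rc: "r \<in> {1..m}" "c \<in> {1..m}"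
    show "perm_fraction n (P (r, c)) \<le> exp (4 / 3 - 20 / 3 * y)"
    proof (cases "r dvd n \<and> 1 \<le> c \<and> c < r")
      case True
      let ?s = "n div r"
      have n: "n = r * ?s" using True by simp
      have "exp (94 * y) * exp (2 * y) = real r * real ?s"
        using n n_eq by (metis exp_add distrib_right numeral_plus_numeral of_nat_mult add_num_simps)
      also have "real r \<le> exp (2 * y)" using rc m by simp
      then have "real r * real ?s \<le> exp (2 * y) * real ?s" by (rule mult_right_mono) simp
      finally have s: "exp (94 * y) \<le> real ?s" by simp
      have "perm_fraction n (P (r, c)) = perm_fraction n (\<lambda>T. (3 / 2) ^ size T < q ^ 56 \<and>
        (\<exists>M. M \<subseteq># T \<and> \<Sum>\<^sub># M = c * ?s))"
        unfolding P_def using True by simp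
      also have "\<dots> \<le> exp (4 / 3 - 20 / 3 * y)"
      proof (rule fraction_invariant_set)
        have "?s \<le> c * ?s" using True by simp
        then show "exp (94 * y) \<le> real (c * ?s)" using s by linarith
        show "c * ?s \<le> n" using True n mult_le_mono1[of c r ?s] by linarith
        have "n - c * ?s = (r - c) * ?s" using n by (simp add: diff_mult_distrib)
        moreover have "?s \<le> (r - c) * ?s"

        proof -
          have "1 \<le> r - c" using True by linarith
          then show ?thesis using mult_le_mono1[of 1 "r - c" ?s] by simp
        qed
        ultimately show "exp (94 * y) \<le> real (n - c * ?s)" using s by linarith
      qed
      finally show ?thesis .
    next
      case False
      then have "P (r, c) = (\<lambda>_. False)" unfolding P_def by auto
      then show ?thesis by (simp add: perm_fraction_false)
    qed
  qed
  also have "\<dots> = real m * real m * exp (4 / 3 - 20 / 3 * y)" by simp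
  also have "\<dots> \<le> exp (2 * y) * exp (2 * y) * exp (4 / 3 - 20 / 3 * y)"
    using m by (intro mult_mono) auto
  also have "\<dots> = exp (4 / 3 - 8 / 3 * y)" by (simp add: exp_add[symmetric])
  finally show ?thesis .
qed

text \<open>The reciprocals of the multiples of \<open>c\<close> sum to at most
  \<open>(1 + 96 * y) / c\<close>, so \<open>perm_fraction_at_least_two\<close> gives a bound of
  order \<open>1 / c\<^sup>2\<close>; summing over \<open>c \<ge> q\<close> leaves about
  \<open>1 / q\<close>.\<close>

lemma fraction_common_divisor:
  "perm_fraction n (\<lambda>T. \<exists>c. q \<le> real c \<and> 2 \<le> size (filter_mset (\<lambda>l. c dvd l) T))
    \<le> exp 1 * (1 + 96 * y)\<^sup>2 * (2 * exp (- y))"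
proof -
  define a where "a = nat \<lceil>q\<rceil>"
  have a: "q \<le> real a" "a \<ge> 2" using q_ge_2 by (auto simp: a_def) linarith
  have "perm_fraction n (\<lambda>T. \<exists>c. q \<le> real c \<and> 2 \<le> size (filter_mset (\<lambda>l. c dvd l) T))
    \<le> perm_fraction n (\<lambda>T. \<exists>c\<in>{a..n}. 2 \<le> size (filter_mset (\<lambda>l. c dvd l) T))"
  proof (rule perm_fraction_mono)
    fix x assume x: "x permutes {1..n}"
    assume "\<exists>c. q \<le> real c \<and> 2 \<le> size (filter_mset (\<lambda>l. c dvd l) (cycle_type n x))"
    then obtain c where c: "q \<le> real c" "2 \<le> size (filter_mset (\<lambda>l. c dvd l) (cycle_type n x))" by blast
    obtain l where l: "l \<in># cycle_type n x" "c dvd l"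
      using c(2) by (rule size_filter_mset_ge_2E) blast
    have "l > 0" using zero_notin_cycle_mset[OF x] l(1) by (cases l) (auto simp: cycle_type_eq)
    have "\<Sum>\<^sub># (cycle_type n x) = n" using sum_mset_cycle_mset[OF x] by (simp add: cycle_type_eq)
    then have "l \<le> n" using sum_mset.remove[OF l(1)] by simp
    then have "c \<le> n" using l(2) \<open>l > 0\<close> dvd_imp_le order_trans by blast
    moreover have "a \<le> c" using c(1) unfolding a_def by linarith
    ultimately show "\<exists>c\<in>{a..n}. 2 \<le> size (filter_mset (\<lambda>l. c dvd l) (cycle_type n x))"
      using c(2) by auto
  qed
  also have "\<dots> \<le> (\<Sum>c\<in>{a..n}. perm_fraction n (\<lambda>T. 2 \<le> size (filter_mset (\<lambda>l. c dvd l) T)))"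
    by (rule perm_fraction_bex) auto
  also have "\<dots> \<le> (\<Sum>c\<in>{a..n}. exp 1 * (1 + 96 * y)\<^sup>2 * (1 / (real c)\<^sup>2))"
  proof (rule sum_mono)
    fix c assume "c \<in> {a..n}"
    then have c: "c > 0" using a by simp
    have "perm_fraction n (\<lambda>T. 2 \<le> size (filter_mset (\<lambda>l. c dvd l) T)) \<le> exp 1 * ((1 + 96 * y) / c)\<^sup>2"
    proof (rule perm_fraction_at_least_two)
      have "(\<Sum>l | l \<in> {1..n} \<and> c dvd l. 1 / real l) \<le> harm n / c"
        by (rule sum_inverse_multiples_le[OF c])
      also have "\<dots> \<le> (1 + 96 * y) / c"
        using harm_le_ln[OF n_pos] ln_n by (intro divide_right_mono) auto
      finally show "(\<Sum>l | l \<in> {1..n} \<and> c dvd l. 1 / real l) \<le> (1 + 96 * y) / c" .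
    qed (use c y in auto)
    then show "perm_fraction n (\<lambda>T. 2 \<le> size (filter_mset (\<lambda>l. c dvd l) T)) \<le>
       exp 1 * (1 + 96 * y)\<^sup>2 * (1 / (real c)\<^sup>2)" by (simp add: power_divide)
  qed
  also have "\<dots> = exp 1 * (1 + 96 * y)\<^sup>2 * (\<Sum>c\<in>{a..n}. 1 / (real c)\<^sup>2)"
    by (rule sum_distrib_left[symmetric])
  also have "\<dots> \<le> exp 1 * (1 + 96 * y)\<^sup>2 * (2 * exp (- y))"
  proof (rule mult_left_mono)
    have "(\<Sum>c\<in>{a..n}. 1 / (real c)\<^sup>2) \<le> 1 / (real a - 1)" by (rule sum_inverse_squares_le[OF a(2)])
    \<comment> \<open>Because \<open>q \<ge> 2\<close>, also
      \<open>a - 1 \<ge> q - 1 \<ge> q / 2\<close>.\<close>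
    also have "\<dots> \<le> 1 / (q / 2)" using a q_ge_2 by (intro divide_left_mono) auto
    also have "\<dots> = 2 * exp (- y)" by (simp add: q_def exp_minus field_simps)
    finally show "(\<Sum>c\<in>{a..n}. 1 / (real c)\<^sup>2) \<le> 2 * exp (- y)" .
  qed simp
  finally show ?thesis .
qed

lemma fraction_at_most_one:
  assumes "\<mu> \<le> inverse_length_sum n P"
  shows "perm_fraction n (\<lambda>T. size (filter_mset P T) \<le> 1) \<le> 2 * exp (1 - \<mu> / 2)"
proof -
  have "perm_fraction n (\<lambda>T. size (filter_mset P T) \<le> 1) \<le> 2 * exp (1 - inverse_length_sum n P / 2)"
    unfolding inverse_length_sum_def by (rule perm_fraction_at_most_one[OF n_pos])
  also have "\<dots> \<le> 2 * exp (1 - \<mu> / 2)" using assms by simp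
  finally show ?thesis .
qed

lemma short_sum_le: "inverse_length_sum n (\<lambda>l. real l < q\<^sup>2) \<le> 1 + 2 * y"
proof -
  have "inverse_length_sum n (\<lambda>l. real l < q\<^sup>2) \<le> 1 + ln (q\<^sup>2)"
    unfolding inverse_length_sum_def
    by (rule sum_inverse_less_le) (use q_ge_2 in \<open>simp add: one_le_power\<close>)
  also have "ln (q\<^sup>2) = 2 * y" by (simp add: q_power)
  finally show ?thesis .
qed

lemma total_sum: "inverse_length_sum n (\<lambda>_. True) = harm n"
  unfolding inverse_length_sum_def by (simp only: sum_inverse_eq_harm simp_thms Collect_mem_eq)

text \<open>Multiples of \<open>s \<ge> 2\<close> take at most half of the harmonic sum, and lengths
  below \<open>q\<^sup>2\<close> at most \<open>1 + 2 * y\<close>. At least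
  \<open>46 * y - 1\<close> remains for suitable lengths, and the \<open>q\<^sup>2\<close> choices
  of \<open>s\<close> cost \<open>2 * y\<close> in the exponent.\<close>

lemma fraction_all_divisible:
  "perm_fraction n (\<lambda>T. \<exists>s. 2 \<le> s \<and> real s \<le> q\<^sup>2 \<and> \<not> (\<exists>l\<in>#T. q\<^sup>2 \<le> real l \<and> \<not> s dvd l))
    \<le> 2 * exp (3 / 2 - 21 * y)"
proof -
  define m where "m = nat \<lfloor>q\<^sup>2\<rfloor>"
  have m: "real m \<le> exp (2 * y)" using q_power[of 2] by (simp add: m_def)
  let ?P = "\<lambda>s l. q\<^sup>2 \<le> real l \<and> \<not> s dvd l"
  have "perm_fraction n (\<lambda>T. \<exists>s. 2 \<le> s \<and> real s \<le> q\<^sup>2 \<and> \<not> (\<exists>l\<in>#T. ?P s l))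
    \<le> perm_fraction n (\<lambda>T. \<exists>s\<in>{2..m}. size (filter_mset (?P s) T) \<le> 1)"
  proof (rule perm_fraction_mono)
    fix x assume "\<exists>s. 2 \<le> s \<and> real s \<le> q\<^sup>2 \<and> \<not> (\<exists>l\<in>#cycle_type n x. ?P s l)"
    then obtain s where s: "2 \<le> s" "real s \<le> q\<^sup>2" "\<forall>l\<in>#cycle_type n x. \<not> ?P s l" by blast
    have "s \<le> m" unfolding m_def using s(2) by (rule le_nat_floor)
    then have "s \<in> {2..m}" using s(1) by simp
    moreover have "size (filter_mset (?P s) (cycle_type n x)) \<le> 1"
      by (rule size_filter_mset_le_1I) (use s(3) in blast)
    ultimately show "\<exists>s\<in>{2..m}. size (filter_mset (?P s) (cycle_type n x)) \<le> 1" by blast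
  qed
  also have "\<dots> \<le> (\<Sum>s\<in>{2..m}. perm_fraction n (\<lambda>T. size (filter_mset (?P s) T) \<le> 1))"
    by (rule perm_fraction_bex) auto
  also have "\<dots> \<le> (\<Sum>s\<in>{2..m}. 2 * exp (3 / 2 - 23 * y))"
  proof (rule sum_mono)
    fix s assume s: "s \<in> {2..m}"
    have "harm n \<le> inverse_length_sum n (?P s) +
        inverse_length_sum n (\<lambda>l. real l < q\<^sup>2 \<or> s dvd l)"
      unfolding total_sum[symmetric] by (rule inverse_length_sum_disj) auto
    also have "inverse_length_sum n (\<lambda>l. real l < q\<^sup>2 \<or> s dvd l) \<le>
        inverse_length_sum n (\<lambda>l. real l < q\<^sup>2) + inverse_length_sum n (\<lambda>l. s dvd l)"
      by (rule inverse_length_sum_disj) auto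
    also have "inverse_length_sum n (\<lambda>l. s dvd l) \<le> harm n / real s"
      unfolding inverse_length_sum_def by (rule sum_inverse_multiples_le) (use s in simp)
    also have "\<dots> \<le> harm n / 2" using s harm_nonneg[of n] by (intro divide_left_mono) auto
    finally have "46 * y - 1 \<le> inverse_length_sum n (?P s)"
      using short_sum_le harm_ge by linarith
    from fraction_at_most_one[OF this]
    have "perm_fraction n (\<lambda>T. size (filter_mset (?P s) T) \<le> 1) \<le> 2 * exp (1 - (46 * y - 1) / 2)" .
    also have "1 - (46 * y - 1) / 2 = 3 / 2 - 23 * y" by (simp add: field_simps)
    finally show "perm_fraction n (\<lambda>T. size (filter_mset (?P s) T) \<le> 1) \<le> 2 * exp (3 / 2 - 23 * y)" .
  qed
  also have "\<dots> = real (card {2..m}) * (2 * exp (3 / 2 - 23 * y))" by simp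
  also have "\<dots> \<le> exp (2 * y) * (2 * exp (3 / 2 - 23 * y))"
    using m by (intro mult_right_mono) auto
  also have "\<dots> = 2 * exp (3 / 2 - 21 * y)" by (simp add: exp_add[symmetric])
  finally show ?thesis .
qed

text \<open>The lengths between \<open>n / q\<close> and \<open>n\<close> carry only about
  \<open>ln q = y\<close> of the harmonic sum, hence the comparatively slow decay.\<close>

lemma fraction_long_cycles:
  "perm_fraction n (\<lambda>T. size (filter_mset (\<lambda>l. real n / q \<le> real l) T) \<le> 1)
    \<le> 2 * exp (3 / 2 - y / 2)"
proof -
  have nq: "real n / q = exp (95 * y)" by (simp add: n_eq q_def exp_diff[symmetric])
  have "harm n \<le> inverse_length_sum n (\<lambda>l. real n / q \<le> real l) +
      inverse_length_sum n (\<lambda>l. real l < real n / q)"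
    unfolding total_sum[symmetric] by (rule inverse_length_sum_disj) auto
  also have "inverse_length_sum n (\<lambda>l. real l < real n / q) \<le> 1 + ln (real n / q)"
    unfolding inverse_length_sum_def by (rule sum_inverse_less_le) (use y in \<open>simp add: nq\<close>)
  also have "ln (real n / q) = 95 * y" by (simp add: nq)
  finally have "y - 1 \<le> inverse_length_sum n (\<lambda>l. real n / q \<le> real l)"
    using harm_ge by linarith
  from fraction_at_most_one[OF this]
  have "perm_fraction n (\<lambda>T. size (filter_mset (\<lambda>l. real n / q \<le> real l) T) \<le> 1)
    \<le> 2 * exp (1 - (y - 1) / 2)" .
  also have "1 - (y - 1) / 2 = 3 / 2 - y / 2" by (simp add: field_simps)
  finally show ?thesis .
qed

text \<open>Here \<open>ln n / 8 = 12 * y\<close>; discarding the lengths below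
  \<open>q\<^sup>2\<close> leaves at least \<open>10 * y - C - 1\<close>.\<close>

lemma fraction_big_prime:
  assumes "ln (real n) / 8 - C \<le> inverse_length_sum n big_prime_divisor"
  shows "perm_fraction n (\<lambda>T. \<not> (\<exists>l\<in>#T. q\<^sup>2 \<le> real l \<and> big_prime_divisor l))
    \<le> 2 * exp (1 + (C + 1) / 2) * exp (- 5 * y)"
proof -
  let ?P = "\<lambda>l. q\<^sup>2 \<le> real l \<and> big_prime_divisor l"
  have "inverse_length_sum n big_prime_divisor \<le> inverse_length_sum n ?P +
      inverse_length_sum n (\<lambda>l. real l < q\<^sup>2)"
    by (rule inverse_length_sum_disj) auto
  then have *: "10 * y - C - 1 \<le> inverse_length_sum n ?P"
    using assms short_sum_le ln_n by linarith
  have "perm_fraction n (\<lambda>T. \<not> (\<exists>l\<in>#T. ?P l)) \<le> perm_fraction n (\<lambda>T. size (filter_mset ?P T) \<le> 1)"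
  proof (rule perm_fraction_mono)
    fix x assume "\<not> (\<exists>l\<in>#cycle_type n x. ?P l)"
    then show "size (filter_mset ?P (cycle_type n x)) \<le> 1"
      by (intro size_filter_mset_le_1I) blast
  qed
  also have "\<dots> \<le> 2 * exp (1 - (10 * y - C - 1) / 2)" by (rule fraction_at_most_one[OF *])
  also have "1 - (10 * y - C - 1) / 2 = 1 + (C + 1) / 2 + - 5 * y" by (simp add: field_simps)
  finally show ?thesis by (simp only: exp_add mult.assoc)
qed

lemma fraction_atypical:
  assumes "ln (real n) / 8 - C \<le> inverse_length_sum n big_prime_divisor"
  shows "perm_fraction n (\<lambda>T. \<not> typical n q T) \<le>
     exp (1 / 2 - 8 * y) + exp (4 / 3 - 8 / 3 * y) + exp 1 * (1 + 96 * y)\<^sup>2 * (2 * exp (- y)) +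
     2 * exp (3 / 2 - 21 * y) + 2 * exp (3 / 2 - y / 2) + 2 * exp (1 + (C + 1) / 2) * exp (- 5 * y)"
proof -
  define E0 where "E0 = (\<lambda>T::nat multiset. q ^ 56 \<le> (3 / 2) ^ size T)"
  \<comment> \<open>Failure of the second clause is counted only together with the first clause, as
    \<open>fraction_block_sums\<close> requires; the remaining case is \<open>E0\<close>.\<close>
  define E1 where "E1 = (\<lambda>T. (3 / 2) ^ size T < q ^ 56 \<and>
     (\<exists>r c. r dvd n \<and> real r \<le> q\<^sup>2 \<and> 1 \<le> c \<and> c < r \<and> (\<exists>M. M \<subseteq># T \<and> \<Sum>\<^sub># M = c * (n div r))))"
  define E2 where "E2 = (\<lambda>T. \<exists>c. q \<le> real c \<and> 2 \<le> size (filter_mset (\<lambda>l. c dvd l) T))"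
  define E3 where "E3 = (\<lambda>T. \<exists>s. 2 \<le> s \<and> real s \<le> q\<^sup>2 \<and> \<not> (\<exists>l\<in>#T. q\<^sup>2 \<le> real l \<and> \<not> s dvd l))"
  define E4 where "E4 = (\<lambda>T. size (filter_mset (\<lambda>l. real n / q \<le> real l) T) \<le> 1)"
  define E5 where "E5 = (\<lambda>T. \<not> (\<exists>l\<in>#T. q\<^sup>2 \<le> real l \<and> big_prime_divisor l))"
  have "perm_fraction n (\<lambda>T. \<not> typical n q T) \<le>
      perm_fraction n (\<lambda>T. E0 T \<or> E1 T \<or> E2 T \<or> E3 T \<or> E4 T \<or> E5 T)"
  proof (rule perm_fraction_mono)
    fix x :: "nat \<Rightarrow> nat"
    let ?T = "cycle_type n x"
    assume atyp: "\<not> typical n q ?T"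
    show "E0 ?T \<or> E1 ?T \<or> E2 ?T \<or> E3 ?T \<or> E4 ?T \<or> E5 ?T"
    proof (rule ccontr)
      assume neg: "\<not> ?thesis"
      have 0: "(3 / 2) ^ size ?T < q ^ 56" using neg unfolding E0_def by linarith
      have 1: "\<forall>r c. r dvd n \<and> real r \<le> q\<^sup>2 \<and> 1 \<le> c \<and> c < r \<longrightarrow>
        \<not> (\<exists>M. M \<subseteq># ?T \<and> \<Sum>\<^sub># M = c * (n div r))" using neg 0 unfolding E1_def by blast
      have "\<not> E2 ?T" using neg by blast
      then have 2: "\<forall>c. q \<le> real c \<longrightarrow> size (filter_mset (\<lambda>l. c dvd l) ?T) \<le> 1"
        unfolding E2_def by (metis Suc_1 not_less_eq_eq)
      have 3: "\<forall>s. 2 \<le> s \<and> real s \<le> q\<^sup>2 \<longrightarrow> (\<exists>l\<in>#?T. q\<^sup>2 \<le> real l \<and> \<not> s dvd l)"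
        using neg unfolding E3_def by blast
      have 4: "2 \<le> size (filter_mset (\<lambda>l. real n / q \<le> real l) ?T)"
        using neg unfolding E4_def by linarith
      have 5: "\<exists>l\<in>#?T. q\<^sup>2 \<le> real l \<and> big_prime_divisor l"
        using neg unfolding E5_def by blast
      show False using atyp 0 1 2 3 4 5 unfolding typical_def by blast
    qed
  qed
  also have "\<dots> \<le> perm_fraction n E0 + (perm_fraction n E1 + (perm_fraction n E2 +
      (perm_fraction n E3 + (perm_fraction n E4 + perm_fraction n E5))))"
    by (intro order_trans[OF perm_fraction_disj] add_left_mono) (rule order_refl)
  finally show ?thesis
    using fraction_many_cycles fraction_block_sums fraction_common_divisor fraction_all_divisible
      fraction_long_cycles fraction_big_prime[OF assms]
    unfolding E0_def E1_def E2_def E3_def E4_def E5_def by linarith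
qed

end

lemma atypical_tendsto_0:
  "(\<lambda>n. perm_fraction n (\<lambda>T. \<not> typical n (exp (ln (real n) / 96)) T)) \<longlonglongrightarrow> 0"
proof -
  obtain C where C: "ln (real n) / 8 - C \<le> inverse_length_sum n big_prime_divisor" if "n > 0" for n
    using sum_big_prime_divisor_ge unfolding inverse_length_sum_def by blast
  define B where "B = (\<lambda>y. exp (1 / 2 - 8 * y) + exp (4 / 3 - 8 / 3 * y) +
     exp 1 * (1 + 96 * y)\<^sup>2 * (2 * exp (- y)) + 2 * exp (3 / 2 - 21 * y) + 2 * exp (3 / 2 - y / 2) +
     2 * exp (1 + (C + 1) / 2) * exp (- 5 * y :: real))"
  have "((\<lambda>y. exp (1 / 2 - 8 * y) + exp (4 / 3 - 8 / 3 * y) +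
     exp 1 * (1 + 96 * y)\<^sup>2 * (2 * exp (- y)) + 2 * exp (3 / 2 - 21 * y) + 2 * exp (3 / 2 - y / 2 :: real))
     \<longlongrightarrow> 0) at_top" by real_asymp
  moreover have "((\<lambda>y. exp (- 5 * y :: real)) \<longlongrightarrow> 0) at_top" by real_asymp
  ultimately have "(B \<longlongrightarrow> 0 + 2 * exp (1 + (C + 1) / 2) * 0) at_top"
    unfolding B_def by (intro tendsto_add tendsto_mult_left)
  moreover have "filterlim (\<lambda>n. ln (real n) / 96) at_top sequentially" by real_asymp
  ultimately have lim: "(\<lambda>n. B (ln (real n) / 96)) \<longlonglongrightarrow> 0"
    using filterlim_compose[of B "nhds 0" at_top "\<lambda>n. ln (real n) / 96" sequentially] by simp
  have "\<forall>\<^sub>F n in sequentially. 1 \<le> ln (real n) / 96" by real_asymp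
  then have "\<forall>\<^sub>F n in sequentially.
    perm_fraction n (\<lambda>T. \<not> typical n (exp (ln (real n) / 96)) T) \<le> B (ln (real n) / 96)"
  proof eventually_elim
    case (elim n)
    then have "n > 0" by (cases n) auto
    then have "real n = exp (96 * (ln (real n) / 96))" by simp
    from fraction_atypical[OF elim refl this C[OF \<open>n > 0\<close>]]
    show ?case unfolding B_def .
  qed
  moreover have "\<forall>\<^sub>F n in sequentially. 0 \<le> perm_fraction n (\<lambda>T. \<not> typical n (exp (ln (real n) / 96)) T)"
    by (intro always_eventually allI) (simp add: perm_fraction_def)
  ultimately show ?thesis using lim by (intro tendsto_sandwich[OF _ _ tendsto_const lim])
qed

section \<open>The algorithm\<close>

definition jordan_hit :: "nat \<Rightarrow> nat multiset \<Rightarrow> bool" where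
  "jordan_hit n T \<longleftrightarrow> real (size T) < 2 * ln (real n) \<and> jordan_test n T"

text \<open>A single such element empties the list of divisors at once. The algorithm may also empty
  it over several rounds, so counting only these elements bounds its failure from above.\<close>

definition elimination_hit :: "nat \<Rightarrow> nat multiset \<Rightarrow> bool" where
  "elimination_hit n T \<longleftrightarrow> real (size T) < 2 * ln (real n) \<and>
     (\<forall>r. r dvd n \<and> 1 < r \<and> r < n \<longrightarrow> eliminates n T r)"

definition miss_fraction :: "nat \<Rightarrow> (nat \<Rightarrow> nat) set \<Rightarrow> (nat multiset \<Rightarrow> bool) \<Rightarrow> real" where
  "miss_fraction n G P = real (card {x \<in> G. \<not> P (cycle_type n x)}) / real (card G)"

text \<open>A false answer requires that every round misses a Jordan hit or that every round misses
  an elimination hit. The bound is stated for all loop states, a goal already reached contributing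
  0, so that induction on the number of rounds goes through.\<close>

lemma altsym_loop_False_le:
  assumes G: "finite G" "G \<noteq> {}" and rs: "\<forall>r\<in>set rs. r dvd n \<and> 1 < r \<and> r < n"
  shows "pmf (altsym_loop n G k jordan rs) False \<le>
    (if jordan then 0 else miss_fraction n G (jordan_hit n) ^ k) +
    (if rs = [] then 0 else miss_fraction n G (elimination_hit n) ^ k)"
  using rs
proof (induction k arbitrary: jordan rs)
  case 0
  then show ?case by (auto simp: pmf_return)
next
  case (Suc k)
  let ?a = "miss_fraction n G (jordan_hit n)" and ?b = "miss_fraction n G (elimination_hit n)"
  have nn: "?a \<ge> 0" "?b \<ge> 0" by (simp_all add: miss_fraction_def)
  have cG: "card G > 0" using G by (simp add: card_gt_0_iff)
  show ?case
  proof (cases "jordan \<and> rs = []")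
    case True
    then show ?thesis by (simp add: pmf_return)
  next
    case False
    define f where "f = (\<lambda>x. let T = cycle_type n x in
        if real (size T) < 2 * ln (real n)
        then altsym_loop n G k (if jordan then jordan else jordan_test n T)
               (filter (\<lambda>r. \<not> eliminates n T r) rs)
        else altsym_loop n G k jordan rs)"
    \<comment> \<open>\<open>?J\<close> and \<open>?E\<close> bound the two failure modes of the
      remaining \<open>k\<close> rounds once \<open>x\<close> has been drawn.\<close>
    let ?J = "\<lambda>x. if jordan \<or> jordan_hit n (cycle_type n x) then 0 else ?a ^ k"
    let ?E = "\<lambda>x. if rs = [] \<or> elimination_hit n (cycle_type n x) then 0 else ?b ^ k"
    have f_le: "pmf (f x) False \<le> ?J x + ?E x" for x
    proof (cases "real (size (cycle_type n x)) < 2 * ln (real n)")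
      case True
      let ?T = "cycle_type n x"
      let ?rs = "filter (\<lambda>r. \<not> eliminates n ?T r) rs"
      have 1: "f x = altsym_loop n G k (jordan \<or> jordan_test n ?T) ?rs"
        unfolding f_def Let_def using True by simp
      have 2: "?rs = []" if "elimination_hit n ?T"
        using that Suc.prems by (auto simp: elimination_hit_def filter_empty_conv)
      have 3: "jordan_hit n ?T \<longleftrightarrow> jordan_test n ?T" using True by (simp add: jordan_hit_def)
      have "pmf (f x) False \<le> (if jordan \<or> jordan_test n ?T then 0 else ?a ^ k) +
          (if ?rs = [] then 0 else ?b ^ k)"
        unfolding 1 by (rule Suc.IH) (use Suc.prems in auto)
      also have "(if ?rs = [] then 0 else ?b ^ k) \<le> ?E x" using 2 nn by auto
      finally show ?thesis using 3 by simp
    next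
      case False
      then have "f x = altsym_loop n G k jordan rs" "\<not> jordan_hit n (cycle_type n x)"
        "\<not> elimination_hit n (cycle_type n x)"
        unfolding f_def Let_def jordan_hit_def elimination_hit_def by auto
      then show ?thesis using Suc.IH[OF Suc.prems, of jordan] by simp
    qed
    have "altsym_loop n G (Suc k) jordan rs = bind_pmf (pmf_of_set G) f"
      unfolding f_def altsym_loop.simps using False by (simp only: if_False)
    then have "pmf (altsym_loop n G (Suc k) jordan rs) False = (\<Sum>x\<in>G. pmf (f x) False) / card G"
      using G by (simp add: pmf_bind_pmf_of_set)
    also have "\<dots> \<le> (\<Sum>x\<in>G. ?J x + ?E x) / card G"
      using f_le by (intro divide_right_mono sum_mono) auto
    also have "\<dots> = (\<Sum>x\<in>G. ?J x) / card G + (\<Sum>x\<in>G. ?E x) / card G"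
      by (simp only: sum.distrib add_divide_distrib)
    \<comment> \<open>Averaging over the drawn element restricts to the misses and supplies one more
      factor \<open>?a\<close>.\<close>
    also have "(\<Sum>x\<in>G. ?J x) / card G = (if jordan then 0 else ?a ^ Suc k)"
    proof (cases jordan)
      case False
      then have "(\<Sum>x\<in>G. ?J x) = (\<Sum>x\<in>{x\<in>G. \<not> jordan_hit n (cycle_type n x)}. ?a ^ k)"
        using G by (intro sum.mono_neutral_cong_right) auto
      then show ?thesis using False by (simp add: miss_fraction_def)
    qed simp
    also have "(\<Sum>x\<in>G. ?E x) / card G = (if rs = [] then 0 else ?b ^ Suc k)"
    proof (cases "rs = []")
      case False
      then have "(\<Sum>x\<in>G. ?E x) = (\<Sum>x\<in>{x\<in>G. \<not> elimination_hit n (cycle_type n x)}. ?b ^ k)"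
        using G by (intro sum.mono_neutral_cong_right) auto
      then show ?thesis using False by (simp add: miss_fraction_def)
    qed simp
    finally show ?thesis .
  qed
qed

text \<open>For \<open>a \<noteq> b\<close> a third point \<open>c\<close> completes a 3-cycle, an
  even permutation, that maps \<open>a\<close> to \<open>b\<close>.\<close>

lemma transitive_perms_alt:
  assumes n: "n \<ge> 3" and G: "carrier (alt_group n) \<subseteq> G"
  shows "transitive_perms n G"
  unfolding transitive_perms_def
proof (intro ballI)
  fix a b assume ab: "a \<in> {1..n}" "b \<in> {1..n}"
  show "\<exists>g\<in>G. g a = b"
  proof (cases "a = b")
    case True
    have "id \<in> carrier (alt_group n)" by (simp add: alt_group_carrier)
    then show ?thesis using True G by (intro bexI[of _ id]) auto
  next
    case False
    have "card ({1..n} - {a, b}) \<ge> 1" using n ab False by (simp add: card_Diff_subset)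
    then obtain c where c: "c \<in> {1..n}" "c \<noteq> a" "c \<noteq> b"
      by (metis Diff_iff card.empty empty_iff equals0I insertI1 insertI2 not_one_le_zero)
    define g where "g = Transposition.transpose a c \<circ> Transposition.transpose a b"
    have "g permutes {1..n}" unfolding g_def
      using ab c by (intro permutes_compose permutes_swap_id) auto
    moreover have "evenperm g" unfolding g_def
      using False c by (subst evenperm_comp) (auto simp: permutation_swap_id evenperm_swap)
    moreover have "g a = b" unfolding g_def using False c by (simp add: transpose_def)
    ultimately show ?thesis using G by (auto simp: alt_group_carrier)
  qed
qed

section \<open>Groups between the alternating and the symmetric group\<close>

context
  fixes n :: nat and G :: "(nat \<Rightarrow> nat) set"
  assumes n: "n \<ge> 3" and G: "subgroup G (sym_group n)" "carrier (alt_group n) \<subseteq> G"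
begin

lemma group_permutes: "x \<in> G \<Longrightarrow> x permutes {1..n}"
  using subgroup.subset[OF G(1)] by (auto simp: sym_group_carrier)

lemma finite_group: "finite G"
  by (rule finite_subset[OF _ finite_permutations[of "{1..n}"]]) (use group_permutes in auto)

lemma group_nonempty: "G \<noteq> {}"
  using subgroup.one_closed[OF G(1)] by auto

lemma card_group_ge: "fact n \<le> 2 * real (card G)"
proof -
  have "2 * card (carrier (alt_group n)) = fact n"
    by (rule alt_group_card_carrier) (use n in simp)
  moreover have "card (carrier (alt_group n)) \<le> card G" by (rule card_mono[OF finite_group G(2)])
  ultimately have "fact n \<le> 2 * card G" by linarith
  then have "real (fact n) \<le> real (2 * card G)" by (simp only: of_nat_le_iff)
  then show ?thesis by simp
qed

lemma altsym_test_False_le: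
  "pmf (altsym_test n G k) False \<le>
    miss_fraction n G (jordan_hit n) ^ k + miss_fraction n G (elimination_hit n) ^ k"
proof -
  let ?rs = "filter (\<lambda>r. r dvd n) [2..<n]"
  have "pmf (altsym_test n G k) False = pmf (altsym_loop n G k False ?rs) False"
    unfolding altsym_test_def using transitive_perms_alt[OF n G(2)] by simp
  also have "\<dots> \<le> (if False then 0 else miss_fraction n G (jordan_hit n) ^ k) +
    (if ?rs = [] then 0 else miss_fraction n G (elimination_hit n) ^ k)"
    by (rule altsym_loop_False_le[OF finite_group group_nonempty]) auto
  also have "\<dots> \<le> miss_fraction n G (jordan_hit n) ^ k + miss_fraction n G (elimination_hit n) ^ k"
    by (simp add: miss_fraction_def)
  finally show ?thesis .
qed

text \<open>\<open>G\<close> contains at least half of all permutations, so passing from the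
  symmetric group to \<open>G\<close> at most doubles a probability.\<close>

lemma miss_fraction_le:
  assumes "\<And>x. x permutes {1..n} \<Longrightarrow> \<not> P (cycle_type n x) \<Longrightarrow> Q (cycle_type n x)"
  shows "miss_fraction n G P \<le> 2 * perm_fraction n Q"
proof -
  have cG: "card G > 0" using finite_group group_nonempty by (simp add: card_gt_0_iff)
  let ?S = "{x. x permutes {1..n} \<and> Q (cycle_type n x)}"
  have "finite ?S" by (rule finite_subset[OF _ finite_permutations[of "{1..n}"]]) auto
  then have "card {x \<in> G. \<not> P (cycle_type n x)} \<le> card ?S"
    using assms group_permutes by (intro card_mono) auto
  then have "miss_fraction n G P \<le> real (card ?S) / real (card G)"
    unfolding miss_fraction_def by (intro divide_right_mono) auto
  also have "\<dots> \<le> real (card ?S) / (fact n / 2)"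
    using card_group_ge cG by (intro divide_left_mono) auto
  finally show ?thesis by (simp add: perm_fraction_def mult.commute)
qed

text \<open>One hit in \<open>G\<close> suffices, since \<open>G\<close> has at most
  \<open>fact n\<close> elements.\<close>

lemma miss_fraction_less:
  assumes "x \<in> G" "P (cycle_type n x)"
  shows "miss_fraction n G P \<le> 1 - 1 / fact n"
proof -
  have cG: "card G > 0" using finite_group group_nonempty by (simp add: card_gt_0_iff)
  have "card {x \<in> G. \<not> P (cycle_type n x)} \<le> card (G - {x})"
    using assms finite_group by (intro card_mono) auto
  also have "\<dots> = card G - 1" using assms finite_group by simp
  finally have "real (card {x \<in> G. \<not> P (cycle_type n x)}) \<le> real (card G) - 1" using cG by linarith
  then have "miss_fraction n G P \<le> (real (card G) - 1) / real (card G)"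
    unfolding miss_fraction_def by (intro divide_right_mono) auto
  also have "\<dots> = 1 - 1 / real (card G)" using cG by (simp add: field_simps)
  also have "\<dots> \<le> 1 - 1 / fact n"
  proof -
    have "card G \<le> card {x. x permutes {1..n}}"
      by (intro card_mono) (use group_permutes finite_permutations[of "{1..n}"] in auto)
    also have "\<dots> = fact n" by (rule card_permutations) auto
    finally have "real (card G) \<le> real (fact n)" by (simp only: of_nat_le_iff)
    then have "real (card G) \<le> fact n" by simp
    then have "1 / fact n \<le> 1 / real (card G)" using cG by (intro divide_left_mono) auto
    then show ?thesis by simp
  qed
  finally show ?thesis .
qed

text \<open>If \<open>G\<close> contains an odd \<open>x\<close>, an odd \<open>y\<close> is the
  product of \<open>x\<close> and the even permutation \<open>inv' x \<circ> y\<close>.\<close>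

lemma full_group:
  assumes "G \<noteq> carrier (alt_group n)" "y permutes {1..n}"
  shows "y \<in> G"
proof (cases "evenperm y")
  case True
  then show ?thesis using assms G(2) by (auto simp: alt_group_carrier)
next
  case False
  obtain x where x: "x \<in> G" "x \<notin> carrier (alt_group n)" using assms(1) G(2) by auto
  then have xp: "x permutes {1..n}" "\<not> evenperm x" using group_permutes by (auto simp: alt_group_carrier)
  have perm: "permutation x" "permutation y"
    using permutes_imp_permutation[OF _ xp(1)] permutes_imp_permutation[OF _ assms(2)] by auto
  have "inv' x \<circ> y permutes {1..n}" using xp assms by (intro permutes_compose permutes_inv) auto
  moreover have "evenperm (inv' x \<circ> y)"
    using perm xp False by (simp add: evenperm_comp evenperm_inv permutation_inverse)
  ultimately have "inv' x \<circ> y \<in> G" using G(2) by (auto simp: alt_group_carrier)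
  then have "x \<otimes>\<^bsub>sym_group n\<^esub> (inv' x \<circ> y) \<in> G" using subgroup.m_closed[OF G(1) x(1)] by blast
  moreover have "x \<circ> (inv' x \<circ> y) = y"
    using permutes_inv_o(1)[OF xp(1)] by (simp add: o_assoc)
  ultimately show ?thesis by (simp add: sym_group_mult)
qed

end

section \<open>Explicit elements\<close>

text \<open>Realise the cycles one at a time on disjoint subsets; a full cycle on \<open>C\<close>
  exists because \<open>card_cyclic_perms\<close> counts a positive number of them.\<close>

lemma exists_cycle_mset:
  assumes "finite A" "0 \<notin># T" "\<Sum>\<^sub># T = card A"
  shows "\<exists>x. x permutes A \<and> cycle_mset A x = T"
  using assms
proof (induction T arbitrary: A)
  case empty
  then have "A = {}" by simp
  then have "cycle_mset A id = {#}" by (simp add: cycle_mset_def)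
  then show ?case using permutes_id by blast
next
  case (add l T)
  have "l \<le> card A" "l > 0" using add.prems by auto
  obtain C where C: "C \<subseteq> A" "card C = l" "finite C"
    using obtain_subset_with_card_n[OF \<open>l \<le> card A\<close>] by metis
  then obtain a where a: "a \<in> C" using \<open>l > 0\<close> by fastforce
  have "card (cyclic_perms a C) \<noteq> 0" using card_cyclic_perms[OF C(3) a] by simp
  then obtain s where "s \<in> cyclic_perms a C" by (metis card.empty ex_in_conv)
  then have s: "s permutes C" "orbit s a = C" by (auto simp: cyclic_perms_def)
  have "\<Sum>\<^sub># T = card (A - C)" using add.prems C by (simp add: card_Diff_subset)
  then obtain t where t: "t permutes A - C" "cycle_mset (A - C) t = T"
    using add.IH[of "A - C"] add.prems by auto
  have "s \<circ> t permutes A"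
    by (intro permutes_compose permutes_subset[OF s(1) C(1)] permutes_subset[OF t(1)]) auto
  moreover have "cycle_mset A (s \<circ> t) = add_mset l T"
    using cycle_mset_comp_Diff[OF add.prems(1) C(1) s(1) t(1)] cycle_mset_single[OF s(2) a s(1) C(3)] t C
    by simp
  ultimately show ?case by blast
qed

lemma sign_funpow:
  assumes "x permutes A" "finite A"
  shows "sign (x ^^ k) = sign x ^ k"
proof (induction k)
  case (Suc k)
  have "permutation x" "permutation (x ^^ k)"
    using permutes_imp_permutation[OF assms(2)] assms(1) permutes_funpow[OF assms(1)] by auto
  then show ?case using Suc sign_compose[of x "x ^^ k"] by (simp add: o_def)
qed (simp add: id_def[symmetric])

text \<open>The product \<open>?N\<close> of the lengths is odd and satisfies
  \<open>x ^^ ?N = id\<close>, so an odd power of the sign is 1.\<close>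

lemma evenperm_odd_cycles:
  assumes x: "x permutes A" "finite A" and odd: "\<And>l. l \<in># cycle_mset A x \<Longrightarrow> odd l"
  shows "evenperm x"
proof -
  let ?N = "\<Prod>\<^sub># (cycle_mset A x)"
  have "(x ^^ ?N) a = a" for a
  proof (cases "a \<in> A")
    case True
    then have "card (orbit x a) \<in># cycle_mset A x" using x(2) by (auto simp: cycle_mset_def)
    then show ?thesis using funpow_fixes_iff[OF x] dvd_prod_mset by blast
  next
    case False
    then show ?thesis using permutes_not_in[OF permutes_funpow[OF x(1)]] by blast
  qed
  then have "x ^^ ?N = id" by (simp add: fun_eq_iff)
  then have "sign x ^ ?N = 1" using sign_funpow[OF x, of ?N] by simp
  moreover have "odd ?N"
  proof -
    have "odd (\<Prod>\<^sub># M)" if "\<And>l. l \<in># M \<Longrightarrow> odd l" for M :: "nat multiset"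
      using that by (induction M) auto
    then show ?thesis using odd by blast
  qed
  ultimately show ?thesis by (cases x rule: sign_cases) (auto simp: sign_def split: if_splits)
qed

lemma exists_alternating_odd_cycles:
  assumes "\<And>l. l \<in># T \<Longrightarrow> odd l" "\<Sum>\<^sub># T = n"
  obtains x where "x \<in> carrier (alt_group n)" "cycle_type n x = T"
proof -
  have "0 \<notin># T" using assms(1) by force
  then obtain x where x: "x permutes {1..n}" "cycle_mset {1..n} x = T"
    using exists_cycle_mset[of "{1..n}" T] assms(2) by auto
  then have "evenperm x" using evenperm_odd_cycles[OF x(1)] assms(1) by auto
  then show ?thesis using that x by (simp add: alt_group_carrier cycle_type_eq)
qed

text \<open>The exponent \<open>i\<close> turns the other cycles into fixed points and, being
  coprime to \<open>l\<close>, keeps the chosen cycle whole; the result is of type (J1).\<close>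

lemma jordan_test_single_cycle:
  assumes x: "x permutes {1..n}" and T: "cycle_type n x = add_mset l T"
    and i: "\<And>j. j \<in># T \<Longrightarrow> j dvd i" "coprime l i" and l: "1 < l" "l < n - 2"
  shows "jordan_test n (cycle_type n x)"
proof -
  have "cycle_type n (x ^^ i) = {#l#} + replicate_mset (n - l) 1"
    using cycle_mset_funpow[OF x _ _ i(1), of l] T i(2) by (simp add: cycle_type_eq)
  then have "jordan_type1 n (cycle_type n (x ^^ i))"
    unfolding jordan_type1_def using l by blast
  then show ?thesis unfolding jordan_test_def Let_def using x by blast
qed

text \<open>Up to three cycles are few enough for the test from degree 5 on, since
  \<open>exp 3 < 25 \<le> n * n\<close>.\<close>

lemma three_less_ln:
  assumes "n \<ge> 5"
  shows "3 < 2 * ln (real n)"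
proof -
  have "exp (3::real) = exp 1 ^ 3" by (simp add: exp_of_nat_mult[symmetric])
  also have "\<dots> \<le> (272 / 100) ^ 3" using e_less_272 by (intro power_mono) auto
  also have "\<dots> < 25" by (simp add: power3_eq_cube)
  also have "\<dots> \<le> real n * real n" using assms mult_mono[of 5 "real n" 5 "real n"] by simp
  finally have "ln (exp 3) < ln (real n * real n)" using assms by (subst ln_less_cancel_iff) auto
  then show ?thesis using assms by (simp add: ln_mult)
qed

text \<open>Take one cycle of odd length \<open>n - k\<close> and \<open>k\<close> fixed points,
  where \<open>k\<close> is 1 or 2 and coprime to \<open>n\<close>. Either the long cycle fills its
  blocks alone, so that the block size divides \<open>n - k\<close> and \<open>n\<close>, hence is
  1; or a fixed point helps, so that \<open>c = 1\<close> and the long cycle lies in a single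
  block.\<close>

lemma exists_elimination_hit:
  assumes n: "n \<ge> 5"
  obtains x where "x \<in> carrier (alt_group n)" "elimination_hit n (cycle_type n x)"
proof -
  define k where "k = (if even n then 1 else 2 :: nat)"
  let ?l = "n - k"
  let ?T = "add_mset ?l (replicate_mset k 1)"
  have k: "k \<le> 2" "odd ?l" "coprime k n" using n by (auto simp: k_def coprime_right_2_iff_odd coprime_commute)
  obtain x where x: "x \<in> carrier (alt_group n)" "cycle_type n x = ?T"
    by (rule exists_alternating_odd_cycles[of ?T n]) (use k n in \<open>auto split: if_splits\<close>)
  have "eliminates n ?T r" if r: "r dvd n" "1 < r" "r < n" for r
  proof -
    let ?s = "n div r"
    have n_eq: "n = r * ?s" using r by simp
    then have s: "?s \<noteq> 1" using r by (metis less_irrefl mult_1_right)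
    have "2 * ?s \<le> n" using n_eq r mult_le_mono1[of 2 r ?s] by linarith
    then have s2: "?s < ?l" using n k by linarith
    have "\<not> (\<exists>c\<ge>1. c dvd ?l \<and> ?l \<le> c * ?s \<and> c \<le> r \<and>
        (\<exists>M. M \<subseteq># ?T - {#?l#} \<and> (\<forall>j\<in>#M. c dvd j) \<and> \<Sum>\<^sub># M = c * ?s - ?l))"
    proof clarify
      fix c M assume c: "1 \<le> c" "?l \<le> c * ?s"
        and M: "M \<subseteq># ?T - {#?l#}" "\<forall>j\<in>#M. c dvd j" "\<Sum>\<^sub># M = c * ?s - ?l"
      show False
      proof (cases "M = {#}")
        case True
        then have "c * ?s = ?l" using M c by simp
        then have "?s dvd ?l" by (metis dvd_triv_right)
        moreover have "?s dvd n" using n_eq by (metis dvd_triv_right)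
        moreover have "k = n - ?l" using k n by simp
        ultimately have "?s dvd k" using dvd_diff_nat by metis
        then have "?s dvd 1" using k(3) \<open>?s dvd n\<close> by (meson coprime_common_divisor)
        then show False using s by simp
      next
        case False
        then obtain j where j: "j \<in># M" by (meson multiset_nonemptyE)
        then have "j \<in># replicate_mset k 1" using M(1) by (metis add_mset_remove_trivial mset_subset_eqD)
        then have "j = 1" by (metis in_replicate_mset)
        then have "c = 1" using M(2) j by auto
        \<comment> \<open>A single block has at most \<open>n / 2\<close> points, fewer than the
          long cycle because \<open>n \<ge> 5\<close>.\<close>
        then show False using c s2 by simp
      qed
    qed
    then show ?thesis unfolding eliminates_def Let_def by (intro bexI[of _ ?l]) auto
  qed
  moreover have "real (size ?T) < 2 * ln (real n)"
    using three_less_ln[OF n] k by simp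
  ultimately show ?thesis using that[of x] x by (simp add: elimination_hit_def)
qed

text \<open>For even \<open>n\<close> take two cycles of odd coprime lengths, and isolate the
  shorter one by raising to the length of the longer. For odd \<open>n\<close> take two
  transpositions and a cycle of length \<open>n - 4\<close>, and isolate the latter by
  squaring.\<close>

lemma exists_alternating_jordan_hit:
  assumes n: "n \<ge> 7"
  obtains x where "x \<in> carrier (alt_group n)" "jordan_hit n (cycle_type n x)"
proof (cases "even n")
  case True
  then obtain m where m: "n = 2 * m" by (elim evenE)
  \<comment> \<open>The parity of \<open>d\<close> is opposite to that of \<open>m\<close>, which
    makes both lengths \<open>m - d\<close> and \<open>m + d\<close> odd.\<close>
  define d where "d = (if even m then 1 else 2 :: nat)"
  define l where "l = m - d"
  have d: "d \<le> 2" "d \<ge> 1" "m \<ge> 4" using n m by (auto simp: d_def)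
  then have l: "m = l + d" "n = l + (l + 2 * d)" by (auto simp: l_def m)
  have "odd l" using d by (auto simp: l_def d_def)
  have cop: "coprime l (l + 2 * d)"
  proof -
    \<comment> \<open>True for the values 1 and 2 only; the two odd lengths differ by a power of 2
      and are therefore coprime.\<close>
    have "2 * d = 2 ^ d" by (simp add: d_def)
    moreover have "coprime l (2 ^ d)" using \<open>odd l\<close> by (simp add: coprime_right_2_iff_odd)
    ultimately show ?thesis by (metis coprime_add_one_right coprime_iff_gcd_eq_1 gcd_add2 add.commute)
  qed
  let ?T = "add_mset l {#l + 2 * d#}"
  obtain x where x: "x \<in> carrier (alt_group n)" "cycle_type n x = ?T"
    by (rule exists_alternating_odd_cycles[of ?T n]) (use \<open>odd l\<close> l in auto)
  have "l \<noteq> 1" using d n m \<open>odd l\<close> by (auto simp: l_def d_def split: if_splits)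
  then have "1 < l" using \<open>odd l\<close> by (cases l) auto
  have "jordan_test n (cycle_type n x)"
  proof (rule jordan_test_single_cycle)
    show "x permutes {1..n}" using x by (simp add: alt_group_carrier)
    show "\<And>j. j \<in># {#l + 2 * d#} \<Longrightarrow> j dvd l + 2 * d" by simp
    show "l < n - 2" using l \<open>1 < l\<close> d by linarith
  qed (use x cop \<open>1 < l\<close> in auto)
  then show ?thesis using that[of x] x three_less_ln[of n] n by (simp add: jordan_hit_def)
next
  case False
  \<comment> \<open>The points 1 to 4 are reserved for the two transpositions, whose product is
    even.\<close>
  let ?A = "{5..n}"
  have "?A \<noteq> {}" using n by simp
  obtain t where t: "t permutes ?A" "cycle_mset ?A t = {#n - 4#}"
    using exists_cycle_mset[of ?A "{#n - 4#}"] n by auto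
  have tr: "cycle_mset {a, b} (Transposition.transpose a b) = {#2#}" if "a \<noteq> b" for a b :: nat
  proof -
    have p: "Transposition.transpose a b permutes {a, b}" by (rule permutes_swap_id) auto
    have "orbit (Transposition.transpose a b) a \<subseteq> {a, b}" by (rule permutes_orbit_subset[OF p]) simp
    moreover have "a \<in> orbit (Transposition.transpose a b) a" by (rule permutes_self_in_orbit[OF p]) simp
    moreover have "b \<in> orbit (Transposition.transpose a b) a"
      using orbit.base[of "Transposition.transpose a b" a] by simp
    ultimately have "orbit (Transposition.transpose a b) a = {a, b}" by auto
    from cycle_mset_single[OF this _ p] show ?thesis using that by simp
  qed
  define u where "u = Transposition.transpose 3 4 \<circ> t"
  define x where "x = Transposition.transpose 1 2 \<circ> u"
  have p: "Transposition.transpose (3::nat) 4 permutes {3, 4}" "Transposition.transpose (1::nat) 2 permutes {1, 2}"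
    by (auto intro: permutes_swap_id)
  have A: "{3, 4} \<union> ?A = {3..n}" "{1, 2} \<union> {3..n} = {1..n}" using n by auto
  have up: "u permutes {3..n}"
    unfolding u_def A(1)[symmetric] by (rule comp_permutes_Un) (use p t in auto)
  have ut: "cycle_mset {3..n} u = {#2#} + {#n - 4#}"
    unfolding u_def A(1)[symmetric] by (subst cycle_mset_comp) (use p t tr in auto)
  have xp: "x permutes {1..n}"
    unfolding x_def A(2)[symmetric] by (rule comp_permutes_Un) (use p up in auto)
  have xt: "cycle_type n x = {#2#} + ({#2#} + {#n - 4#})"
    unfolding cycle_type_eq x_def A(2)[symmetric] by (subst cycle_mset_comp) (use p up ut tr in auto)
  have "evenperm t" by (rule evenperm_odd_cycles[OF t(1)]) (use False n in \<open>auto simp: t(2)\<close>)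
  moreover have "permutation t" "permutation u"
    using permutes_imp_permutation[OF _ t(1)] permutes_imp_permutation[OF _ up] by auto
  ultimately have "evenperm x"
    unfolding x_def u_def by (simp add: evenperm_comp permutation_compose permutation_swap_id evenperm_swap)
  have "jordan_test n (cycle_type n x)"
  proof (rule jordan_test_single_cycle[OF xp])
    show "cycle_type n x = add_mset (n - 4) {#2, 2#}" by (simp add: xt)
    show "\<And>j. j \<in># {#2, 2#} \<Longrightarrow> j dvd (2::nat)" by auto
    show "coprime (n - 4) 2" using False n by (simp add: coprime_right_2_iff_odd)
  qed (use n in auto)
  then show ?thesis
    using that[of x] xp \<open>evenperm x\<close> three_less_ln[of n] n
    by (simp add: jordan_hit_def alt_group_carrier xt)
qed

text \<open>The type is a 3-cycle and a transposition, with one fixed point in degree 6. Its cube is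
  a transposition, which is of type (J1). The element is odd, so it serves only for the full
  symmetric group.\<close>

lemma exists_jordan_hit_small:
  assumes "n = 5 \<or> n = 6"
  obtains x where "x permutes {1..n}" "jordan_hit n (cycle_type n x)"
proof -
  define T where "T = {#3#} + replicate_mset (n - 5) (1::nat)"
  have T: "\<Sum>\<^sub># (add_mset 2 T) = n" "0 \<notin># add_mset 2 T" "size (add_mset 2 T) \<le> 3"
    using assms by (auto simp: T_def)
  obtain x where x: "x permutes {1..n}" "cycle_mset {1..n} x = add_mset 2 T"
    using exists_cycle_mset[of "{1..n}" "add_mset 2 T"] T by auto
  have "jordan_test n (cycle_type n x)"
  proof (rule jordan_test_single_cycle[OF x(1)])
    show "cycle_type n x = add_mset 2 T" using x by (simp add: cycle_type_eq)
    show "\<And>j. j \<in># T \<Longrightarrow> j dvd 3" by (auto simp: T_def split: if_splits)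
  qed (use assms in auto)
  moreover have "real (size (cycle_type n x)) < 2 * ln (real n)"
    using three_less_ln[of n] T(3) x assms by (auto simp: cycle_type_eq)
  ultimately show ?thesis using that x by (simp add: jordan_hit_def)
qed

section \<open>Large and small degrees combined\<close>

lemma typical_hits:
  assumes "n \<ge> 2" "exp (ln (real n) / 96) \<ge> 2" "x permutes {1..n}"
    "typical n (exp (ln (real n) / 96)) (cycle_type n x)"
  shows "jordan_hit n (cycle_type n x)" "elimination_hit n (cycle_type n x)"
proof -
  have q: "exp (ln (real n) / 96) ^ 96 = real n"
    using assms(1) by (simp add: exp_power)
  note t = assms(3) refl assms(2) q assms(4)
  show "jordan_hit n (cycle_type n x)"
    unfolding jordan_hit_def using typical_few_cycles[OF t] typical_jordan_test[OF t] by blast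
  show "elimination_hit n (cycle_type n x)"
    unfolding elimination_hit_def using typical_few_cycles[OF t] typical_eliminates[OF t] by blast
qed

lemma miss_fractions_large:
  assumes "\<delta> > 0"
  shows "\<exists>N. \<forall>n G. n \<ge> N \<and> subgroup G (sym_group n) \<and> carrier (alt_group n) \<subseteq> G \<longrightarrow>
    miss_fraction n G (jordan_hit n) < \<delta> \<and> miss_fraction n G (elimination_hit n) < \<delta>"
proof -
  let ?q = "\<lambda>n::nat. exp (ln (real n) / 96)"
  have "\<forall>\<^sub>F n in sequentially. perm_fraction n (\<lambda>T. \<not> typical n (?q n) T) < \<delta> / 2"
    using atypical_tendsto_0 assms by (intro order_tendstoD(2)) auto
  moreover have "\<forall>\<^sub>F n in sequentially. ?q n \<ge> 2" by real_asymp
  moreover have "\<forall>\<^sub>F n in sequentially. n \<ge> (3::nat)" by (rule eventually_ge_at_top)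
  ultimately have "\<forall>\<^sub>F n in sequentially. n \<ge> 3 \<and> ?q n \<ge> 2 \<and>
      perm_fraction n (\<lambda>T. \<not> typical n (?q n) T) < \<delta> / 2"
    by eventually_elim auto
  then obtain N where N: "n \<ge> 3" "?q n \<ge> 2" "perm_fraction n (\<lambda>T. \<not> typical n (?q n) T) < \<delta> / 2"
    if "n \<ge> N" for n
    unfolding eventually_sequentially by blast
  have "miss_fraction n G (jordan_hit n) < \<delta> \<and> miss_fraction n G (elimination_hit n) < \<delta>"
    if n: "n \<ge> N" and G: "subgroup G (sym_group n)" "carrier (alt_group n) \<subseteq> G" for n G
  proof -
    have "miss_fraction n G P \<le> 2 * perm_fraction n (\<lambda>T. \<not> typical n (?q n) T)"
      if "P = jordan_hit n \<or> P = elimination_hit n" for P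
      by (rule miss_fraction_le[OF N(1)[OF n] G]) (use typical_hits[OF _ N(2)[OF n]] N(1)[OF n] that in auto)
    then show ?thesis using N(3)[OF n] by fastforce
  qed
  then show ?thesis by blast
qed

lemma miss_fractions_le:
  assumes G: "subgroup G (sym_group n)" "carrier (alt_group n) \<subseteq> G" and n: "\<not> exceptional_input n G"
  shows "miss_fraction n G (jordan_hit n) \<le> 1 - 1 / fact n"
    "miss_fraction n G (elimination_hit n) \<le> 1 - 1 / fact n"
proof -
  have n5: "n \<ge> 5" and ne: "n \<ge> 7 \<or> G \<noteq> carrier (alt_group n)"
    using n by (auto simp: exceptional_input_def)
  then have n3: "n \<ge> 3" by simp
  obtain x where "x \<in> carrier (alt_group n)" "elimination_hit n (cycle_type n x)"
    by (rule exists_elimination_hit[OF n5])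
  then show "miss_fraction n G (elimination_hit n) \<le> 1 - 1 / fact n"
    using miss_fraction_less[OF n3 G] G(2) by blast
  have "\<exists>x\<in>G. jordan_hit n (cycle_type n x)"
  proof (cases "n \<ge> 7")
    case True
    then show ?thesis using exists_alternating_jordan_hit[OF True] G(2) by (metis subsetD)
  next
    case False
    then have "n = 5 \<or> n = 6" "G \<noteq> carrier (alt_group n)" using n5 ne by auto
    then show ?thesis using exists_jordan_hit_small full_group[OF n3 G] by metis
  qed
  then show "miss_fraction n G (jordan_hit n) \<le> 1 - 1 / fact n"
    using miss_fraction_less[OF n3 G] by blast
qed

text \<open>From some degree \<open>N0\<close> on, both miss fractions are below
  \<open>\<epsilon> / 2\<close>, so a single round suffices. Below \<open>N0\<close> the miss
  fractions have the common bound \<open>c < 1\<close>, and \<open>K\<close> rounds push both powers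
  below \<open>\<epsilon> / 2\<close>.\<close>

lemma altsym_test_False_less:
  fixes \<epsilon> :: real
  assumes "\<epsilon> > 0"
  obtains N0 K where "K \<ge> 1"
    "\<And>n G k. n \<ge> N0 \<Longrightarrow> subgroup G (sym_group n) \<Longrightarrow> carrier (alt_group n) \<subseteq> G \<Longrightarrow>
       \<not> exceptional_input n G \<Longrightarrow> k \<ge> 1 \<Longrightarrow> pmf (altsym_test n G k) False < \<epsilon>"
    "\<And>n G. n < N0 \<Longrightarrow> subgroup G (sym_group n) \<Longrightarrow> carrier (alt_group n) \<subseteq> G \<Longrightarrow>
       \<not> exceptional_input n G \<Longrightarrow> pmf (altsym_test n G K) False < \<epsilon>"
proof -
  \<comment> \<open>The bound by 1 ensures that further rounds do not increase the powers.\<close>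
  obtain N0 where N0: "miss_fraction n G (jordan_hit n) < min 1 (\<epsilon> / 2)"
      "miss_fraction n G (elimination_hit n) < min 1 (\<epsilon> / 2)"
    if "n \<ge> N0" "subgroup G (sym_group n)" "carrier (alt_group n) \<subseteq> G" for n G
    using miss_fractions_large[of "min 1 (\<epsilon> / 2)"] assms by auto
  define c where "c = 1 - 1 / (fact N0 :: real)"
  have c: "0 \<le> c" "c < 1" using fact_ge_1[of N0, where 'a=real] by (auto simp: c_def)
  then have "(\<lambda>k. c ^ k) \<longlonglongrightarrow> 0" by (intro LIMSEQ_power_zero) auto
  then have "\<forall>\<^sub>F k in sequentially. c ^ k < \<epsilon> / 2" using assms by (intro order_tendstoD(2)) auto
  then have "\<forall>\<^sub>F k in sequentially. c ^ k < \<epsilon> / 2 \<and> k \<ge> 1"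
    using eventually_ge_at_top[of 1] by eventually_elim auto
  then obtain K where K: "c ^ K < \<epsilon> / 2" "K \<ge> 1"
    unfolding eventually_sequentially by blast
  have nn: "miss_fraction n G P \<ge> 0" for n G P by (simp add: miss_fraction_def)
  have n3: "n \<ge> 3" if "\<not> exceptional_input n G" for n G
    using that by (simp add: exceptional_input_def)
  show ?thesis
  proof (rule that[OF K(2)])
    fix n G k
    assume A: "n \<ge> N0" "subgroup G (sym_group n)" "carrier (alt_group n) \<subseteq> G"
      "\<not> exceptional_input n G" "(k::nat) \<ge> 1"
    have "a ^ k \<le> a" if "0 \<le> a" "a \<le> 1" for a :: real
      using power_decreasing[of 1 k a] that A(5) by simp
    then have "miss_fraction n G P ^ k < \<epsilon> / 2" if "P = jordan_hit n \<or> P = elimination_hit n" for P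
      using N0[OF A(1-3)] that nn by (smt (verit))
    then show "pmf (altsym_test n G k) False < \<epsilon>"
      using altsym_test_False_le[OF n3[OF A(4)] A(2,3), of k] by (smt (verit) field_sum_of_halves)
  next
    fix n G
    assume A: "n < N0" "subgroup G (sym_group n)" "carrier (alt_group n) \<subseteq> G" "\<not> exceptional_input n G"
    have "(fact n :: real) \<le> fact N0" by (rule fact_mono) (use A in simp)
    then have "1 / (fact N0 :: real) \<le> 1 / fact n" by (intro divide_left_mono) auto
    then have "miss_fraction n G P ^ K < \<epsilon> / 2" if "P = jordan_hit n \<or> P = elimination_hit n" for P
    proof -
      have "miss_fraction n G P \<le> c"
        using miss_fractions_le[OF A(2-4)] that \<open>1 / (fact N0 :: real) \<le> 1 / fact n\<close>
        unfolding c_def by auto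
      then have "miss_fraction n G P ^ K \<le> c ^ K" using nn by (rule power_mono)
      then show ?thesis using K(1) by linarith
    qed
    then show "pmf (altsym_test n G K) False < \<epsilon>"
      using altsym_test_False_le[OF n3[OF A(4)] A(2,3), of K] by (smt (verit) field_sum_of_halves)
  qed
qed

theorem theorem11:
  shows "(\<forall>\<epsilon>::real. \<epsilon> > 0 \<longrightarrow> (\<forall>N::nat. N > 0 \<longrightarrow> (\<exists>k::nat.
            \<forall>n G. n \<ge> N \<and> subgroup G (sym_group n) \<and> carrier (alt_group n) \<subseteq> G \<and>
                  \<not> exceptional_input n G \<longrightarrow>
              pmf (altsym_test n G k) False < \<epsilon>)))
       \<and>
         (\<forall>\<epsilon>::real. \<epsilon> > 0 \<longrightarrow> (\<exists>k::nat \<Rightarrow> nat.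
            (\<forall>N > 0. \<forall>n G. n \<ge> N \<and> subgroup G (sym_group n) \<and> carrier (alt_group n) \<subseteq> G \<and>
                  \<not> exceptional_input n G \<longrightarrow>
              pmf (altsym_test n G (k N)) False < \<epsilon>) \<and>
            (\<forall>M N. 0 < M \<and> M \<le> N \<longrightarrow> k N \<le> k M) \<and>
            (\<lambda>N. real (k N)) \<longlonglongrightarrow> 1))"
    (is "?part1 \<and> ?part2")
proof
  show ?part2
  proof (intro allI impI)
    fix \<epsilon> :: real assume "\<epsilon> > 0"
    then obtain N0 K where K: "K \<ge> 1"
      and large: "\<And>n G k. n \<ge> N0 \<Longrightarrow> subgroup G (sym_group n) \<Longrightarrow> carrier (alt_group n) \<subseteq> G \<Longrightarrow>
       \<not> exceptional_input n G \<Longrightarrow> k \<ge> 1 \<Longrightarrow> pmf (altsym_test n G k) False < \<epsilon>"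
      and small: "\<And>n G. n < N0 \<Longrightarrow> subgroup G (sym_group n) \<Longrightarrow> carrier (alt_group n) \<subseteq> G \<Longrightarrow>
       \<not> exceptional_input n G \<Longrightarrow> pmf (altsym_test n G K) False < \<epsilon>"
      by (rule altsym_test_False_less) blast
    \<comment> \<open>A step function: it is non-increasing because \<open>K \<ge> 1\<close>, and
      eventually equal to 1. For \<open>N < N0\<close> the value \<open>K\<close> serves both the
      degrees below \<open>N0\<close> and those above.\<close>
    define k where "k = (\<lambda>N. if N < N0 then K else 1)"
    have "pmf (altsym_test n G (k N)) False < \<epsilon>"
      if "n \<ge> N" "subgroup G (sym_group n)" "carrier (alt_group n) \<subseteq> G" "\<not> exceptional_input n G" for N n G
      using large[of n G] small[of n G] that K by (cases "n < N0") (auto simp: k_def)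
    moreover have "\<forall>M N. 0 < M \<and> M \<le> N \<longrightarrow> k N \<le> k M" using K by (auto simp: k_def)
    moreover have "(\<lambda>N. real (k N)) \<longlonglongrightarrow> 1"
    proof (rule tendsto_eventually)
      show "\<forall>\<^sub>F N in sequentially. real (k N) = 1"
        using eventually_ge_at_top[of N0] by eventually_elim (simp add: k_def)
    qed
    ultimately show "\<exists>k::nat \<Rightarrow> nat.
            (\<forall>N > 0. \<forall>n G. n \<ge> N \<and> subgroup G (sym_group n) \<and> carrier (alt_group n) \<subseteq> G \<and>
                  \<not> exceptional_input n G \<longrightarrow>
              pmf (altsym_test n G (k N)) False < \<epsilon>) \<and>
            (\<forall>M N. 0 < M \<and> M \<le> N \<longrightarrow> k N \<le> k M) \<and>
            (\<lambda>N. real (k N)) \<longlonglongrightarrow> 1" by blast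
  qed
  then show ?part1 by meson
qed

end
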